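(* For every $p\ge 2$ there is a constant $C_p$ depending only on $p$ such that the following holds. Let $X_1,\ldots,X_N$ be independent copies of a random vector $X\sim\mu$ in $\mathbb{R}^d$ such that $\mathbb{E}[X]=0$ and $\mathrm{Cov}(X)=I_d$, let $\mu_N$ be the law of $\overline{X}_N=\frac{1}{\sqrt N}\sum_{i=1}^N X_i$, and let $\gamma=\mathcal{N}(0,I_d)$. Let $W$ be a solution to $$\min_{\substack{W':\mathbb{R}^d\to\mathcal{S}_+^d\\ \int \mathrm{tr}(W')\,\mathrm{d}\mu=\mathrm{tr}(\mathrm{Cov}_\mu)}} C(\mu,W')$$ with $C(\mu,W)=1$. Then $$\mathcal{W}_p(\mu_N,\gamma)\le \frac{C_p\,d^{1-2/p}}{\sqrt N}\left(\int \|W(x)-I_d\|_p^p\,\mathrm{d}\mu(x)\right)^{1/p},$$ where $\|\cdot\|_p$ is the matrix norm defined by $\|A\|_p^p=\sum_{i,j}|A_{ij}|^p$.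
   Context: $\mathcal{S}_+^d\subset\mathbb{R}^{d\times d}$ is the convex cone of symmetric positive-semidefinite matrices. For a probability measure $\mu$ on $\mathbb{R}^d$ and a (measurable) matrix field $W:\mathbb{R}^d\to\mathcal{S}_+^d$, the Poincaré constant $C(\mu,W)\in[0,\infty]$ is the smallest constant such that $$\mathrm{Var}_\mu(f)\le C(\mu,W)\int \nabla f(x)^\top W(x)\nabla f(x)\,\mathrm{d}\mu(x)$$ holds for every sufficiently smooth $f:\mathbb{R}^d\to\mathbb{R}$, understood here as every continuously differentiable $f$ with $\int f^2\,\mathrm{d}\mu<\infty$ and $\int \nabla f^\top W\nabla f\,\mathrm{d}\mu<\infty$; $\mathrm{Var}_\mu(f)=\int (f-\int f\,\mathrm{d}\mu)^2\,\mathrm{d}\mu$. $\mathrm{Cov}_\mu$ is the covariance matrix of $\mu$. The Wasserstein-$p$ distance is $\mathcal{W}_p(\mu_N,\gamma)=\left(\inf_{\pi\in\Pi(\mu_N,\gamma)}\int\|x-y\|^p\,\pi(\mathrm{d}x,\mathrm{d}y)\right)^{1/p}$, where $\Pi(\mu_N,\gamma)$ is the set of couplings of $\mu_N$ and $\gamma$ and $\|\cdot\|$ is the Euclidean norm. *)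

theory Defs
  imports "HOL-Probability.Probability"
begin

text \<open>
  A constant that is uniform in the dimension cannot be stated over \<open>real ^ 'n\<close>, since
  types cannot be quantified inside a formula. The space R^d is therefore represented by the
  functions on \<open>{..<d}\<close> that are undefined elsewhere, i.e. by the space of
  \<open>PiM {..<d} (\<lambda>_. borel)\<close>, and \<open>d \<times> d\<close> matrices by
  functions of two indices of which only the entries below \<open>d\<close> matter.
\<close>

type_synonym rvec = "nat \<Rightarrow> real"
type_synonym rmat = "nat \<Rightarrow> nat \<Rightarrow> real"

definition RR :: "nat \<Rightarrow> rvec set" where
  "RR d = ({..<d} \<rightarrow>\<^sub>E UNIV)"

definition borel_RR :: "nat \<Rightarrow> rvec measure" where
  "borel_RR d = PiM {..<d} (\<lambda>_. borel)"

definition edist :: "nat \<Rightarrow> rvec \<Rightarrow> rvec \<Rightarrow> real" where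
  "edist d x y = L2_set (\<lambda>i. x i - y i) {..<d}"

definition prob_on_RR :: "nat \<Rightarrow> rvec measure \<Rightarrow> bool" where
  "prob_on_RR d \<mu> \<longleftrightarrow> prob_space \<mu> \<and> sets \<mu> = sets (borel_RR d)"

definition psd :: "nat \<Rightarrow> rmat \<Rightarrow> bool" where
  "psd d A \<longleftrightarrow> (\<forall>i<d. \<forall>j<d. A i j = A j i) \<and>
     (\<forall>v :: rvec. 0 \<le> (\<Sum>i<d. \<Sum>j<d. v i * A i j * v j))"

definition tr :: "nat \<Rightarrow> rmat \<Rightarrow> real" where
  "tr d A = (\<Sum>i<d. A i i)"

definition id_mat :: rmat where
  "id_mat i j = (if i = j then 1 else 0)"

definition mean :: "rvec measure \<Rightarrow> nat \<Rightarrow> real" where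
  "mean \<mu> i = (\<integral>x. x i \<partial>\<mu>)"

definition cov :: "rvec measure \<Rightarrow> rmat" where
  "cov \<mu> i j = (\<integral>x. (x i - mean \<mu> i) * (x j - mean \<mu> j) \<partial>\<mu>)"

text \<open>
  The limit is taken in the product topology of \<open>nat \<Rightarrow> real\<close>, which on
  \<open>RR d\<close> is the Euclidean one; see \<open>eventually_at_within_RR\<close>.
\<close>

definition has_gradient :: "nat \<Rightarrow> (rvec \<Rightarrow> real) \<Rightarrow> rvec \<Rightarrow> rvec \<Rightarrow> bool" where
  "has_gradient d f v x \<longleftrightarrow>
     ((\<lambda>y. (f y - f x - (\<Sum>i<d. v i * (y i - x i))) / edist d y x) \<longlongrightarrow> 0) (at x within RR d)"

definition C1_grad :: "nat \<Rightarrow> (rvec \<Rightarrow> real) \<Rightarrow> (rvec \<Rightarrow> rvec) \<Rightarrow> bool" where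
  "C1_grad d f g \<longleftrightarrow> (\<forall>x\<in>RR d. has_gradient d f (g x) x) \<and>
     (\<forall>i<d. continuous_on (RR d) (\<lambda>x. g x i))"

lemma eventually_at_within_RR:
  assumes x: "x \<in> RR d"
  shows "eventually P (at x within RR d) \<longleftrightarrow>
    (\<exists>\<delta>>0. \<forall>y\<in>RR d. y \<noteq> x \<and> edist d y x < \<delta> \<longrightarrow> P y)"
proof
  assume "eventually P (at x within RR d)"
  then obtain S where S: "open S" "x \<in> S" "\<And>y. y \<in> S \<Longrightarrow> y \<noteq> x \<Longrightarrow> y \<in> RR d \<Longrightarrow> P y"
    unfolding eventually_at_topological by blast
  from product_topology_open_contains_basis[OF S(1)[unfolded open_fun_def] S(2)]
  obtain X where X: "x \<in> (\<Pi>\<^sub>E i\<in>UNIV. X i)" "\<And>i. open (X i)" "(\<Pi>\<^sub>E i\<in>UNIV. X i) \<subseteq> S"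
    by auto
  have "\<exists>e>0. ball (x i) e \<subseteq> X i" for i
    using X(1,2) open_contains_ball[of "X i"] by (auto simp: PiE_iff)
  then obtain e where e: "\<And>i. e i > 0" "\<And>i. ball (x i) (e i) \<subseteq> X i"
    by metis
  define \<delta> where "\<delta> = Min (insert 1 (e ` {..<d}))"
  have "\<delta> > 0" using e(1) by (auto simp: \<delta>_def)
  moreover have "P y" if y: "y \<in> RR d" "y \<noteq> x" "edist d y x < \<delta>" for y
  proof (rule S(3))
    have "y i \<in> X i" for i
    proof (cases "i < d")
      case True
      have "\<bar>y i - x i\<bar> \<le> edist d y x"
        using member_le_L2_set[of "{..<d}" i "\<lambda>i. \<bar>y i - x i\<bar>"] True
        by (simp add: edist_def L2_set_def)
      also have "\<dots> < \<delta>" by fact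
      also have "\<delta> \<le> e i" using True by (auto simp: \<delta>_def intro!: Min_le)
      finally have "y i \<in> ball (x i) (e i)" by (simp add: dist_real_def abs_minus_commute)
      then show ?thesis using e(2) by blast
    next
      case False
      then have "y i = x i" using x y(1) by (auto simp: RR_def PiE_iff extensional_def)
      then show ?thesis using X(1) by (auto simp: PiE_iff)
    qed
    then show "y \<in> S" using X(3) by (auto simp: PiE_iff)
  qed (use y in auto)
  ultimately show "\<exists>\<delta>>0. \<forall>y\<in>RR d. y \<noteq> x \<and> edist d y x < \<delta> \<longrightarrow> P y" by blast
next
  assume "\<exists>\<delta>>0. \<forall>y\<in>RR d. y \<noteq> x \<and> edist d y x < \<delta> \<longrightarrow> P y"
  then obtain \<delta> where \<delta>: "\<delta> > 0" "\<And>y. y \<in> RR d \<Longrightarrow> y \<noteq> x \<Longrightarrow> edist d y x < \<delta> \<Longrightarrow> P y"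
    by blast
  have "continuous_on UNIV (\<lambda>y. edist d y x)"
    unfolding edist_def L2_set_def
    by (intro continuous_intros continuous_on_product_coordinates)
  then have "open {y. edist d y x < \<delta>}"
    by (intro open_Collect_less) (auto intro: continuous_intros)
  moreover have "edist d x x < \<delta>" using \<delta>(1) by (simp add: edist_def L2_set_def)
  ultimately show "eventually P (at x within RR d)"
    unfolding eventually_at_topological using \<delta>(2) by (intro exI[of _ "{y. edist d y x < \<delta>}"]) auto
qed

definition energy :: "nat \<Rightarrow> rvec measure \<Rightarrow> (rvec \<Rightarrow> rmat) \<Rightarrow> (rvec \<Rightarrow> rvec) \<Rightarrow> ennreal" where
  "energy d \<mu> W g = (\<integral>\<^sup>+x. ennreal (\<Sum>i<d. \<Sum>j<d. g x i * W x i j * g x j) \<partial>\<mu>)"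

definition Var :: "rvec measure \<Rightarrow> (rvec \<Rightarrow> real) \<Rightarrow> ennreal" where
  "Var \<mu> f = (\<integral>\<^sup>+x. ennreal ((f x - (\<integral>y. f y \<partial>\<mu>))\<^sup>2) \<partial>\<mu>)"

text \<open>
  Since \<open>Inf {} = \<infinity>\<close>, the constant is infinite if no finite one works; the
  convention \<open>\<infinity> * 0 = 0\<close> on \<^typ>\<open>ennreal\<close> is immaterial.
\<close>

definition poincare_const :: "nat \<Rightarrow> rvec measure \<Rightarrow> (rvec \<Rightarrow> rmat) \<Rightarrow> ennreal" where
  "poincare_const d \<mu> W = Inf {c. \<forall>f g. C1_grad d f g \<longrightarrow> integrable \<mu> (\<lambda>x. (f x)\<^sup>2) \<longrightarrow>
     energy d \<mu> W g < \<infinity> \<longrightarrow> Var \<mu> f \<le> c * energy d \<mu> W g}"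

definition admissible :: "nat \<Rightarrow> rvec measure \<Rightarrow> (rvec \<Rightarrow> rmat) \<Rightarrow> bool" where
  "admissible d \<mu> W \<longleftrightarrow>
     (\<forall>i<d. \<forall>j<d. (\<lambda>x. W x i j) \<in> borel_measurable (borel_RR d)) \<and>
     (\<forall>x\<in>RR d. psd d (W x)) \<and>
     (\<integral>\<^sup>+x. ennreal (tr d (W x)) \<partial>\<mu>) = ennreal (tr d (cov \<mu>))"

definition optimal_weight :: "nat \<Rightarrow> rvec measure \<Rightarrow> (rvec \<Rightarrow> rmat) \<Rightarrow> bool" where
  "optimal_weight d \<mu> W \<longleftrightarrow> admissible d \<mu> W \<and>
     (\<forall>W'. admissible d \<mu> W' \<longrightarrow> poincare_const d \<mu> W \<le> poincare_const d \<mu> W')"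

definition normalized_sum :: "nat \<Rightarrow> nat \<Rightarrow> (nat \<Rightarrow> rvec) \<Rightarrow> rvec" where
  "normalized_sum d N X = (\<lambda>i\<in>{..<d}. (\<Sum>k<N. X k i) / sqrt (real N))"

text \<open>
  The law of the normalized sum of \<open>N\<close> independent copies, on the canonical sample
  space; by \<open>distr_normalized_sum\<close> every other realization gives the same law.
\<close>

definition normalized_sum_law :: "nat \<Rightarrow> nat \<Rightarrow> rvec measure \<Rightarrow> rvec measure" where
  "normalized_sum_law d N \<mu> =
     distr (PiM {..<N} (\<lambda>_. \<mu>)) (borel_RR d) (normalized_sum d N)"

lemma (in prob_space) distr_normalized_sum:
  fixes X :: "nat \<Rightarrow> 'a \<Rightarrow> rvec"
  assumes "N > 0"
    and indep: "indep_vars (\<lambda>_. borel_RR d) X {..<N}"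
    and law: "\<And>k. k < N \<Longrightarrow> distr M (borel_RR d) (X k) = \<mu>"
  shows "distr M (borel_RR d) (\<lambda>\<omega>. normalized_sum d N (\<lambda>k. X k \<omega>)) = normalized_sum_law d N \<mu>"
proof -
  have rv: "\<And>k. k \<in> {..<N} \<Longrightarrow> X k \<in> M \<rightarrow>\<^sub>M borel_RR d"
    using indep by (simp add: indep_vars_def)
  let ?P = "PiM {..<N} (\<lambda>_. borel_RR d)"
  have comp: "(\<lambda>x. x k i) \<in> ?P \<rightarrow>\<^sub>M (borel :: real measure)" if "k < N" "i < d" for k i
  proof -
    have "(\<lambda>x. x k) \<in> ?P \<rightarrow>\<^sub>M borel_RR d" using that by (intro measurable_component_singleton) auto
    moreover have "(\<lambda>y. y i) \<in> borel_RR d \<rightarrow>\<^sub>M (borel :: real measure)"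
      unfolding borel_RR_def using that by (intro measurable_component_singleton) auto
    ultimately show ?thesis by (rule measurable_compose)
  qed
  have ns: "normalized_sum d N \<in> ?P \<rightarrow>\<^sub>M borel_RR d"
    unfolding normalized_sum_def[abs_def] borel_RR_def
    by (intro measurable_restrict borel_measurable_divide borel_measurable_sum
        borel_measurable_const comp[unfolded borel_RR_def]) auto
  have "distr M ?P (\<lambda>\<omega>. \<lambda>k\<in>{..<N}. X k \<omega>) = PiM {..<N} (\<lambda>k. distr M (borel_RR d) (X k))"
    using indep rv assms(1) by (subst (asm) indep_vars_iff_distr_eq_PiM') auto
  also have "\<dots> = PiM {..<N} (\<lambda>_. \<mu>)" by (intro PiM_cong) (auto simp: law)
  finally have "normalized_sum_law d N \<mu> =
      distr (distr M ?P (\<lambda>\<omega>. \<lambda>k\<in>{..<N}. X k \<omega>)) (borel_RR d) (normalized_sum d N)"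
    by (simp add: normalized_sum_law_def)
  also have "\<dots> = distr M (borel_RR d) (normalized_sum d N \<circ> (\<lambda>\<omega>. \<lambda>k\<in>{..<N}. X k \<omega>))"
    by (intro distr_distr ns measurable_restrict rv)
  also have "normalized_sum d N \<circ> (\<lambda>\<omega>. \<lambda>k\<in>{..<N}. X k \<omega>) = (\<lambda>\<omega>. normalized_sum d N (\<lambda>k. X k \<omega>))"
    by (simp add: normalized_sum_def fun_eq_iff restrict_def)
  finally show ?thesis ..
qed

definition std_gaussian :: "nat \<Rightarrow> rvec measure" where
  "std_gaussian d = PiM {..<d} (\<lambda>_. density lborel (\<lambda>x. ennreal (std_normal_density x)))"

text \<open>Powers of extended nonnegative reals, meant for \<open>r > 0\<close>.\<close>

definition epowr :: "ennreal \<Rightarrow> real \<Rightarrow> ennreal" where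
  "epowr a r = (if a = \<infinity> then \<infinity> else ennreal (enn2real a powr r))"

definition couplings :: "nat \<Rightarrow> rvec measure \<Rightarrow> rvec measure \<Rightarrow> (rvec \<times> rvec) measure set" where
  "couplings d \<mu> \<nu> = {\<pi>. sets \<pi> = sets (borel_RR d \<Otimes>\<^sub>M borel_RR d) \<and>
     distr \<pi> (borel_RR d) fst = \<mu> \<and> distr \<pi> (borel_RR d) snd = \<nu>}"

definition wasserstein :: "real \<Rightarrow> nat \<Rightarrow> rvec measure \<Rightarrow> rvec measure \<Rightarrow> ennreal" where
  "wasserstein p d \<mu> \<nu> =
     epowr (INF \<pi>\<in>couplings d \<mu> \<nu>. \<integral>\<^sup>+z. ennreal (edist d (fst z) (snd z) powr p) \<partial>\<pi>) (1 / p)"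

text \<open>The \<open>p\<close>-th power of the entrywise \<open>p\<close>-norm of a matrix.\<close>

definition mat_norm_pow :: "real \<Rightarrow> nat \<Rightarrow> rmat \<Rightarrow> real" where
  "mat_norm_pow p d A = (\<Sum>i<d. \<Sum>j<d. \<bar>A i j\<bar> powr p)"

end

(*
  With the Poincare constant equal to 1, the coordinate functions saturate the Poincare inequality,
  and the first variation around them says that W is a Stein kernel:
  E[X_i h(X)] = E[sum_j W_ij(X) d_j h(X)]. For the normalized sum S this gives
  E[S_i h(S)] = E[sum_j T_ij d_j h(S)] with T = (1/N) sum_k W(X_k), and only Gaussian h are needed.
  Let Z be an independent standard Gaussian vector and X_t = cos t S + sin t Z for t in [0, pi/2]. By the
  identity for S, the conditional velocity E[X_t' | X_t] is - cos t E[(T - I) Z | X_t], whose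
  p-norm is at most that of (T - I) Z. A Markov chain Y_k whose transitions are the conditional
  laws of X_{t + h} given X_t has Y_0 ~ S and ends in Z. Its increments are conditional means, of norm
  at most h |(T - I) Z|_p + O(h^2), plus martingale differences of size O(h), whose sum is of
  order sqrt h and disappears as h tends to 0. Working coordinatewise in the p-norm gives the power of d,
  and the inequality |f + g|_p^2 <= |f|_p^2 + K |g|_p^2 for g orthogonal to the derivative of
  |f|^p serves for the chain, for the moments of (T - I) Z, and for the average T - I.
*)
theory Submission
  imports Defs
begin

subsection \<open>Scalar inequalities\<close>

text \<open>A flow along the conditional velocity E[X_t' | X_t] would also carry S to Z, but its
  existence needs regularity of that field. The chain needs none: for 0 < t \<le> pi/2 the law of
  X_t has a positive density, the conditional law of the sample given X_t = x has an explicit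
  Gaussian weight, and this weight, as a function of S, is exactly the test function for which the
  Stein identity is required. T is not a function of S, so conditioning takes place on the sample
  space that carries both. The price is the martingale part of the increments: by the triangle
  inequality its n terms of size 1/n would not vanish, while adding squares leaves a total of order
  1/sqrt n. No limit coupling is built, because the Wasserstein distance is an infimum. Only second
  moments of X are given; its p-th moments come from the Stein identity and moments of W.
  Coordinates saturate the inequality because E[W_ii] >= 1 for every i while the trace has mean d.
  Two passages between the Euclidean norm and the p-norm cost d^(p/2-1) each in p-th powers, hence
  d^(1-2/p).\<close>

text \<open>Convexity of the power on the open half-line; at \<open>x = 0\<close> the left side
  equals (1 - q) y^q <= 0. The expansions, Jensen's inequality and the power mean inequality below
  are all drawn from this tangent line.\<close>

lemma powr_above_tangent:
  fixes x y q :: real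
  assumes "q \<ge> 1" "x \<ge> 0" "y > 0"
  shows "y powr q + q * y powr (q - 1) * (x - y) \<le> x powr q"
proof (cases "x = 0")
  case True
  have "y powr q = y powr (q - 1) * y"
    using assms by (simp add: powr_diff)
  then have "y powr q + q * y powr (q - 1) * (x - y) = (1 - q) * y powr q"
    using True by (simp add: algebra_simps)
  also have "\<dots> \<le> 0" using assms by (intro mult_nonpos_nonneg) auto
  finally show ?thesis using True by simp
next
  case False
  have "q * y powr (q - 1) * (x - y) \<le> x powr q - y powr q"
    using assms False
    by (intro convex_on_imp_above_tangent[OF powr_convex, of q])
      (auto intro!: derivative_eq_intros simp: interior_open)
  then show ?thesis by simp
qed

text \<open>The slope is the derivative of |y|^q, which is 0 at \<open>y = 0\<close>. For other
  \<open>y\<close> the claim reduces to absolute values, because \<open>sgn y * (x - y)\<close> is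
  at most |x| - |y|.\<close>

lemma abs_powr_above_tangent:
  fixes x y q :: real
  assumes "q \<ge> 1"
  shows "\<bar>y\<bar> powr q + q * (sgn y * \<bar>y\<bar> powr (q - 1)) * (x - y) \<le> \<bar>x\<bar> powr q"
proof (cases "y = 0")
  case False
  have "\<bar>y\<bar> powr q + q * \<bar>y\<bar> powr (q - 1) * (\<bar>x\<bar> - \<bar>y\<bar>) \<le> \<bar>x\<bar> powr q"
    using powr_above_tangent[OF assms, of "\<bar>x\<bar>" "\<bar>y\<bar>"] False by simp
  moreover have "sgn y * (x - y) \<le> \<bar>x\<bar> - \<bar>y\<bar>"
    by (auto simp: sgn_if abs_if)
  then have "(q * \<bar>y\<bar> powr (q - 1)) * (sgn y * (x - y)) \<le> (q * \<bar>y\<bar> powr (q - 1)) * (\<bar>x\<bar> - \<bar>y\<bar>)"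
    using assms by (intro mult_left_mono) auto
  ultimately show ?thesis by (simp add: mult_ac)
qed (use assms in auto)

lemma one_plus_powr_ge:
  fixes t q :: real
  assumes "q \<ge> 1" "t \<ge> -1"
  shows "1 + q * t \<le> (1 + t) powr q"
  using powr_above_tangent[of q "1 + t" 1] assms by simp

text \<open>A second-order expansion without second derivatives: the tangent at
  \<open>1 + t\<close>, evaluated at 1, leaves the factor t (1 + t)^(q-1), and the tangent
  inequality for the exponent q - 1 bounds it in the direction that the sign of \<open>t\<close>
  requires.\<close>

lemma one_plus_powr_le:
  fixes t q :: real
  assumes q: "q \<ge> 2" and t: "\<bar>t\<bar> \<le> 1 / 2"
  shows "(1 + t) powr q \<le> 1 + q * t + q * (q - 1) * 2 powr q * t\<^sup>2"
proof -
  have pos: "1 + t > 0" using t by linarith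
  have "(1 + t) powr q + q * (1 + t) powr (q - 1) * (1 - (1 + t)) \<le> 1 powr q"
    by (rule powr_above_tangent) (use q pos in auto)
  then have 1: "(1 + t) powr q \<le> 1 + q * (t * (1 + t) powr (q - 1))" by (simp add: algebra_simps)
  have 2: "t * (1 + t) powr (q - 1) \<le> t + (q - 1) * 2 powr q * t\<^sup>2"
  proof (cases "t \<ge> 0")
    case True
    have "(1 + t) powr (q - 1) + (q - 1) * (1 + t) powr (q - 1 - 1) * (1 - (1 + t)) \<le> 1 powr (q - 1)"
      by (rule powr_above_tangent) (use q pos in auto)
    then have "(1 + t) powr (q - 1) \<le> 1 + (q - 1) * t * (1 + t) powr (q - 2)"
      by (simp add: algebra_simps)
    also have "(1 + t) powr (q - 2) \<le> 2 powr (q - 2)"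
      using q t True by (intro powr_mono2) auto
    also have "\<dots> \<le> 2 powr q" by simp
    finally have "(1 + t) powr (q - 1) \<le> 1 + (q - 1) * t * 2 powr q"
      using q True by (auto simp: mult_left_mono)
    then have "t * (1 + t) powr (q - 1) \<le> t * (1 + (q - 1) * t * 2 powr q)"
      using True by (intro mult_left_mono)
    then show ?thesis by (simp add: algebra_simps power2_eq_square)
  next
    case False
    have "1 + (q - 1) * t \<le> (1 + t) powr (q - 1)"
      by (rule one_plus_powr_ge) (use q t in auto)
    then have "t * (1 + t) powr (q - 1) \<le> t * (1 + (q - 1) * t)"
      using False by (intro mult_left_mono_neg) auto
    also have "\<dots> = t + (q - 1) * 1 * t\<^sup>2" by (simp add: algebra_simps power2_eq_square)
    also have "\<dots> \<le> t + (q - 1) * 2 powr q * t\<^sup>2"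
      using q by (intro add_left_mono mult_right_mono mult_left_mono) (auto intro: ge_one_powr_ge_zero)
    finally show ?thesis .
  qed
  have "q * (t * (1 + t) powr (q - 1)) \<le> q * (t + (q - 1) * 2 powr q * t\<^sup>2)"
    using 2 q by (intro mult_left_mono) auto
  then show ?thesis using 1 by (simp add: algebra_simps)
qed

text \<open>The first summand is the quadratic remainder for |t| <= 1/2. For larger |t|, the second
  comes from |1 + t| <= 3 |t|, and the third absorbs a negative linear term through - t <= 2
  t^2.\<close>

definition smooth_const :: "real \<Rightarrow> real" where
  "smooth_const p = p * (p - 1) * 2 powr p + 3 powr p + 4 * p"

lemma abs_one_plus_powr_le:
  fixes t p :: real
  assumes p: "p \<ge> 2"
  shows "\<bar>1 + t\<bar> powr p \<le> 1 + p * t + smooth_const p * (t\<^sup>2 + \<bar>t\<bar> powr p)"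
proof (cases "\<bar>t\<bar> \<le> 1 / 2")
  case True
  have "(1 + t) powr p \<le> 1 + p * t + p * (p - 1) * 2 powr p * t\<^sup>2"
    by (rule one_plus_powr_le) (use p True in auto)
  also have "\<dots> \<le> 1 + p * t + smooth_const p * t\<^sup>2"
    using p by (intro add_left_mono mult_right_mono) (auto simp: smooth_const_def)
  also have "\<dots> \<le> 1 + p * t + smooth_const p * (t\<^sup>2 + \<bar>t\<bar> powr p)"
    using p by (intro add_left_mono mult_left_mono) (auto simp: smooth_const_def)
  finally have "(1 + t) powr p \<le> 1 + p * t + smooth_const p * (t\<^sup>2 + \<bar>t\<bar> powr p)" .
  moreover have "\<bar>1 + t\<bar> = 1 + t" using True by linarith
  ultimately show ?thesis by simp
next
  case False
  have "\<bar>1 + t\<bar> powr p \<le> (3 * \<bar>t\<bar>) powr p"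
    using False p by (intro powr_mono2) auto
  also have "\<dots> = 3 powr p * \<bar>t\<bar> powr p" by (simp add: powr_mult)
  finally have 1: "\<bar>1 + t\<bar> powr p \<le> 3 powr p * \<bar>t\<bar> powr p" .
  have "- t \<le> 2 * (\<bar>t\<bar> * \<bar>t\<bar>)"
    using mult_right_mono[of 1 "2 * \<bar>t\<bar>" "\<bar>t\<bar>"] False by simp
  then have "p * (- t) \<le> p * (2 * t\<^sup>2)"
    using p by (intro mult_left_mono) (auto simp: power2_eq_square)
  then have 2: "0 \<le> 1 + p * t + 2 * p * t\<^sup>2" by simp
  have "3 powr p * \<bar>t\<bar> powr p + 4 * p * t\<^sup>2 \<le> smooth_const p * (t\<^sup>2 + \<bar>t\<bar> powr p)"
  proof -
    have "0 \<le> p * (p - 1) * 2 powr p * (t\<^sup>2 + \<bar>t\<bar> powr p) + 3 powr p * t\<^sup>2 + 4 * p * \<bar>t\<bar> powr p"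
      using p by auto
    then show ?thesis by (simp add: smooth_const_def algebra_simps)
  qed
  moreover have "2 * p * t\<^sup>2 \<le> 4 * p * t\<^sup>2" using p by (intro mult_right_mono) auto
  ultimately show ?thesis using 1 2 by linarith
qed

lemma smooth_const_pos: "p \<ge> 2 \<Longrightarrow> smooth_const p > 0"
  unfolding smooth_const_def by (intro add_nonneg_pos add_nonneg_nonneg mult_nonneg_nonneg) auto

text \<open>Homogeneity: dividing by |a|^p leaves the one-variable estimate at t = b / a. For p > 2
  the remainder needs both terms, the quadratic one for small \<open>b\<close> and the one of order
  p for large \<open>b\<close>.\<close>

lemma abs_add_powr_le:
  fixes a b p :: real
  assumes p: "p \<ge> 2"
  shows "\<bar>a + b\<bar> powr p \<le> \<bar>a\<bar> powr p + p * (sgn a * \<bar>a\<bar> powr (p - 1)) * b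
    + smooth_const p * (\<bar>a\<bar> powr (p - 2) * b\<^sup>2 + \<bar>b\<bar> powr p)"
proof (cases "a = 0")
  \<comment> \<open>\<open>0 powr r\<close> is 0 even for r = 0, so also for p = 2 only the |b|^p
    terms remain, and these need \<open>smooth_const p\<close> to be at least 1.\<close>
  case True
  have "1 \<le> smooth_const p"
  proof -
    have "0 \<le> p * (p - 1) * 2 powr p" "0 \<le> 3 powr p" using p by auto
    then show ?thesis using p unfolding smooth_const_def by linarith
  qed
  then have "1 * \<bar>b\<bar> powr p \<le> smooth_const p * \<bar>b\<bar> powr p" by (intro mult_right_mono) auto
  then show ?thesis using True by simp
next
  case False
  define t where "t = b / a"
  have b: "b = a * t" using False by (simp add: t_def)
  have ab: "\<bar>a + b\<bar> powr p = \<bar>a\<bar> powr p * \<bar>1 + t\<bar> powr p"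
  proof -
    have "a + b = a * (1 + t)" using b by (simp add: algebra_simps)
    then show ?thesis by (simp add: abs_mult powr_mult)
  qed
  have e1: "\<bar>a\<bar> powr p * t = sgn a * \<bar>a\<bar> powr (p - 1) * b"
  proof -
    have "\<bar>a\<bar> powr p = \<bar>a\<bar> powr (p - 1) * \<bar>a\<bar>" using False by (simp add: powr_diff)
    moreover have "\<bar>a\<bar> = sgn a * a" by (simp add: abs_sgn)
    ultimately show ?thesis using b by simp
  qed
  have e2: "\<bar>a\<bar> powr p * t\<^sup>2 = \<bar>a\<bar> powr (p - 2) * b\<^sup>2"
  proof -
    have "\<bar>a\<bar> powr p = \<bar>a\<bar> powr (p - 2) * \<bar>a\<bar> powr 2"
      by (subst powr_add[symmetric]) simp
    also have "\<bar>a\<bar> powr 2 = a\<^sup>2" using False by (subst powr_numeral) auto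
    finally have "\<bar>a\<bar> powr p = \<bar>a\<bar> powr (p - 2) * a\<^sup>2" .
    then show ?thesis using b by (simp add: power_mult_distrib)
  qed
  have e3: "\<bar>a\<bar> powr p * \<bar>t\<bar> powr p = \<bar>b\<bar> powr p"
    by (simp add: b abs_mult powr_mult)
  have "\<bar>a\<bar> powr p * \<bar>1 + t\<bar> powr p \<le>
      \<bar>a\<bar> powr p * (1 + p * t + smooth_const p * (t\<^sup>2 + \<bar>t\<bar> powr p))"
    by (intro mult_left_mono abs_one_plus_powr_le p) auto
  also have "\<dots> = \<bar>a\<bar> powr p + p * (\<bar>a\<bar> powr p * t)
      + smooth_const p * (\<bar>a\<bar> powr p * t\<^sup>2 + \<bar>a\<bar> powr p * \<bar>t\<bar> powr p)"
    by (simp add: algebra_simps)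
  finally show ?thesis unfolding ab e1 e2 e3 by (simp add: mult_ac)
qed

text \<open>Write z^q as z times z^(q-1) and enlarge the second factor to its value at x +
  y.\<close>

lemma powr_add_superadditive:
  fixes x y q :: real
  assumes "q \<ge> 1" "x \<ge> 0" "y \<ge> 0"
  shows "x powr q + y powr q \<le> (x + y) powr q"
proof -
  have e: "z powr q = z * z powr (q - 1)" if "z \<ge> 0" for z :: real
    using that by (cases "z = 0") (auto simp: powr_diff)
  have "x * x powr (q - 1) + y * y powr (q - 1) \<le> x * (x + y) powr (q - 1) + y * (x + y) powr (q - 1)"
    using assms by (intro add_mono mult_left_mono powr_mono2) auto
  also have "\<dots> = (x + y) powr q" using assms by (subst e) (auto simp: algebra_simps)
  finally show ?thesis using assms by (simp add: e[symmetric])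
qed

lemma square_powr_half: "(u\<^sup>2) powr (p / 2) = u powr p" if "u \<ge> 0" for u :: real
proof (cases "u = 0")
  case False
  then have "u\<^sup>2 = u powr 2" using that by (subst powr_numeral) auto
  then show ?thesis by (simp only: powr_powr) simp
qed simp

text \<open>Converts the remainder of \<open>abs_add_powr_le\<close> into an estimate between squares, which can be iterated
  without losing constants.\<close>

lemma powr_add_le_square:
  fixes u v p C :: real
  assumes p: "p \<ge> 2" and u: "u \<ge> 0" and v: "v \<ge> 0" and C: "C \<ge> 0"
  shows "u powr p + C * (u powr (p - 2) * v\<^sup>2 + v powr p) \<le> (u\<^sup>2 + (2 * C + 2) * v\<^sup>2) powr (p / 2)"
proof -
  \<comment> \<open>Two lower bounds \<open>A\<close> and \<open>B\<close> for the right side will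
    be averaged, hence 2 C. The further 2 makes the base at least 1, so that raising it to the power
    p/2 does not lose 2 C.\<close>
  define s where "s = (2 * C + 2) * v\<^sup>2"
  have s: "s \<ge> 0" using C by (simp add: s_def)
  \<comment> \<open>The tangent of t^(p/2) at u^2 gives growth linear in \<open>s\<close> with
    weight u^(p-2); its factor p/2 >= 1 is dropped.\<close>
  have A: "u powr p + s * u powr (p - 2) \<le> (u\<^sup>2 + s) powr (p / 2)"
  proof (cases "u = 0")
    case False
    then have u0: "u > 0" using u by simp
    have "(u\<^sup>2) powr (p / 2) + p / 2 * (u\<^sup>2) powr (p / 2 - 1) * (u\<^sup>2 + s - u\<^sup>2) \<le> (u\<^sup>2 + s) powr (p / 2)"
      by (rule powr_above_tangent) (use p u0 s in auto)
    moreover have "(u\<^sup>2) powr (p / 2 - 1) = u powr (p - 2)"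
      using square_powr_half[OF u, of "p - 2"] by (simp add: diff_divide_distrib)
    ultimately have "u powr p + p / 2 * (s * u powr (p - 2)) \<le> (u\<^sup>2 + s) powr (p / 2)"
      by (simp add: square_powr_half[OF u] mult_ac)
    moreover have "1 * (s * u powr (p - 2)) \<le> p / 2 * (s * u powr (p - 2))"
      using p s by (intro mult_right_mono) auto
    ultimately show ?thesis by simp
  qed (use s in simp)
  have "s powr (p / 2) + (u\<^sup>2) powr (p / 2) \<le> (s + u\<^sup>2) powr (p / 2)"
    by (rule powr_add_superadditive) (use p s in auto)
  then have B: "s powr (p / 2) + u powr p \<le> (u\<^sup>2 + s) powr (p / 2)"
    by (simp add: square_powr_half[OF u] add.commute)
  have c: "2 * C * v powr p \<le> s powr (p / 2)"
  proof -
    have "2 * C * v powr p \<le> (2 * C + 2) powr (p / 2) * v powr p"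
    proof (intro mult_right_mono)
      have "2 * C \<le> (2 * C + 2) powr 1" using C by simp
      also have "\<dots> \<le> (2 * C + 2) powr (p / 2)" using C p by (intro powr_mono) auto
      finally show "2 * C \<le> (2 * C + 2) powr (p / 2)" .
    qed auto
    also have "\<dots> = s powr (p / 2)"
      using C v by (simp add: s_def powr_mult square_powr_half)
    finally show ?thesis .
  qed
  have "2 * C * (u powr (p - 2) * v\<^sup>2) \<le> s * u powr (p - 2)"
  proof -
    have "0 \<le> 2 * v\<^sup>2 * u powr (p - 2)" by simp
    then show ?thesis by (simp add: s_def algebra_simps)
  qed
  then show ?thesis using A B c unfolding s_def[symmetric] by (simp add: algebra_simps)
qed

subsection \<open>p-norms and orthogonal increments\<close>

definition in_Lp :: "real \<Rightarrow> 'a measure \<Rightarrow> ('a \<Rightarrow> real) \<Rightarrow> bool" where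
  "in_Lp p M f \<longleftrightarrow> f \<in> borel_measurable M \<and> integrable M (\<lambda>x. \<bar>f x\<bar> powr p)"

text \<open>Junk value: the norm is 0 unless \<open>in_Lp\<close> holds.\<close>

definition Lp_norm :: "real \<Rightarrow> 'a measure \<Rightarrow> ('a \<Rightarrow> real) \<Rightarrow> real" where
  "Lp_norm p M f = (\<integral>x. \<bar>f x\<bar> powr p \<partial>M) powr (1 / p)"

lemma Lp_norm_nonneg [simp]: "0 \<le> Lp_norm p M f"
  by (simp add: Lp_norm_def)

lemma Lp_norm_powr: "p > 0 \<Longrightarrow> Lp_norm p M f powr p = (\<integral>x. \<bar>f x\<bar> powr p \<partial>M)"
  by (simp add: Lp_norm_def powr_powr)

lemma Lp_norm_leI:
  assumes "p > 0" "0 \<le> a" "(\<integral>x. \<bar>f x\<bar> powr p \<partial>M) \<le> a powr p"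
  shows "Lp_norm p M f \<le> a"
proof -
  have "Lp_norm p M f \<le> (a powr p) powr (1 / p)"
    unfolding Lp_norm_def using assms by (intro powr_mono2) auto
  then show ?thesis using assms by (simp add: powr_powr)
qed

lemma in_Lp_measurable: "in_Lp p M f \<Longrightarrow> f \<in> borel_measurable M"
  by (simp add: in_Lp_def)

lemma
  assumes "in_Lp p M f" "p > 0"
  shows in_Lp_cmult: "in_Lp p M (\<lambda>x. c * f x)"
    and Lp_norm_cmult: "Lp_norm p M (\<lambda>x. c * f x) = \<bar>c\<bar> * Lp_norm p M f"
  using assms by (auto simp: in_Lp_def Lp_norm_def abs_mult powr_mult powr_powr)

lemma in_Lp_add:
  assumes f: "in_Lp p M f" and g: "in_Lp p M g" and p: "p > 0"
  shows "in_Lp p M (\<lambda>x. f x + g x)"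
proof -
  have "\<bar>f x + g x\<bar> powr p \<le> 2 powr p * (\<bar>f x\<bar> powr p + \<bar>g x\<bar> powr p)" for x
  proof -
    have "\<bar>f x + g x\<bar> powr p \<le> (2 * max \<bar>f x\<bar> \<bar>g x\<bar>) powr p"
      using p by (intro powr_mono2) auto
    also have "\<dots> = 2 powr p * max \<bar>f x\<bar> \<bar>g x\<bar> powr p" by (simp add: powr_mult)
    also have "\<dots> \<le> 2 powr p * (\<bar>f x\<bar> powr p + \<bar>g x\<bar> powr p)"
      by (intro mult_left_mono) (auto simp: max_def)
    finally show ?thesis .
  qed
  note bound = this
  have [measurable]: "f \<in> borel_measurable M" "g \<in> borel_measurable M"
    using f g by (auto simp: in_Lp_def)
  have "integrable M (\<lambda>x. \<bar>f x + g x\<bar> powr p)"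
  proof (rule Bochner_Integration.integrable_bound)
    show "integrable M (\<lambda>x. 2 powr p * (\<bar>f x\<bar> powr p + \<bar>g x\<bar> powr p))"
      using f g by (intro integrable_mult_right Bochner_Integration.integrable_add) (auto simp: in_Lp_def)
    show "AE x in M. norm (\<bar>f x + g x\<bar> powr p) \<le> norm (2 powr p * (\<bar>f x\<bar> powr p + \<bar>g x\<bar> powr p))"
      using bound by (intro AE_I2) (simp only: real_norm_def abs_of_nonneg[OF powr_ge_zero] order_trans[OF bound abs_ge_self])
  qed measurable
  then show ?thesis using f g by (simp add: in_Lp_def)
qed

lemma in_Lp_uminus: "in_Lp p M f \<Longrightarrow> in_Lp p M (\<lambda>x. - f x)"
  by (auto simp: in_Lp_def)

lemma Lp_norm_uminus: "Lp_norm p M (\<lambda>x. - f x) = Lp_norm p M f"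
  by (auto simp: Lp_norm_def)

lemma in_Lp_diff: "in_Lp p M f \<Longrightarrow> in_Lp p M g \<Longrightarrow> p > 0 \<Longrightarrow> in_Lp p M (\<lambda>x. f x - g x)"
  using in_Lp_add[of p M f "\<lambda>x. - g x"] in_Lp_uminus[of p M g] by simp

lemma in_Lp_zero: "in_Lp p M (\<lambda>x. 0)"
  by (auto simp: in_Lp_def)

lemma Lp_norm_zero: "p > 0 \<Longrightarrow> Lp_norm p M (\<lambda>x. 0) = 0"
  by (simp add: Lp_norm_def)

lemma in_Lp_sum:
  assumes "\<And>i. i \<in> I \<Longrightarrow> in_Lp p M (f i)" "p > 0"
  shows "in_Lp p M (\<lambda>x. \<Sum>i\<in>I. f i x)"
  using assms(1)
proof (induction I rule: infinite_finite_induct)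
  case (insert i I)
  then show ?case by (simp add: in_Lp_add assms(2))
qed (auto simp: in_Lp_zero)

lemma in_Lp_imp_integrable:
  assumes "finite_measure M" "in_Lp p M f" "p \<ge> 1"
  shows "integrable M f"
proof -
  interpret finite_measure M by fact
  have "\<bar>f x\<bar> \<le> 1 + \<bar>f x\<bar> powr p" for x
  proof (cases "\<bar>f x\<bar> \<le> 1")
    case False
    then have "\<bar>f x\<bar> powr 1 \<le> \<bar>f x\<bar> powr p" using assms by (intro powr_mono) auto
    then show ?thesis using False by simp
  qed (simp add: add_increasing2)
  then show ?thesis using assms(2) unfolding in_Lp_def
    by (intro Bochner_Integration.integrable_bound[of M "\<lambda>x. 1 + \<bar>f x\<bar> powr p" f]) (auto simp: abs_of_nonneg)
qed

lemma abs_powr_convex: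
  fixes a b l p :: real
  assumes "p \<ge> 1" "0 \<le> l" "l \<le> 1"
  shows "\<bar>l * a + (1 - l) * b\<bar> powr p \<le> l * \<bar>a\<bar> powr p + (1 - l) * \<bar>b\<bar> powr p"
proof -
  define y where "y = l * a + (1 - l) * b"
  define s where "s = p * (sgn y * \<bar>y\<bar> powr (p - 1))"
  have "l * (\<bar>y\<bar> powr p + s * (a - y)) + (1 - l) * (\<bar>y\<bar> powr p + s * (b - y))
      \<le> l * \<bar>a\<bar> powr p + (1 - l) * \<bar>b\<bar> powr p"
    using assms abs_powr_above_tangent[OF assms(1), of y] unfolding s_def
    by (intro add_mono mult_left_mono) auto
  moreover have "l * (\<bar>y\<bar> powr p + s * (a - y)) + (1 - l) * (\<bar>y\<bar> powr p + s * (b - y))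
      = \<bar>y\<bar> powr p + s * ((l * a + (1 - l) * b) - y)"
    by (simp add: algebra_simps)
  ultimately show ?thesis by (simp add: y_def)
qed

lemma integral_abs_powr_le:
  assumes f: "in_Lp p M f" and p: "p > 0" and a: "Lp_norm p M f \<le> a" "a > 0"
  shows "(\<integral>x. \<bar>f x / a\<bar> powr p \<partial>M) \<le> 1"
proof -
  have "(\<integral>x. \<bar>f x / a\<bar> powr p \<partial>M) = Lp_norm p M f powr p / a powr p"
    using a p by (simp add: Lp_norm_powr powr_divide)
  also have "\<dots> \<le> a powr p / a powr p"
    using a p by (intro divide_right_mono powr_mono2) auto
  finally show ?thesis using a by simp
qed

lemma in_Lp_divide: "in_Lp p M f \<Longrightarrow> p > 0 \<Longrightarrow> in_Lp p M (\<lambda>x. f x / a)"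
  using in_Lp_cmult[of p M f "1 / a"] by simp

text \<open>(f + g) / (a + b) is a convex combination of f / a and g / b, whose p-th powers
  integrate to at most 1. Strictly positive majorants \<open>a\<close>, \<open>b\<close> of the
  norms avoid division by a zero norm; they are lowered to the norms at the end.\<close>

lemma Lp_norm_add_le:
  assumes f: "in_Lp p M f" and g: "in_Lp p M g" and p: "p \<ge> 1"
  shows "Lp_norm p M (\<lambda>x. f x + g x) \<le> Lp_norm p M f + Lp_norm p M g"
proof -
  have p0: "p > 0" using p by simp
  have "Lp_norm p M (\<lambda>x. f x + g x) \<le> a + b"
    if a: "Lp_norm p M f \<le> a" "a > 0" and b: "Lp_norm p M g \<le> b" "b > 0" for a b
  proof (rule Lp_norm_leI)
    define l where "l = a / (a + b)"
    have l: "0 \<le> l" "l \<le> 1" "(a + b) * l = a" "(a + b) * (1 - l) = b"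
      using a b by (auto simp: l_def field_simps)
    have eq: "f x + g x = (a + b) * (l * (f x / a) + (1 - l) * (g x / b))" for x
    proof -
      have "(a + b) * (l * (f x / a) + (1 - l) * (g x / b))
          = ((a + b) * l) * (f x / a) + ((a + b) * (1 - l)) * (g x / b)" by (simp only: algebra_simps)
      then show ?thesis using l(3,4) a(2) b(2) by simp
    qed
    have "\<bar>f x + g x\<bar> powr p \<le> (a + b) powr p * (l * \<bar>f x / a\<bar> powr p + (1 - l) * \<bar>g x / b\<bar> powr p)" for x
    proof -
      have "\<bar>f x + g x\<bar> powr p = (a + b) powr p * \<bar>l * (f x / a) + (1 - l) * (g x / b)\<bar> powr p"
        unfolding eq using a b by (simp add: abs_mult powr_mult)
      also have "\<dots> \<le> (a + b) powr p * (l * \<bar>f x / a\<bar> powr p + (1 - l) * \<bar>g x / b\<bar> powr p)"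
        using p l(1,2) by (intro mult_left_mono abs_powr_convex) auto
      finally show ?thesis .
    qed
    moreover have fi: "integrable M (\<lambda>x. \<bar>f x / a\<bar> powr p)" "integrable M (\<lambda>x. \<bar>g x / b\<bar> powr p)"
      using in_Lp_divide[OF f p0, of a] in_Lp_divide[OF g p0, of b] by (auto simp: in_Lp_def)
    ultimately have "(\<integral>x. \<bar>f x + g x\<bar> powr p \<partial>M)
        \<le> (\<integral>x. (a + b) powr p * (l * \<bar>f x / a\<bar> powr p + (1 - l) * \<bar>g x / b\<bar> powr p) \<partial>M)"
      using in_Lp_add[OF f g p0] by (intro integral_mono) (auto simp: in_Lp_def)
    also have "\<dots> = (a + b) powr p * (l * (\<integral>x. \<bar>f x / a\<bar> powr p \<partial>M) + (1 - l) * (\<integral>x. \<bar>g x / b\<bar> powr p \<partial>M))"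
      using fi by simp
    also have "\<dots> \<le> (a + b) powr p * (l * 1 + (1 - l) * 1)"
      using l integral_abs_powr_le[OF f p0 a] integral_abs_powr_le[OF g p0 b]
      by (intro mult_left_mono add_mono) auto
    finally show "(\<integral>x. \<bar>f x + g x\<bar> powr p \<partial>M) \<le> (a + b) powr p" by simp
  qed (use p a b in auto)
  note * = this
  show ?thesis
  proof (rule field_le_epsilon)
    fix e :: real assume "e > 0"
    then show "Lp_norm p M (\<lambda>x. f x + g x) \<le> Lp_norm p M f + Lp_norm p M g + e"
      using *[of "Lp_norm p M f + e / 2" "Lp_norm p M g + e / 2"] Lp_norm_nonneg[of p M f] Lp_norm_nonneg[of p M g]
      by (simp add: add_nonneg_pos)
  qed
qed

lemma Lp_norm_diff_le:
  assumes "in_Lp p M f" "in_Lp p M g" "p \<ge> 1"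
  shows "Lp_norm p M (\<lambda>x. f x - g x) \<le> Lp_norm p M f + Lp_norm p M g"
  using Lp_norm_add_le[OF assms(1) in_Lp_uminus[OF assms(2)] assms(3)] by (simp add: Lp_norm_uminus)

lemma powr_mult_square_le:
  fixes a b p :: real
  assumes "p \<ge> 2" "a \<ge> 0" "b \<ge> 0"
  shows "a powr (p - 2) * b\<^sup>2 \<le> a powr p + b powr p"
proof -
  have e: "c powr p = c powr (p - 2) * c\<^sup>2" if "c \<ge> 0" for c :: real
  proof (cases "c = 0")
    case False
    then have "c powr 2 = c\<^sup>2" using that by (subst powr_numeral) auto
    then show ?thesis by (metis diff_add_cancel powr_add)
  qed simp
  show ?thesis
  proof (cases "a \<le> b")
    case True
    then have "a powr (p - 2) * b\<^sup>2 \<le> b powr (p - 2) * b\<^sup>2"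
      using assms by (intro mult_right_mono powr_mono2) auto
    then show ?thesis using e[OF assms(3)] by (simp add: add_increasing)
  next
    case False
    then have "a powr (p - 2) * b\<^sup>2 \<le> a powr (p - 2) * a\<^sup>2"
      using assms by (intro mult_left_mono power_mono) auto
    then show ?thesis using e[OF assms(2)] by (simp add: add_increasing2)
  qed
qed

text \<open>The crude bound |f|^(p-1) |g| <= |f|^p + |g|^p, by comparing |f| with |g|, stands in for
  Hoelder's inequality, since only integrability is at stake.\<close>

lemma integrable_sgn_powr_mult:
  assumes f: "in_Lp p M f" and g: "in_Lp p M g" and p: "p \<ge> 1"
  shows "integrable M (\<lambda>x. sgn (f x) * \<bar>f x\<bar> powr (p - 1) * g x)"
proof -
  note [measurable] = in_Lp_measurable[OF f] in_Lp_measurable[OF g]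
  have fp: "integrable M (\<lambda>x. \<bar>f x\<bar> powr p)" "integrable M (\<lambda>x. \<bar>g x\<bar> powr p)"
    using f g by (auto simp: in_Lp_def)
  show ?thesis
  proof (rule Bochner_Integration.integrable_bound)
    show "integrable M (\<lambda>x. \<bar>f x\<bar> powr p + \<bar>g x\<bar> powr p)" using fp by auto
    have "\<bar>sgn a * \<bar>a\<bar> powr (p - 1) * b\<bar> \<le> \<bar>a\<bar> powr p + \<bar>b\<bar> powr p" for a b :: real
    proof -
      have e: "c powr p = c powr (p - 1) * c" if "c \<ge> 0" for c :: real
        using that by (cases "c = 0") (auto simp: powr_diff)
      have "\<bar>sgn a * \<bar>a\<bar> powr (p - 1) * b\<bar> \<le> \<bar>a\<bar> powr (p - 1) * \<bar>b\<bar>"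
        by (simp add: abs_mult sgn_if)
      also have "\<dots> \<le> \<bar>a\<bar> powr p + \<bar>b\<bar> powr p"
      proof (cases "\<bar>a\<bar> \<le> \<bar>b\<bar>")
        case True
        then have "\<bar>a\<bar> powr (p - 1) * \<bar>b\<bar> \<le> \<bar>b\<bar> powr (p - 1) * \<bar>b\<bar>"
          using p by (intro mult_right_mono powr_mono2) auto
        then show ?thesis using e[of "\<bar>b\<bar>"] by (simp add: add_increasing)
      next
        case False
        then have "\<bar>a\<bar> powr (p - 1) * \<bar>b\<bar> \<le> \<bar>a\<bar> powr (p - 1) * \<bar>a\<bar>"
          by (intro mult_left_mono) auto
        then show ?thesis using e[of "\<bar>a\<bar>"] by (simp add: add_increasing2)
      qed
      finally show ?thesis .
    qed
    then show "AE x in M. norm (sgn (f x) * \<bar>f x\<bar> powr (p - 1) * g x) \<le> norm (\<bar>f x\<bar> powr p + \<bar>g x\<bar> powr p)"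
      by auto
  qed measurable
qed

text \<open>The factor 2 C + 2 of \<open>powr_add_le_square\<close> for C = 2 *
  \<open>smooth_const p\<close>; the doubling comes from bounding the normalized mixed term by a sum
  of two integrals, each at most 1.\<close>

definition orth_const :: "real \<Rightarrow> real" where
  "orth_const p = 4 * smooth_const p + 2"

lemma orth_const_pos: "p \<ge> 2 \<Longrightarrow> orth_const p > 0"
  using smooth_const_pos[of p] by (simp add: orth_const_def)

text \<open>Smoothness of the \<open>p\<close>-norm: orthogonality to the derivative of \<open>|f|^p\<close> removes the first-order
  term.\<close>

lemma Lp_norm_orthogonal_add:
  assumes p: "p \<ge> 2" and f: "in_Lp p M f" and g: "in_Lp p M g"
    and orth: "(\<integral>x. sgn (f x) * \<bar>f x\<bar> powr (p - 1) * g x \<partial>M) = 0"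
  shows "(Lp_norm p M (\<lambda>x. f x + g x))\<^sup>2 \<le> (Lp_norm p M f)\<^sup>2 + orth_const p * (Lp_norm p M g)\<^sup>2"
proof -
  have p0: "p > 0" using p by simp
  note [measurable] = in_Lp_measurable[OF f] in_Lp_measurable[OF g]
  have fp: "integrable M (\<lambda>x. \<bar>f x\<bar> powr p)" "integrable M (\<lambda>x. \<bar>g x\<bar> powr p)"
    using f g by (auto simp: in_Lp_def)
  have i1: "integrable M (\<lambda>x. sgn (f x) * \<bar>f x\<bar> powr (p - 1) * g x)"
    using p by (intro integrable_sgn_powr_mult f g) auto
  have bd: "(Lp_norm p M (\<lambda>x. f x + g x))\<^sup>2 \<le> a\<^sup>2 + orth_const p * b\<^sup>2"
    if a: "Lp_norm p M f \<le> a" "a > 0" and b: "Lp_norm p M g \<le> b" "b > 0" for a b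
  proof -
    define K where "K = smooth_const p"
    have K: "K > 0" using smooth_const_pos[OF p] by (simp add: K_def)
    have fi: "integrable M (\<lambda>x. \<bar>f x / a\<bar> powr p)" "integrable M (\<lambda>x. \<bar>g x / b\<bar> powr p)"
      using in_Lp_divide[OF f p0, of a] in_Lp_divide[OF g p0, of b] by (auto simp: in_Lp_def)
    \<comment> \<open>After scaling both functions to norm at most 1, the mixed term |f|^(p-2) g^2
      is dominated by a sum of p-th powers, so its integral has the order a^(p-2) b^2 that Hoelder's
      inequality would give.\<close>
    have q: "\<bar>s\<bar> powr (p - 2) * t\<^sup>2 \<le> a powr (p - 2) * b\<^sup>2 * (\<bar>s / a\<bar> powr p + \<bar>t / b\<bar> powr p)" for s t
    proof -
      have "\<bar>s\<bar> powr (p - 2) * t\<^sup>2 = a powr (p - 2) * b\<^sup>2 * (\<bar>s / a\<bar> powr (p - 2) * \<bar>t / b\<bar>\<^sup>2)"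
        using a b by (simp add: powr_divide power_divide)
      also have "\<dots> \<le> a powr (p - 2) * b\<^sup>2 * (\<bar>s / a\<bar> powr p + \<bar>t / b\<bar> powr p)"
        using p by (intro mult_left_mono powr_mult_square_le) auto
      finally show ?thesis .
    qed
    have pw: "\<bar>f x + g x\<bar> powr p \<le> \<bar>f x\<bar> powr p + p * (sgn (f x) * \<bar>f x\<bar> powr (p - 1) * g x)
        + K * (a powr (p - 2) * b\<^sup>2 * (\<bar>f x / a\<bar> powr p + \<bar>g x / b\<bar> powr p) + \<bar>g x\<bar> powr p)" for x
    proof -
      have "K * (\<bar>f x\<bar> powr (p - 2) * (g x)\<^sup>2 + \<bar>g x\<bar> powr p)
          \<le> K * (a powr (p - 2) * b\<^sup>2 * (\<bar>f x / a\<bar> powr p + \<bar>g x / b\<bar> powr p) + \<bar>g x\<bar> powr p)"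
        using q[of "f x" "g x"] K by (intro mult_left_mono add_right_mono) auto
      then show ?thesis using abs_add_powr_le[OF p, of "f x" "g x"] by (simp add: K_def mult_ac)
    qed
    have "(\<integral>x. \<bar>f x + g x\<bar> powr p \<partial>M) \<le> (\<integral>x. \<bar>f x\<bar> powr p + p * (sgn (f x) * \<bar>f x\<bar> powr (p - 1) * g x)
        + K * (a powr (p - 2) * b\<^sup>2 * (\<bar>f x / a\<bar> powr p + \<bar>g x / b\<bar> powr p) + \<bar>g x\<bar> powr p) \<partial>M)"
      using in_Lp_add[OF f g p0] fp fi i1 pw
      by (intro integral_mono) (auto simp: in_Lp_def)
    also have "\<dots> = (\<integral>x. \<bar>f x\<bar> powr p \<partial>M) + p * (\<integral>x. sgn (f x) * \<bar>f x\<bar> powr (p - 1) * g x \<partial>M)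
        + K * (a powr (p - 2) * b\<^sup>2 * ((\<integral>x. \<bar>f x / a\<bar> powr p \<partial>M) + (\<integral>x. \<bar>g x / b\<bar> powr p \<partial>M))
          + (\<integral>x. \<bar>g x\<bar> powr p \<partial>M))"
      using fp fi i1 by simp
    also have "\<dots> = (\<integral>x. \<bar>f x\<bar> powr p \<partial>M)
        + K * (a powr (p - 2) * b\<^sup>2 * ((\<integral>x. \<bar>f x / a\<bar> powr p \<partial>M) + (\<integral>x. \<bar>g x / b\<bar> powr p \<partial>M))
          + (\<integral>x. \<bar>g x\<bar> powr p \<partial>M))"
      using orth by simp
    also have "\<dots> \<le> a powr p + K * (a powr (p - 2) * b\<^sup>2 * (1 + 1) + b powr p)"
      using integral_abs_powr_le[OF f p0 a] integral_abs_powr_le[OF g p0 b] a b K p0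
      by (intro add_mono mult_left_mono) (auto simp flip: Lp_norm_powr intro!: powr_mono2)
    also have "\<dots> \<le> a powr p + (2 * K) * (a powr (p - 2) * b\<^sup>2 + b powr p)"
      using K by (simp add: algebra_simps)
    also have "\<dots> \<le> (a\<^sup>2 + (2 * (2 * K) + 2) * b\<^sup>2) powr (p / 2)"
      by (rule powr_add_le_square) (use p a b K in auto)
    also have "\<dots> = (a\<^sup>2 + orth_const p * b\<^sup>2) powr (p / 2)" by (simp add: orth_const_def K_def)
    finally have *: "(\<integral>x. \<bar>f x + g x\<bar> powr p \<partial>M) \<le> (a\<^sup>2 + orth_const p * b\<^sup>2) powr (p / 2)" .
    have nn: "0 \<le> a\<^sup>2 + orth_const p * b\<^sup>2" using orth_const_pos[OF p] by simp
    have "Lp_norm p M (\<lambda>x. f x + g x) \<le> sqrt (a\<^sup>2 + orth_const p * b\<^sup>2)"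
    proof (rule Lp_norm_leI)
      show "(\<integral>x. \<bar>f x + g x\<bar> powr p \<partial>M) \<le> sqrt (a\<^sup>2 + orth_const p * b\<^sup>2) powr p"
        using * square_powr_half[of "sqrt (a\<^sup>2 + orth_const p * b\<^sup>2)" p] nn by simp
    qed (use p nn in auto)
    then have "(Lp_norm p M (\<lambda>x. f x + g x))\<^sup>2 \<le> (sqrt (a\<^sup>2 + orth_const p * b\<^sup>2))\<^sup>2"
      by (intro power_mono) auto
    then show ?thesis using nn by simp
  qed
  \<comment> \<open>The bound for strictly positive majorants reaches the norms themselves by
    letting both excesses tend to 0.\<close>
  have "((\<lambda>e. (Lp_norm p M f + e)\<^sup>2 + orth_const p * (Lp_norm p M g + e)\<^sup>2) \<longlongrightarrow>
      (Lp_norm p M f + 0)\<^sup>2 + orth_const p * (Lp_norm p M g + 0)\<^sup>2) (at_right 0)"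
    by (intro tendsto_intros)
  moreover have "\<forall>\<^sub>F e in at_right (0::real).
      (Lp_norm p M (\<lambda>x. f x + g x))\<^sup>2 \<le> (Lp_norm p M f + e)\<^sup>2 + orth_const p * (Lp_norm p M g + e)\<^sup>2"
    using eventually_at_right_less[of 0]
    by eventually_elim (intro bd, auto simp: add_nonneg_pos)
  ultimately show ?thesis
    by (intro tendsto_lowerbound[where F = "at_right (0::real)"]) auto
qed

lemma in_Lp_distr:
  assumes "T \<in> M \<rightarrow>\<^sub>M N" "f \<in> borel_measurable N"
  shows "in_Lp p (distr M N T) f \<longleftrightarrow> in_Lp p M (\<lambda>x. f (T x))"
    and "Lp_norm p (distr M N T) f = Lp_norm p M (\<lambda>x. f (T x))"
  using assms by (auto simp: in_Lp_def Lp_norm_def integrable_distr_eq integral_distr)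

text \<open>A new centred summand is independent of the partial sum, hence orthogonal to the
  derivative of |S|^p. Iterating the orthogonal estimate adds squares of p-norms; the coefficient 1
  in front of the old norm keeps the constant from compounding.\<close>

lemma (in prob_space) Lp_norm_indep_sum:
  assumes p: "p \<ge> 2" and I: "finite I"
    and indep: "indep_vars (\<lambda>_. borel) Y I"
    and Lp: "\<And>i. i \<in> I \<Longrightarrow> in_Lp p M (Y i)"
    and zero: "\<And>i. i \<in> I \<Longrightarrow> expectation (Y i) = 0"
  shows "(Lp_norm p M (\<lambda>x. \<Sum>i\<in>I. Y i x))\<^sup>2 \<le> orth_const p * (\<Sum>i\<in>I. (Lp_norm p M (Y i))\<^sup>2)"
  using I indep Lp zero
proof (induction I rule: finite_induct)
  case empty
  then show ?case using p by (simp add: Lp_norm_zero)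
next
  case (insert k I)
  let ?S = "\<lambda>x. \<Sum>i\<in>I. Y i x"
  have SL: "in_Lp p M ?S" using insert p by (intro in_Lp_sum) auto
  have iv: "indep_var borel (Y k) borel ?S"
    using indep_vars_sum[OF insert(1,2) insert.prems(1)] .
  then have iv2: "indep_var borel (id \<circ> Y k) borel ((\<lambda>s. sgn s * \<bar>s\<bar> powr (p - 1)) \<circ> ?S)"
    by (rule indep_var_compose) auto
  have S1: "integrable M (\<lambda>x. sgn (?S x) * \<bar>?S x\<bar> powr (p - 1))"
  proof (rule Bochner_Integration.integrable_bound[of M "\<lambda>x. 1 + \<bar>?S x\<bar> powr p"])
    have "\<bar>sgn s * \<bar>s\<bar> powr (p - 1)\<bar> \<le> 1 + \<bar>s\<bar> powr p" for s :: real
    proof -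
      have "\<bar>sgn s * \<bar>s\<bar> powr (p - 1)\<bar> \<le> \<bar>s\<bar> powr (p - 1)" by (simp add: abs_mult sgn_if)
      also have "\<dots> \<le> 1 + \<bar>s\<bar> powr p"
      proof (cases "\<bar>s\<bar> \<le> 1")
        case True
        then have "\<bar>s\<bar> powr (p - 1) \<le> 1" using p by (intro powr_le1) auto
        then show ?thesis by (simp add: add_increasing2)
      next
        case False
        then have "\<bar>s\<bar> powr (p - 1) \<le> \<bar>s\<bar> powr p" by (intro powr_mono) auto
        then show ?thesis by simp
      qed
      finally show ?thesis .
    qed
    then show "AE x in M. norm (sgn (?S x) * \<bar>?S x\<bar> powr (p - 1)) \<le> norm (1 + \<bar>?S x\<bar> powr p)"
      by auto
  qed (use SL in \<open>auto simp: in_Lp_def intro!: measurable_compose[OF in_Lp_measurable[OF SL]]\<close>)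
  have "expectation (\<lambda>x. (id \<circ> Y k) x * ((\<lambda>s. sgn s * \<bar>s\<bar> powr (p - 1)) \<circ> ?S) x)
      = expectation (id \<circ> Y k) * expectation ((\<lambda>s. sgn s * \<bar>s\<bar> powr (p - 1)) \<circ> ?S)"
    using S1 in_Lp_imp_integrable[OF finite_measure_axioms, of p "Y k"] insert.prems(2)[of k] p
    by (intro indep_var_lebesgue_integral[OF iv2]) (auto simp: comp_def)
  then have "expectation (\<lambda>x. sgn (?S x) * \<bar>?S x\<bar> powr (p - 1) * Y k x) = 0"
    using insert.prems(3)[of k] by (simp add: comp_def mult_ac)
  then have "(Lp_norm p M (\<lambda>x. ?S x + Y k x))\<^sup>2 \<le> (Lp_norm p M ?S)\<^sup>2 + orth_const p * (Lp_norm p M (Y k))\<^sup>2"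
    using insert by (intro Lp_norm_orthogonal_add p SL) auto
  also have "(Lp_norm p M ?S)\<^sup>2 \<le> orth_const p * (\<Sum>i\<in>I. (Lp_norm p M (Y i))\<^sup>2)"
    using insert indep_vars_subset[OF insert.prems(1), of I] by auto
  finally show ?case using insert(1,2) by (simp add: algebra_simps)
qed

subsection \<open>Gaussian mixtures and their disintegration\<close>

lemma borel_RR_component: "i < d \<Longrightarrow> (\<lambda>x. x i) \<in> borel_RR d \<rightarrow>\<^sub>M (borel :: real measure)"
  unfolding borel_RR_def by (intro measurable_component_singleton) auto

lemma sets_PiM_lborel: "sets (PiM {..<d} (\<lambda>_. lborel)) = sets (borel_RR d)"
  unfolding borel_RR_def by (intro sets_PiM_cong) auto

lemma sets_std_gaussian: "sets (std_gaussian d) = sets (borel_RR d)"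
  unfolding borel_RR_def std_gaussian_def by (intro sets_PiM_cong) auto

lemma std_gaussian_component: "i < d \<Longrightarrow> (\<lambda>x. x i) \<in> std_gaussian d \<rightarrow>\<^sub>M (borel :: real measure)"
  by (subst measurable_cong_sets[OF sets_std_gaussian refl]) (rule borel_RR_component)

lemma affine_measurable [measurable]:
  "(\<lambda>z. \<lambda>i\<in>{..<d}. m i + s * z i) \<in> std_gaussian d \<rightarrow>\<^sub>M borel_RR d"
proof -
  have "(\<lambda>z. m i + s * z i) \<in> borel_measurable (std_gaussian d)" if "i < d" for i
    using std_gaussian_component[OF that] by simp
  then show ?thesis unfolding borel_RR_def by (intro measurable_restrict) auto
qed

lemma prob_space_std_normal: "prob_space (density lborel (\<lambda>x. ennreal (std_normal_density x)))"
  by (rule prob_space_normal_density) simp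

lemma prob_space_std_gaussian: "prob_space (std_gaussian d)"
  unfolding std_gaussian_def by (intro prob_space_PiM prob_space_std_normal)

text \<open>Density of N(m, s^2 I) at \<open>x\<close>. Point and mean enter only through their
  difference, so the expression serves as a density in \<open>x\<close> and later as a smooth test
  function of the mean.\<close>

definition gauss_density :: "nat \<Rightarrow> real \<Rightarrow> rvec \<Rightarrow> rvec \<Rightarrow> real" where
  "gauss_density d s m x = (\<Prod>i<d. normal_density (m i) s (x i))"

lemma gauss_density_nonneg [simp]: "0 \<le> gauss_density d s m x"
  by (simp add: gauss_density_def prod_nonneg)

lemma gauss_density_pos: "s > 0 \<Longrightarrow> 0 < gauss_density d s m x"
  by (simp add: gauss_density_def prod_pos normal_density_pos)

lemma gauss_density_measurable:
  "(\<lambda>x. ennreal (gauss_density d s m x)) \<in> borel_measurable (PiM {..<d} (\<lambda>_. lborel))"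
proof -
  have "(\<lambda>x. normal_density (m i) s (x i)) \<in> borel_measurable (borel_RR d)" if "i < d" for i
    by (rule measurable_compose[OF borel_RR_component[OF that] borel_measurable_normal_density])
  then have "(\<lambda>x. gauss_density d s m x) \<in> borel_measurable (borel_RR d)"
    unfolding gauss_density_def by (intro borel_measurable_prod) auto
  then show ?thesis by (subst measurable_cong_sets[OF sets_PiM_lborel refl]) measurable
qed

lemma gauss_density_eq_exp:
  "gauss_density d s m x = (1 / sqrt (2 * pi * s\<^sup>2)) ^ d * exp (- (\<Sum>i<d. (x i - m i)\<^sup>2) / (2 * s\<^sup>2))"
proof -
  have "gauss_density d s m x = (\<Prod>i<d. 1 / sqrt (2 * pi * s\<^sup>2)) * (\<Prod>i<d. exp (- (x i - m i)\<^sup>2 / (2 * s\<^sup>2)))"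
    unfolding gauss_density_def normal_density_def by (rule prod.distrib)
  also have "(\<Prod>i<d. exp (- (x i - m i)\<^sup>2 / (2 * s\<^sup>2))) = exp (\<Sum>i<d. - (x i - m i)\<^sup>2 / (2 * s\<^sup>2))"
    by (simp add: exp_sum)
  also have "(\<Sum>i<d. - (x i - m i)\<^sup>2 / (2 * s\<^sup>2)) = - (\<Sum>i<d. (x i - m i)\<^sup>2) / (2 * s\<^sup>2)"
    by (simp add: sum_negf sum_divide_distrib)
  finally show ?thesis by simp
qed

lemma gauss_density_le: "gauss_density d s m x \<le> (1 / sqrt (2 * pi * s\<^sup>2)) ^ d"
  unfolding gauss_density_eq_exp
  by (rule mult_left_le) (auto intro!: divide_nonneg_nonneg sum_nonneg)

text \<open>One factor of the residual is swallowed by its own Gaussian coordinate, since u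
  exp(-u^2/2) <= 1. This is the uniform bound behind the integrability of all integrands that carry
  a Gaussian weight and one residual.\<close>

lemma gauss_density_residual_le:
  assumes s: "s > 0" and j: "j < d"
  shows "gauss_density d s m x * \<bar>(x j - m j) / s\<bar> \<le> (1 / sqrt (2 * pi * s\<^sup>2)) ^ d"
proof -
  define u where "u = \<bar>(x j - m j) / s\<bar>"
  have u2: "u\<^sup>2 = (x j - m j)\<^sup>2 / s\<^sup>2" by (simp add: u_def power_divide)
  have "(x j - m j)\<^sup>2 \<le> (\<Sum>i<d. (x i - m i)\<^sup>2)"
    using j by (intro member_le_sum) auto
  then have "u\<^sup>2 / 2 \<le> (\<Sum>i<d. (x i - m i)\<^sup>2) / (2 * s\<^sup>2)"
    unfolding u2 divide_divide_eq_left mult.commute[of "s\<^sup>2" 2] by (rule divide_right_mono) simp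
  then have "exp (- (\<Sum>i<d. (x i - m i)\<^sup>2) / (2 * s\<^sup>2)) \<le> exp (- (u\<^sup>2 / 2))" by simp
  moreover have "u * exp (- (u\<^sup>2 / 2)) \<le> 1"
  proof -
    have "2 * u \<le> u\<^sup>2 + 1" using zero_le_power2[of "u - 1"] by (simp add: power2_diff)
    then have "u \<le> 1 + u\<^sup>2 / 2" by simp
    also have "\<dots> \<le> exp (u\<^sup>2 / 2)" by (rule exp_ge_add_one_self)
    finally show ?thesis by (simp add: exp_minus divide_simps)
  qed
  moreover have "u \<ge> 0" by (simp add: u_def)
  ultimately have "u * exp (- (\<Sum>i<d. (x i - m i)\<^sup>2) / (2 * s\<^sup>2)) \<le> 1"
    by (meson mult_left_mono order_trans)
  then have "(1 / sqrt (2 * pi * s\<^sup>2)) ^ d * (u * exp (- (\<Sum>i<d. (x i - m i)\<^sup>2) / (2 * s\<^sup>2))) \<le> (1 / sqrt (2 * pi * s\<^sup>2)) ^ d"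
    by (rule mult_left_le) simp
  then show ?thesis by (simp add: gauss_density_eq_exp u_def mult_ac)
qed

lemma distr_std_normal_affine:
  assumes "s > 0"
  shows "distr (density lborel (\<lambda>x. ennreal (std_normal_density x))) borel (\<lambda>z. m + s * z)
    = density lborel (\<lambda>x. ennreal (normal_density m s x))"
proof -
  let ?M = "density lborel (\<lambda>x. ennreal (std_normal_density x))"
  interpret prob_space ?M by (rule prob_space_std_normal)
  have "distributed ?M lborel (\<lambda>x. x) (\<lambda>x. ennreal (std_normal_density x))"
    unfolding distributed_def by (auto simp: distr_id2)
  from normal_density_affine[OF this, of s m] assms
  have "distributed ?M lborel (\<lambda>x. m + s * x) (\<lambda>x. ennreal (normal_density m s x))" by simp
  then have "distr ?M lborel (\<lambda>x. m + s * x) = density lborel (\<lambda>x. ennreal (normal_density m s x))"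
    by (simp add: distributed_def)
  moreover have "distr ?M lborel (\<lambda>x. m + s * x) = distr ?M borel (\<lambda>x. m + s * x)"
    by (intro distr_cong) auto
  ultimately show ?thesis by simp
qed

lemma distr_std_gaussian_affine:
  assumes s: "s > 0"
  shows "distr (std_gaussian d) (borel_RR d) (\<lambda>z. \<lambda>i\<in>{..<d}. m i + s * z i)
    = PiM {..<d} (\<lambda>i. density lborel (\<lambda>x. ennreal (normal_density (m i) s x)))"
proof -
  let ?G = "density lborel (\<lambda>x. ennreal (std_normal_density x))"
  let ?N = "\<lambda>i. density lborel (\<lambda>x. ennreal (normal_density (m i) s x))"
  interpret G: product_prob_space "\<lambda>_::nat. ?G"
    by (intro product_prob_spaceI prob_space_std_normal)
  interpret N: product_prob_space ?N
    by (intro product_prob_spaceI prob_space_normal_density s)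
  show ?thesis
  proof (rule N.PiM_eqI)
    fix A assume "\<And>i. i \<in> {..<d} \<Longrightarrow> A i \<in> sets (?N i)"
    then have A: "\<And>i. i \<in> {..<d} \<Longrightarrow> A i \<in> sets borel" by simp
    have PA: "Pi\<^sub>E {..<d} A \<in> sets (borel_RR d)"
      unfolding borel_RR_def by (intro sets_PiM_I_finite A) auto
    have eq: "(\<lambda>z. \<lambda>i\<in>{..<d}. m i + s * z i) -` Pi\<^sub>E {..<d} A \<inter> space (std_gaussian d)
        = Pi\<^sub>E {..<d} (\<lambda>i. (\<lambda>z. m i + s * z) -` A i)"
      by (auto simp: std_gaussian_def space_PiM PiE_iff)
    have "emeasure (distr (std_gaussian d) (borel_RR d) (\<lambda>z. \<lambda>i\<in>{..<d}. m i + s * z i)) (Pi\<^sub>E {..<d} A)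
        = emeasure (std_gaussian d) (Pi\<^sub>E {..<d} (\<lambda>i. (\<lambda>z. m i + s * z) -` A i))"
      by (simp add: emeasure_distr[OF affine_measurable PA] eq)
    also have "\<dots> = (\<Prod>i<d. emeasure ?G ((\<lambda>z. m i + s * z) -` A i))"
      unfolding std_gaussian_def
      by (intro G.emeasure_PiM) (auto intro!: measurable_sets_borel[OF _ A])
    also have "\<dots> = (\<Prod>i<d. emeasure (?N i) (A i))"
    proof (intro prod.cong refl)
      fix i assume i: "i \<in> {..<d}"
      have "emeasure (?N i) (A i) = emeasure (distr ?G borel (\<lambda>z. m i + s * z)) (A i)"
        by (simp add: distr_std_normal_affine[OF s])
      also have "\<dots> = emeasure ?G ((\<lambda>z. m i + s * z) -` A i)"
        using A[OF i] by (subst emeasure_distr) auto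
      finally show "emeasure ?G ((\<lambda>z. m i + s * z) -` A i) = emeasure (?N i) (A i)" ..
    qed
    finally show "emeasure (distr (std_gaussian d) (borel_RR d) (\<lambda>z. \<lambda>i\<in>{..<d}. m i + s * z i)) (Pi\<^sub>E {..<d} A)
      = (\<Prod>i\<in>{..<d}. emeasure (?N i) (A i))" .
  qed (auto simp: borel_RR_def intro!: sets_PiM_cong)
qed

lemma PiM_normal_density:
  assumes s: "s > 0"
  shows "PiM {..<d} (\<lambda>i. density lborel (\<lambda>x. ennreal (normal_density (m i) s x)))
    = density (PiM {..<d} (\<lambda>_. lborel)) (\<lambda>x. ennreal (gauss_density d s m x))"
proof -
  let ?N = "\<lambda>i. density lborel (\<lambda>x. ennreal (normal_density (m i) s x))"
  interpret N: product_prob_space ?N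
    by (intro product_prob_spaceI prob_space_normal_density s)
  interpret L: product_sigma_finite "\<lambda>_::nat. lborel :: real measure"
    by standard
  have "density (PiM {..<d} (\<lambda>_. lborel)) (\<lambda>x. ennreal (gauss_density d s m x)) = PiM {..<d} ?N"
  proof (rule N.PiM_eqI)
    fix A assume "\<And>i. i \<in> {..<d} \<Longrightarrow> A i \<in> sets (?N i)"
    then have A: "\<And>i. i \<in> {..<d} \<Longrightarrow> A i \<in> sets borel" by simp
    have PA: "Pi\<^sub>E {..<d} A \<in> sets (PiM {..<d} (\<lambda>_. lborel))"
      by (intro sets_PiM_I_finite) (auto simp: A)
    have "emeasure (density (PiM {..<d} (\<lambda>_. lborel)) (\<lambda>x. ennreal (gauss_density d s m x))) (Pi\<^sub>E {..<d} A)
        = (\<integral>\<^sup>+x. ennreal (gauss_density d s m x) * indicator (Pi\<^sub>E {..<d} A) x \<partial>PiM {..<d} (\<lambda>_. lborel))"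
      by (rule emeasure_density[OF gauss_density_measurable PA])
    also have "\<dots> = (\<integral>\<^sup>+x. (\<Prod>i<d. ennreal (normal_density (m i) s (x i)) * indicator (A i) (x i)) \<partial>PiM {..<d} (\<lambda>_. lborel))"
    proof (rule nn_integral_cong)
      fix x :: rvec assume "x \<in> space (PiM {..<d} (\<lambda>_. lborel))"
      then have "indicator (Pi\<^sub>E {..<d} A) x = (\<Prod>i<d. indicator (A i) (x i) :: ennreal)"
        by (auto simp: space_PiM PiE_iff indicator_def)
      then show "ennreal (gauss_density d s m x) * indicator (Pi\<^sub>E {..<d} A) x
          = (\<Prod>i<d. ennreal (normal_density (m i) s (x i)) * indicator (A i) (x i))"
        by (simp add: gauss_density_def prod.distrib prod_ennreal)
    qed
    also have "\<dots> = (\<Prod>i<d. \<integral>\<^sup>+y. ennreal (normal_density (m i) s y) * indicator (A i) y \<partial>lborel)"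
      by (intro L.product_nn_integral_prod[of "{..<d}" "\<lambda>i y. ennreal (normal_density (m i) s y) * indicator (A i) y"])
        (use A in auto)
    also have "\<dots> = (\<Prod>i<d. emeasure (?N i) (A i))"
      using A by (intro prod.cong refl, subst emeasure_density) auto
    finally show "emeasure (density (PiM {..<d} (\<lambda>_. lborel)) (\<lambda>x. ennreal (gauss_density d s m x))) (Pi\<^sub>E {..<d} A)
      = (\<Prod>i\<in>{..<d}. emeasure (?N i) (A i))" .
  qed (auto intro!: sets_PiM_cong)
  then show ?thesis ..
qed

lemma nn_integral_std_gaussian_affine:
  assumes s: "s > 0" and F[measurable]: "F \<in> borel_measurable (borel_RR d)"
  shows "(\<integral>\<^sup>+z. F (\<lambda>i\<in>{..<d}. m i + s * z i) \<partial>std_gaussian d)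
    = (\<integral>\<^sup>+x. ennreal (gauss_density d s m x) * F x \<partial>PiM {..<d} (\<lambda>_. lborel))"
proof -
  have FL: "F \<in> borel_measurable (PiM {..<d} (\<lambda>_. lborel))"
    using F by (simp add: measurable_cong_sets[OF sets_PiM_lborel refl])
  have "(\<integral>\<^sup>+z. F (\<lambda>i\<in>{..<d}. m i + s * z i) \<partial>std_gaussian d)
      = (\<integral>\<^sup>+x. F x \<partial>distr (std_gaussian d) (borel_RR d) (\<lambda>z. \<lambda>i\<in>{..<d}. m i + s * z i))"
    by (subst nn_integral_distr) auto
  also have "\<dots> = (\<integral>\<^sup>+x. F x \<partial>density (PiM {..<d} (\<lambda>_. lborel)) (\<lambda>x. ennreal (gauss_density d s m x)))"
    by (simp add: distr_std_gaussian_affine[OF s] PiM_normal_density[OF s])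
  also have "\<dots> = (\<integral>\<^sup>+x. ennreal (gauss_density d s m x) * F x \<partial>PiM {..<d} (\<lambda>_. lborel))"
    by (rule nn_integral_density[OF gauss_density_measurable FL])
  finally show ?thesis .
qed

text \<open>For c = cos t and s = sin t this is X_t. The argument is the pair of sample point and
  Gaussian vector rather than the value of S, since later integrands depend on the sample also
  through \<open>T\<close>.\<close>

definition gauss_comb :: "nat \<Rightarrow> (nat \<Rightarrow> 'w \<Rightarrow> real) \<Rightarrow> real \<Rightarrow> real \<Rightarrow> 'w \<times> rvec \<Rightarrow> rvec" where
  "gauss_comb d S c s = (\<lambda>(\<omega>, z). \<lambda>i\<in>{..<d}. c * S i \<omega> + s * z i)"

definition gauss_comb_law :: "'w measure \<Rightarrow> nat \<Rightarrow> (nat \<Rightarrow> 'w \<Rightarrow> real) \<Rightarrow> real \<Rightarrow> real \<Rightarrow> rvec measure" where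
  "gauss_comb_law P d S c s = distr (P \<Otimes>\<^sub>M std_gaussian d) (borel_RR d) (gauss_comb d S c s)"

lemma gauss_comb_measurable:
  assumes "\<And>i. i < d \<Longrightarrow> S i \<in> borel_measurable P"
  shows "gauss_comb d S c s \<in> P \<Otimes>\<^sub>M std_gaussian d \<rightarrow>\<^sub>M borel_RR d"
proof -
  have "(\<lambda>y. c * S i (fst y) + s * snd y i) \<in> borel_measurable (P \<Otimes>\<^sub>M std_gaussian d)" if "i < d" for i
    by (intro borel_measurable_add borel_measurable_times borel_measurable_const
        measurable_compose[OF measurable_fst assms[OF that]]
        measurable_compose[OF measurable_snd std_gaussian_component[OF that]])
  then show ?thesis
    unfolding gauss_comb_def borel_RR_def case_prod_beta by (intro measurable_restrict) auto
qed

lemma sets_gauss_comb_law [simp]: "sets (gauss_comb_law P d S c s) = sets (borel_RR d)"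
  by (simp add: gauss_comb_law_def)

text \<open>A positive \<open>s\<close> gives c S + s Z a density, whatever the law of S, and Bayes'
  formula then provides conditional laws in closed form.\<close>

locale gauss_mixture = prob_space P for P :: "'w measure" +
  fixes d :: nat and S :: "nat \<Rightarrow> 'w \<Rightarrow> real" and c s :: real
  assumes S_measurable [measurable]: "\<And>i. i < d \<Longrightarrow> S i \<in> borel_measurable P"
    and s_pos: "s > 0"
begin

definition kern :: "rvec \<Rightarrow> 'w \<Rightarrow> real" where
  "kern x \<omega> = gauss_density d s (\<lambda>i. c * S i \<omega>) x"

definition mix_density :: "rvec \<Rightarrow> real" where
  "mix_density x = (\<integral>\<omega>. kern x \<omega> \<partial>P)"

text \<open>The conditional density of \<open>\<omega>\<close> given \<open>c S(\<omega>) + s z = x\<close>.\<close>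

definition posterior :: "rvec \<Rightarrow> 'w \<Rightarrow> real" where
  "posterior x \<omega> = kern x \<omega> / mix_density x"

abbreviation mix_point :: "'w \<times> rvec \<Rightarrow> rvec" where
  "mix_point \<equiv> gauss_comb d S c s"

abbreviation mix_law :: "rvec measure" where
  "mix_law \<equiv> gauss_comb_law P d S c s"

lemma kern_pos: "0 < kern x \<omega>"
  by (simp add: kern_def gauss_density_pos s_pos)

lemma kern_measurable_pair [measurable]: "(\<lambda>(x, \<omega>). kern x \<omega>) \<in> borel_measurable (borel_RR d \<Otimes>\<^sub>M P)"
proof -
  have "(\<lambda>y. normal_density (c * S i (snd y)) s (fst y i)) \<in> borel_measurable (borel_RR d \<Otimes>\<^sub>M P)" if "i < d" for i
  proof -
    have [measurable]: "(\<lambda>y. fst y i) \<in> borel_measurable (borel_RR d \<Otimes>\<^sub>M P)"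
      by (rule measurable_compose[OF measurable_fst borel_RR_component[OF that]])
    have [measurable]: "(\<lambda>y. S i (snd y)) \<in> borel_measurable (borel_RR d \<Otimes>\<^sub>M P)"
      by (rule measurable_compose[OF measurable_snd S_measurable[OF that]])
    show ?thesis unfolding normal_density_def by measurable
  qed
  then show ?thesis
    unfolding kern_def gauss_density_def case_prod_beta by (intro borel_measurable_prod) auto
qed

lemma kern_measurable [measurable]: "kern x \<in> borel_measurable P"
proof -
  have "(\<lambda>\<omega>. normal_density (c * S i \<omega>) s (x i)) \<in> borel_measurable P" if [simp]: "i < d" for i
    unfolding normal_density_def by measurable
  then show ?thesis
    unfolding kern_def gauss_density_def by (intro borel_measurable_prod) auto
qed

lemma kern_le: "kern x \<omega> \<le> (1 / sqrt (2 * pi * s\<^sup>2)) ^ d"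
  unfolding kern_def by (rule gauss_density_le)

lemma kern_integrable: "integrable P (kern x)"
  by (rule integrable_const_bound[where B = "(1 / sqrt (2 * pi * s\<^sup>2)) ^ d"])
    (use kern_le kern_pos in \<open>auto simp: abs_of_pos\<close>)

lemma nn_integral_kern: "(\<integral>\<^sup>+\<omega>. ennreal (kern x \<omega>) \<partial>P) = ennreal (mix_density x)"
  unfolding mix_density_def using kern_pos
  by (intro nn_integral_eq_integral kern_integrable) (auto intro: less_imp_le)

text \<open>The Gaussian weight is positive everywhere, so its mean is too. The posterior is
  therefore a probability density for every \<open>x\<close>, with no exceptional null set to carry
  along.\<close>

lemma mix_density_pos: "0 < mix_density x"
proof -
  have nn: "0 \<le> mix_density x"
    unfolding mix_density_def using kern_pos by (intro integral_nonneg_AE) (auto intro: less_imp_le)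
  have "mix_density x \<noteq> 0"
  proof
    assume "mix_density x = 0"
    then have "AE \<omega> in P. kern x \<omega> = 0"
      unfolding mix_density_def using kern_pos[of x]
      by (subst (asm) integral_nonneg_eq_0_iff_AE[OF kern_integrable]) (auto intro: less_imp_le)
    then have "AE \<omega> in P. False" using kern_pos[of x] by (auto elim!: eventually_mono simp: less_le)
    then show False by simp
  qed
  then show ?thesis using nn by simp
qed

lemma mix_density_measurable [measurable]: "mix_density \<in> borel_measurable (borel_RR d)"
proof -
  have "(\<lambda>x. enn2real (\<integral>\<^sup>+\<omega>. ennreal (kern x \<omega>) \<partial>P)) \<in> borel_measurable (borel_RR d)"
    by measurable
  then show ?thesis using mix_density_pos by (simp add: nn_integral_kern less_imp_le)
qed

lemma posterior_nonneg: "0 \<le> posterior x \<omega>"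
  using kern_pos[of x \<omega>] mix_density_pos[of x] by (simp add: posterior_def)

lemma posterior_measurable_pair [measurable]:
  "(\<lambda>(x, \<omega>). posterior x \<omega>) \<in> borel_measurable (borel_RR d \<Otimes>\<^sub>M P)"
  unfolding posterior_def by measurable

lemma posterior_measurable [measurable]: "posterior x \<in> borel_measurable P"
  unfolding posterior_def by measurable

lemma nn_integral_posterior: "(\<integral>\<^sup>+\<omega>. ennreal (posterior x \<omega>) \<partial>P) = 1"
proof -
  have "(\<integral>\<^sup>+\<omega>. ennreal (posterior x \<omega>) \<partial>P) = (\<integral>\<^sup>+\<omega>. ennreal (kern x \<omega>) * ennreal (1 / mix_density x) \<partial>P)"
    unfolding posterior_def using mix_density_pos[of x] kern_pos[of x]
    by (intro nn_integral_cong) (simp add: ennreal_mult[symmetric] less_imp_le)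
  also have "\<dots> = ennreal (mix_density x) * ennreal (1 / mix_density x)"
    by (simp add: nn_integral_multc nn_integral_kern)
  also have "\<dots> = 1" using mix_density_pos[of x] by (simp add: ennreal_mult[symmetric] less_imp_le)
  finally show ?thesis .
qed

lemma mix_point_measurable [measurable]: "mix_point \<in> P \<Otimes>\<^sub>M std_gaussian d \<rightarrow>\<^sub>M borel_RR d"
  by (rule gauss_comb_measurable) measurable

sublocale Gm: prob_space "std_gaussian d"
  by (rule prob_space_std_gaussian)

sublocale PG: pair_prob_space P "std_gaussian d" ..

lemma prob_space_mix_law: "prob_space mix_law"
  unfolding gauss_comb_law_def by (intro PG.prob_space_distr) measurable

text \<open>For a fixed sample point the affine map z -> c S + s z turns the Gaussian law into the
  density \<open>kern\<close>; Tonelli then moves the integral over x outside.\<close>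

lemma nn_integral_mix_lborel:
  assumes F[measurable]: "F \<in> borel_measurable (borel_RR d \<Otimes>\<^sub>M P)"
  shows "(\<integral>\<^sup>+y. F (mix_point y, fst y) \<partial>(P \<Otimes>\<^sub>M std_gaussian d))
    = (\<integral>\<^sup>+x. \<integral>\<^sup>+\<omega>. ennreal (kern x \<omega>) * F (x, \<omega>) \<partial>P \<partial>PiM {..<d} (\<lambda>_. lborel))"
proof -
  interpret L: finite_product_sigma_finite "\<lambda>_::nat. lborel :: real measure" "{..<d}"
    by standard auto
  interpret PL: pair_sigma_finite P "PiM {..<d} (\<lambda>_. lborel :: real measure)" ..
  have "(\<integral>\<^sup>+y. F (mix_point y, fst y) \<partial>(P \<Otimes>\<^sub>M std_gaussian d))
      = (\<integral>\<^sup>+\<omega>. \<integral>\<^sup>+z. F (mix_point (\<omega>, z), \<omega>) \<partial>std_gaussian d \<partial>P)"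
    by (subst Gm.nn_integral_fst[symmetric]) auto
  also have "\<dots> = (\<integral>\<^sup>+\<omega>. \<integral>\<^sup>+x. ennreal (kern x \<omega>) * F (x, \<omega>) \<partial>PiM {..<d} (\<lambda>_. lborel) \<partial>P)"
  proof (rule nn_integral_cong)
    fix \<omega> assume [measurable]: "\<omega> \<in> space P"
    show "(\<integral>\<^sup>+z. F (mix_point (\<omega>, z), \<omega>) \<partial>std_gaussian d)
        = (\<integral>\<^sup>+x. ennreal (kern x \<omega>) * F (x, \<omega>) \<partial>PiM {..<d} (\<lambda>_. lborel))"
      unfolding gauss_comb_def kern_def case_prod_conv
      by (rule nn_integral_std_gaussian_affine[OF s_pos]) measurable
  qed
  also have "\<dots> = (\<integral>\<^sup>+x. \<integral>\<^sup>+\<omega>. ennreal (kern x \<omega>) * F (x, \<omega>) \<partial>P \<partial>PiM {..<d} (\<lambda>_. lborel))"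
  proof (rule PL.Fubini'[symmetric])
    have 1: "(\<lambda>(x, \<omega>). ennreal (kern x \<omega>) * F (x, \<omega>)) \<in> borel_measurable (borel_RR d \<Otimes>\<^sub>M P)"
      by measurable
    have 2: "(\<lambda>(\<omega>, x). (x, \<omega>)) \<in> P \<Otimes>\<^sub>M PiM {..<d} (\<lambda>_. lborel) \<rightarrow>\<^sub>M borel_RR d \<Otimes>\<^sub>M P"
      by (subst measurable_cong_sets[OF refl sets_pair_measure_cong[OF sets_PiM_lborel[symmetric] refl]]) measurable
    show "(\<lambda>(\<omega>, x). ennreal (kern x \<omega>) * F (x, \<omega>)) \<in> borel_measurable (P \<Otimes>\<^sub>M PiM {..<d} (\<lambda>_. lborel))"
      using measurable_compose[OF 2 1] by (simp add: case_prod_beta)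
  qed
  finally show ?thesis .
qed

lemma mix_law_eq_density: "mix_law = density (PiM {..<d} (\<lambda>_. lborel)) (\<lambda>x. ennreal (mix_density x))"
proof (rule measure_eqI)
  fix A assume A: "A \<in> sets mix_law"
  then have [measurable]: "A \<in> sets (borel_RR d)" by simp
  have mm: "(\<lambda>x. ennreal (mix_density x)) \<in> borel_measurable (PiM {..<d} (\<lambda>_. lborel))"
    by (subst measurable_cong_sets[OF sets_PiM_lborel refl]) measurable
  have "emeasure mix_law A = (\<integral>\<^sup>+x. indicator A x \<partial>mix_law)" using A by simp
  also have "\<dots> = (\<integral>\<^sup>+y. indicator A (mix_point y) \<partial>(P \<Otimes>\<^sub>M std_gaussian d))"
    unfolding gauss_comb_law_def by (rule nn_integral_distr) measurable
  also have "\<dots> = (\<integral>\<^sup>+x. \<integral>\<^sup>+\<omega>. ennreal (kern x \<omega>) * indicator A x \<partial>P \<partial>PiM {..<d} (\<lambda>_. lborel))"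
    using nn_integral_mix_lborel[of "\<lambda>(x, \<omega>). indicator A x"] by simp
  also have "\<dots> = (\<integral>\<^sup>+x. ennreal (mix_density x) * indicator A x \<partial>PiM {..<d} (\<lambda>_. lborel))"
    by (simp add: nn_integral_multc nn_integral_kern)
  also have "\<dots> = emeasure (density (PiM {..<d} (\<lambda>_. lborel)) (\<lambda>x. ennreal (mix_density x))) A"
    by (rule emeasure_density[symmetric, OF mm]) (simp add: sets_PiM_lborel)
  finally show "emeasure mix_law A = emeasure (density (PiM {..<d} (\<lambda>_. lborel)) (\<lambda>x. ennreal (mix_density x))) A" .
qed (simp add: sets_PiM_lborel)

text \<open>Bayes' formula: drawing (\<omega>, z) and recording x is the same as drawing x from the
  mixture and \<omega> from its posterior, because \<open>posterior\<close> times
  \<open>mix_density\<close> is \<open>kern\<close>.\<close>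

lemma nn_integral_mix_disintegration:
  assumes F[measurable]: "F \<in> borel_measurable (borel_RR d \<Otimes>\<^sub>M P)"
  shows "(\<integral>\<^sup>+y. F (mix_point y, fst y) \<partial>(P \<Otimes>\<^sub>M std_gaussian d))
    = (\<integral>\<^sup>+x. \<integral>\<^sup>+\<omega>. ennreal (posterior x \<omega>) * F (x, \<omega>) \<partial>P \<partial>mix_law)"
proof -
  have mm: "(\<lambda>x. ennreal (mix_density x)) \<in> borel_measurable (PiM {..<d} (\<lambda>_. lborel))"
    by (subst measurable_cong_sets[OF sets_PiM_lborel refl]) measurable
  have fm: "(\<lambda>x. \<integral>\<^sup>+\<omega>. ennreal (posterior x \<omega>) * F (x, \<omega>) \<partial>P) \<in> borel_measurable (PiM {..<d} (\<lambda>_. lborel))"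
    by (subst measurable_cong_sets[OF sets_PiM_lborel refl]) measurable
  have "(\<integral>\<^sup>+x. \<integral>\<^sup>+\<omega>. ennreal (posterior x \<omega>) * F (x, \<omega>) \<partial>P \<partial>mix_law)
      = (\<integral>\<^sup>+x. ennreal (mix_density x) * (\<integral>\<^sup>+\<omega>. ennreal (posterior x \<omega>) * F (x, \<omega>) \<partial>P) \<partial>PiM {..<d} (\<lambda>_. lborel))"
    unfolding mix_law_eq_density by (rule nn_integral_density[OF mm fm])
  also have "\<dots> = (\<integral>\<^sup>+x. \<integral>\<^sup>+\<omega>. ennreal (kern x \<omega>) * F (x, \<omega>) \<partial>P \<partial>PiM {..<d} (\<lambda>_. lborel))"
  proof (rule nn_integral_cong)
    fix x assume "x \<in> space (PiM {..<d} (\<lambda>_. lborel :: real measure))"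
    then have x[measurable]: "x \<in> space (borel_RR d)" by (simp add: sets_eq_imp_space_eq[OF sets_PiM_lborel])
    have "ennreal (mix_density x) * (\<integral>\<^sup>+\<omega>. ennreal (posterior x \<omega>) * F (x, \<omega>) \<partial>P)
        = (\<integral>\<^sup>+\<omega>. ennreal (mix_density x) * (ennreal (posterior x \<omega>) * F (x, \<omega>)) \<partial>P)"
      by (rule nn_integral_cmult[symmetric]) (use x in measurable)
    also have "\<dots> = (\<integral>\<^sup>+\<omega>. ennreal (kern x \<omega>) * F (x, \<omega>) \<partial>P)"
      using mix_density_pos[of x] kern_pos[of x]
      by (intro nn_integral_cong)
        (simp add: mult.assoc[symmetric] ennreal_mult[symmetric] posterior_def less_imp_le)
    finally show "ennreal (mix_density x) * (\<integral>\<^sup>+\<omega>. ennreal (posterior x \<omega>) * F (x, \<omega>) \<partial>P)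
        = (\<integral>\<^sup>+\<omega>. ennreal (kern x \<omega>) * F (x, \<omega>) \<partial>P)" .
  qed
  also have "\<dots> = (\<integral>\<^sup>+y. F (mix_point y, fst y) \<partial>(P \<Otimes>\<^sub>M std_gaussian d))"
    by (rule nn_integral_mix_lborel[symmetric, OF F])
  finally show ?thesis ..
qed

end

section \<open>Jensen's inequality, norms on product spaces and Gaussian moments\<close>

text \<open>Jensen's inequality for the probability density \<open>w\<close>: the tangent of |t|^p
  at the mean is integrated against \<open>w\<close>. Extended reals make an infinite right side
  harmless.\<close>

lemma abs_integral_powr_le:
  fixes w b :: "'a \<Rightarrow> real"
  assumes p: "p \<ge> 1" and [measurable]: "w \<in> borel_measurable M" "b \<in> borel_measurable M"
    and w: "\<And>x. 0 \<le> w x" "(\<integral>\<^sup>+x. ennreal (w x) \<partial>M) = 1"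
    and wb: "integrable M (\<lambda>x. w x * b x)"
  shows "ennreal (\<bar>\<integral>x. w x * b x \<partial>M\<bar> powr p) \<le> (\<integral>\<^sup>+x. ennreal (w x) * ennreal (\<bar>b x\<bar> powr p) \<partial>M)"
proof (cases "(\<integral>\<^sup>+x. ennreal (w x * \<bar>b x\<bar> powr p) \<partial>M) = \<infinity>")
  case True
  then show ?thesis using w by (simp add: ennreal_mult)
next
  case False
  have iw: "integrable M w"
    by (rule integrableI_nonneg) (use w in auto)
  have w1: "(\<integral>x. w x \<partial>M) = 1"
    using nn_integral_eq_integral[OF iw] w by simp
  have ib: "integrable M (\<lambda>x. w x * \<bar>b x\<bar> powr p)"
    by (rule integrableI_nonneg) (use w False in \<open>auto simp: less_top\<close>)
  define m where "m = (\<integral>x. w x * b x \<partial>M)"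
  define \<sigma> where "\<sigma> = p * (sgn m * \<bar>m\<bar> powr (p - 1))"
  have "(\<integral>x. (\<bar>m\<bar> powr p - \<sigma> * m) * w x + \<sigma> * (w x * b x) \<partial>M) \<le> (\<integral>x. w x * \<bar>b x\<bar> powr p \<partial>M)"
  proof (rule integral_mono)
    fix x
    have "w x * (\<bar>m\<bar> powr p + \<sigma> * (b x - m)) \<le> w x * \<bar>b x\<bar> powr p"
      unfolding \<sigma>_def by (intro mult_left_mono abs_powr_above_tangent p w)
    then show "(\<bar>m\<bar> powr p - \<sigma> * m) * w x + \<sigma> * (w x * b x) \<le> w x * \<bar>b x\<bar> powr p"
      by (simp add: algebra_simps)
  qed (use iw wb ib in auto)
  moreover have "(\<integral>x. (\<bar>m\<bar> powr p - \<sigma> * m) * w x + \<sigma> * (w x * b x) \<partial>M) = \<bar>m\<bar> powr p"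
    using iw wb by (simp add: w1 m_def[symmetric])
  ultimately have "\<bar>m\<bar> powr p \<le> (\<integral>x. w x * \<bar>b x\<bar> powr p \<partial>M)" by simp
  then have "ennreal (\<bar>m\<bar> powr p) \<le> (\<integral>\<^sup>+x. ennreal (w x * \<bar>b x\<bar> powr p) \<partial>M)"
    using nn_integral_eq_integral[OF ib] w by (simp add: ennreal_leI)
  then show ?thesis using w by (simp add: ennreal_mult m_def)
qed

text \<open>Comparing extended integrals makes finiteness of the norm of \<open>f\<close> part of
  the conclusion; norm estimates are carried between different sample spaces in this way.\<close>

lemma Lp_norm_le_nn_integral:
  assumes "p > 0" "f \<in> borel_measurable M" "in_Lp p N g"
    and le: "(\<integral>\<^sup>+x. ennreal (\<bar>f x\<bar> powr p) \<partial>M) \<le> (\<integral>\<^sup>+x. ennreal (\<bar>g x\<bar> powr p) \<partial>N)"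
  shows "in_Lp p M f" "Lp_norm p M f \<le> Lp_norm p N g"
proof -
  have g: "(\<integral>\<^sup>+x. ennreal (\<bar>g x\<bar> powr p) \<partial>N) = ennreal (\<integral>x. \<bar>g x\<bar> powr p \<partial>N)"
    using assms(3) by (intro nn_integral_eq_integral) (auto simp: in_Lp_def)
  have i: "integrable M (\<lambda>x. \<bar>f x\<bar> powr p)"
  proof (rule integrableI_nonneg)
    show "(\<integral>\<^sup>+x. ennreal (\<bar>f x\<bar> powr p) \<partial>M) < \<infinity>"
      using le unfolding g by (auto simp: less_top[symmetric] top_unique)
  qed (use assms in auto)
  then show "in_Lp p M f" using assms(2) by (simp add: in_Lp_def)
  have "(\<integral>\<^sup>+x. ennreal (\<bar>f x\<bar> powr p) \<partial>M) = ennreal (\<integral>x. \<bar>f x\<bar> powr p \<partial>M)"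
    using i by (intro nn_integral_eq_integral) auto
  then have "(\<integral>x. \<bar>f x\<bar> powr p \<partial>M) \<le> (\<integral>x. \<bar>g x\<bar> powr p \<partial>N)"
    using le unfolding g by (simp add: integral_nonneg_AE)
  then show "Lp_norm p M f \<le> Lp_norm p N g"
    unfolding Lp_norm_def using assms(1) by (intro powr_mono2) auto
qed

lemma (in pair_sigma_finite)
  assumes f: "in_Lp p M1 f" and g: "in_Lp p M2 g"
  shows in_Lp_pair_mult: "in_Lp p (M1 \<Otimes>\<^sub>M M2) (\<lambda>z. f (fst z) * g (snd z))"
    and Lp_norm_pair_mult: "Lp_norm p (M1 \<Otimes>\<^sub>M M2) (\<lambda>z. f (fst z) * g (snd z)) = Lp_norm p M1 f * Lp_norm p M2 g"
proof -
  have [measurable]: "f \<in> borel_measurable M1" "g \<in> borel_measurable M2"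
    using f g by (auto simp: in_Lp_def)
  have nf: "(\<integral>\<^sup>+x. ennreal (\<bar>f x\<bar> powr p) \<partial>M1) = ennreal (\<integral>x. \<bar>f x\<bar> powr p \<partial>M1)"
    using f by (intro nn_integral_eq_integral) (auto simp: in_Lp_def)
  have ng: "(\<integral>\<^sup>+x. ennreal (\<bar>g x\<bar> powr p) \<partial>M2) = ennreal (\<integral>x. \<bar>g x\<bar> powr p \<partial>M2)"
    using g by (intro nn_integral_eq_integral) (auto simp: in_Lp_def)
  have "(\<integral>\<^sup>+z. ennreal (\<bar>f (fst z) * g (snd z)\<bar> powr p) \<partial>(M1 \<Otimes>\<^sub>M M2))
      = (\<integral>\<^sup>+x. \<integral>\<^sup>+y. ennreal (\<bar>f x\<bar> powr p) * ennreal (\<bar>g y\<bar> powr p) \<partial>M2 \<partial>M1)"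
    by (subst M2.nn_integral_fst[symmetric]) (auto simp: abs_mult powr_mult ennreal_mult)
  also have "\<dots> = ennreal (\<integral>x. \<bar>f x\<bar> powr p \<partial>M1) * ennreal (\<integral>x. \<bar>g x\<bar> powr p \<partial>M2)"
    by (simp add: nn_integral_cmult nn_integral_multc nf ng)
  finally have eq: "(\<integral>\<^sup>+z. ennreal (\<bar>f (fst z) * g (snd z)\<bar> powr p) \<partial>(M1 \<Otimes>\<^sub>M M2))
      = ennreal ((\<integral>x. \<bar>f x\<bar> powr p \<partial>M1) * (\<integral>x. \<bar>g x\<bar> powr p \<partial>M2))"
    by (simp add: ennreal_mult integral_nonneg_AE)
  have i: "integrable (M1 \<Otimes>\<^sub>M M2) (\<lambda>z. \<bar>f (fst z) * g (snd z)\<bar> powr p)"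
    by (rule integrableI_nonneg) (auto simp: eq)
  then show "in_Lp p (M1 \<Otimes>\<^sub>M M2) (\<lambda>z. f (fst z) * g (snd z))" by (simp add: in_Lp_def)
  have "(\<integral>z. \<bar>f (fst z) * g (snd z)\<bar> powr p \<partial>(M1 \<Otimes>\<^sub>M M2)) = (\<integral>x. \<bar>f x\<bar> powr p \<partial>M1) * (\<integral>x. \<bar>g x\<bar> powr p \<partial>M2)"
    using eq nn_integral_eq_integral[OF i] by (simp add: integral_nonneg_AE)
  then show "Lp_norm p (M1 \<Otimes>\<^sub>M M2) (\<lambda>z. f (fst z) * g (snd z)) = Lp_norm p M1 f * Lp_norm p M2 g"
    by (simp add: Lp_norm_def powr_mult integral_nonneg_AE)
qed

lemma (in prob_space) in_Lp_one: "in_Lp p M (\<lambda>_. 1)" and Lp_norm_one: "Lp_norm p M (\<lambda>_. 1) = 1"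
  by (auto simp: in_Lp_def Lp_norm_def prob_space)

lemma (in pair_prob_space)
  assumes "in_Lp p M1 f"
  shows in_Lp_fst: "in_Lp p (M1 \<Otimes>\<^sub>M M2) (\<lambda>z. f (fst z))"
    and Lp_norm_fst: "Lp_norm p (M1 \<Otimes>\<^sub>M M2) (\<lambda>z. f (fst z)) = Lp_norm p M1 f"
  using in_Lp_pair_mult[OF assms M2.in_Lp_one] Lp_norm_pair_mult[OF assms M2.in_Lp_one] M2.Lp_norm_one[of p] by auto

lemma (in pair_prob_space)
  assumes "in_Lp p M2 f"
  shows in_Lp_snd: "in_Lp p (M1 \<Otimes>\<^sub>M M2) (\<lambda>z. f (snd z))"
    and Lp_norm_snd: "Lp_norm p (M1 \<Otimes>\<^sub>M M2) (\<lambda>z. f (snd z)) = Lp_norm p M2 f"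
  using in_Lp_pair_mult[OF M1.in_Lp_one assms] Lp_norm_pair_mult[OF M1.in_Lp_one assms] M1.Lp_norm_one[of p] by auto

definition normal_norm :: "real \<Rightarrow> real" where
  "normal_norm p = Lp_norm p (density lborel (\<lambda>x. ennreal (std_normal_density x))) (\<lambda>x. x)"

text \<open>Moments of real order are dominated by 1 + |x|^k with a natural k >= p.\<close>

lemma in_Lp_std_normal:
  assumes p: "p > 0"
  shows "in_Lp p (density lborel (\<lambda>x. ennreal (std_normal_density x))) (\<lambda>x. x)"
proof -
  interpret prob_space "density lborel (\<lambda>x. ennreal (std_normal_density x))" by (rule prob_space_std_normal)
  obtain k :: nat where k: "p \<le> real k" using real_arch_simple by blast
  have ik: "integrable (density lborel (\<lambda>x. ennreal (std_normal_density x))) (\<lambda>x. \<bar>x\<bar> ^ k)"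
    using integrable_std_normal_moment_abs[of k] by (subst integrable_density) auto
  have b: "\<bar>x\<bar> powr p \<le> 1 + \<bar>x\<bar> ^ k" for x :: real
  proof (cases "\<bar>x\<bar> \<le> 1")
    case True
    then have "\<bar>x\<bar> powr p \<le> 1" using p by (intro powr_le1) auto
    then show ?thesis by (simp add: add_increasing2)
  next
    case False
    then have "\<bar>x\<bar> powr p \<le> \<bar>x\<bar> powr real k" using k by (intro powr_mono) auto
    also have "\<dots> = \<bar>x\<bar> ^ k" using False by (subst powr_realpow) auto
    finally show ?thesis by simp
  qed
  have "integrable (density lborel (\<lambda>x. ennreal (std_normal_density x))) (\<lambda>x. \<bar>x\<bar> powr p)"
  proof (rule Bochner_Integration.integrable_bound)
    show "integrable (density lborel (\<lambda>x. ennreal (std_normal_density x))) (\<lambda>x. 1 + \<bar>x\<bar> ^ k)"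
      using ik by simp
    show "AE x in density lborel (\<lambda>x. ennreal (std_normal_density x)). norm (\<bar>x\<bar> powr p) \<le> norm (1 + \<bar>x\<bar> ^ k)"
      using b by (intro AE_I2) (simp only: real_norm_def abs_of_nonneg[OF powr_ge_zero] order_trans[OF b abs_ge_self])
  qed measurable
  then show ?thesis by (simp add: in_Lp_def)
qed

lemma
  assumes i: "i < d" and p: "p > 0"
  shows in_Lp_std_gaussian: "in_Lp p (std_gaussian d) (\<lambda>z. z i)"
    and Lp_norm_std_gaussian: "Lp_norm p (std_gaussian d) (\<lambda>z. z i) = normal_norm p"
proof -
  let ?G = "density lborel (\<lambda>x. ennreal (std_normal_density x))"
  have d: "distr (std_gaussian d) ?G (\<lambda>z. z i) = ?G"
    unfolding std_gaussian_def using i by (intro distr_PiM_component prob_space_std_normal) auto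
  have m: "(\<lambda>z. z i) \<in> std_gaussian d \<rightarrow>\<^sub>M ?G"
    using std_gaussian_component[OF i] by simp
  have id: "(\<lambda>x::real. x) \<in> borel_measurable ?G" by simp
  show "in_Lp p (std_gaussian d) (\<lambda>z. z i)"
    using in_Lp_distr(1)[OF m id, of p] in_Lp_std_normal[OF p] by (simp only: d)
  show "Lp_norm p (std_gaussian d) (\<lambda>z. z i) = normal_norm p"
    unfolding normal_norm_def using in_Lp_distr(2)[OF m id, of p] by (simp only: d)
qed

lemma (in prob_space)
  assumes f: "in_Lp p M f" and i: "i < d" and p: "p \<ge> 1"
  shows in_Lp_gauss_combination: "in_Lp p (M \<Otimes>\<^sub>M std_gaussian d) (\<lambda>y. a * f (fst y) + b * snd y i)"
    and Lp_norm_gauss_combination: "Lp_norm p (M \<Otimes>\<^sub>M std_gaussian d) (\<lambda>y. a * f (fst y) + b * snd y i)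
      \<le> \<bar>a\<bar> * Lp_norm p M f + \<bar>b\<bar> * normal_norm p"
proof -
  have p0: "p > 0" using p by simp
  interpret G: prob_space "std_gaussian d" by (rule prob_space_std_gaussian)
  interpret MG: pair_prob_space M "std_gaussian d" ..
  note F = MG.in_Lp_fst[OF f]
  note Z = MG.in_Lp_snd[OF in_Lp_std_gaussian[OF i p0]]
  note ab = in_Lp_cmult[OF F p0, of a] in_Lp_cmult[OF Z p0, of b]
  show "in_Lp p (M \<Otimes>\<^sub>M std_gaussian d) (\<lambda>y. a * f (fst y) + b * snd y i)"
    by (rule in_Lp_add[OF ab p0])
  show "Lp_norm p (M \<Otimes>\<^sub>M std_gaussian d) (\<lambda>y. a * f (fst y) + b * snd y i)
      \<le> \<bar>a\<bar> * Lp_norm p M f + \<bar>b\<bar> * normal_norm p"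
    using Lp_norm_add_le[OF ab p]
    by (simp add: Lp_norm_cmult[OF F p0] Lp_norm_cmult[OF Z p0] MG.Lp_norm_fst[OF f]
        MG.Lp_norm_snd[OF in_Lp_std_gaussian[OF i p0]] Lp_norm_std_gaussian[OF i p0])
qed

section \<open>The conditional velocity of the rotation under a Stein identity\<close>

text \<open>\<open>stein\<close> is the Stein identity for h = \<open>kern x\<close>, regarded as a
  function of S: its partial derivative in S_j is c / s^2 (x_j - c S_j) h, and multiplication by s^2
  removes the quotient. \<open>T\<close> lives on the sample space, next to S.\<close>

locale stein_mixture = gauss_mixture P d S c s for P :: "'w measure" and d S c s +
  fixes T :: "nat \<Rightarrow> nat \<Rightarrow> 'w \<Rightarrow> real" and p :: real
  assumes p_ge: "p \<ge> 2"
    and S_Lp: "\<And>i. i < d \<Longrightarrow> in_Lp p P (S i)"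
    and T_Lp: "\<And>i j. i < d \<Longrightarrow> j < d \<Longrightarrow> in_Lp p P (T i j)"
    and cs: "c\<^sup>2 + s\<^sup>2 = 1"
    and stein: "\<And>i x. i < d \<Longrightarrow> s\<^sup>2 * expectation (\<lambda>\<omega>. S i \<omega> * kern x \<omega>)
        = c * expectation (\<lambda>\<omega>. (\<Sum>j<d. T i j \<omega> * (x j - c * S j \<omega>)) * kern x \<omega>)"
begin

text \<open>The Gaussian vector that must have been drawn for c S + s z to equal
  \<open>x\<close>.\<close>

definition residual :: "rvec \<Rightarrow> 'w \<Rightarrow> rvec" where
  "residual x \<omega> j = (x j - c * S j \<omega>) / s"

definition defect :: "nat \<Rightarrow> 'w \<Rightarrow> rvec \<Rightarrow> real" where
  "defect i \<omega> z = (\<Sum>j<d. T i j \<omega> * z j) - z i"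

text \<open>A coordinate of the velocity X_t' = - sin t S + cos t Z.\<close>

definition rotated :: "nat \<Rightarrow> 'w \<Rightarrow> rvec \<Rightarrow> real" where
  "rotated i \<omega> z = c * z i - s * S i \<omega>"

text \<open>Written through the defect, so that its size is visible; \<open>drift_eq_rotated\<close>
  identifies it with the conditional mean of the velocity.\<close>

definition drift :: "nat \<Rightarrow> rvec \<Rightarrow> real" where
  "drift i x = (\<integral>\<omega>. posterior x \<omega> * (- c * defect i \<omega> (residual x \<omega>)) \<partial>P)"

abbreviation defect_norm :: "nat \<Rightarrow> real" where
  "defect_norm i \<equiv> Lp_norm p (P \<Otimes>\<^sub>M std_gaussian d) (\<lambda>y. defect i (fst y) (snd y))"

text \<open>Bounds the p-norm of every combination of S_i and Z_i with coefficients of modulus at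
  most 1, hence of both position and velocity.\<close>

abbreviation radius :: "nat \<Rightarrow> real" where
  "radius i \<equiv> Lp_norm p P (S i) + normal_norm p"

lemma p_pos: "p > 0" "p \<ge> 1" using p_ge by auto

lemma T_measurable [measurable]: "i < d \<Longrightarrow> j < d \<Longrightarrow> T i j \<in> borel_measurable P"
  using T_Lp by (auto simp: in_Lp_def)

lemma abs_c_le: "\<bar>c\<bar> \<le> 1" and s_le: "s \<le> 1"
proof -
  have "c\<^sup>2 \<le> 1" "s\<^sup>2 \<le> 1" using cs zero_le_power2[of s] zero_le_power2[of c] by linarith+
  then show "\<bar>c\<bar> \<le> 1" "s \<le> 1" using s_pos by (auto simp: abs_square_le_1)
qed

lemma residual_measurable: "j < d \<Longrightarrow> (\<lambda>v. residual (fst v) (snd v) j) \<in> borel_measurable (borel_RR d \<Otimes>\<^sub>M P)"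
  unfolding residual_def
  by (intro borel_measurable_divide borel_measurable_diff borel_measurable_times borel_measurable_const
    measurable_compose[OF measurable_fst borel_RR_component] measurable_compose[OF measurable_snd S_measurable])

lemma residual_measurable': "j < d \<Longrightarrow> (\<lambda>\<omega>. residual x \<omega> j) \<in> borel_measurable P"
  unfolding residual_def by measurable

lemma defect_measurable:
  assumes "i < d" shows "(\<lambda>v. defect i (snd v) (residual (fst v) (snd v))) \<in> borel_measurable (borel_RR d \<Otimes>\<^sub>M P)"
  unfolding defect_def using assms
  by (intro borel_measurable_diff borel_measurable_sum borel_measurable_times residual_measurable
    measurable_compose[OF measurable_snd T_measurable]) auto

lemma defect_measurable':
  assumes "i < d" shows "(\<lambda>\<omega>. defect i \<omega> (residual x \<omega>)) \<in> borel_measurable P"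
  unfolding defect_def using assms
  by (intro borel_measurable_diff borel_measurable_sum borel_measurable_times residual_measurable' T_measurable) auto

lemma rotated_measurable:
  assumes "i < d" shows "(\<lambda>v. rotated i (snd v) (residual (fst v) (snd v))) \<in> borel_measurable (borel_RR d \<Otimes>\<^sub>M P)"
  unfolding rotated_def using assms
  by (intro borel_measurable_diff borel_measurable_times residual_measurable borel_measurable_const
    measurable_compose[OF measurable_snd S_measurable]) auto

lemma drift_measurable: assumes "i < d" shows "drift i \<in> borel_measurable (borel_RR d)"
proof -
  have "(\<lambda>(x, \<omega>). posterior x \<omega> * (- c * defect i \<omega> (residual x \<omega>))) \<in> borel_measurable (borel_RR d \<Otimes>\<^sub>M P)"
    using posterior_measurable_pair defect_measurable[OF assms]
    by (simp add: case_prod_beta)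
  then show ?thesis unfolding drift_def by (rule borel_measurable_lebesgue_integral)
qed

lemma kern_residual_le:
  assumes "j < d"
  shows "kern x \<omega> * \<bar>residual x \<omega> j\<bar> \<le> (1 / sqrt (2 * pi * s\<^sup>2)) ^ d"
  unfolding kern_def residual_def by (rule gauss_density_residual_le[OF s_pos assms])

lemma integrable_S: "i < d \<Longrightarrow> integrable P (S i)"
  by (rule in_Lp_imp_integrable[OF finite_measure_axioms S_Lp p_pos(2)])

lemma integrable_T: "i < d \<Longrightarrow> j < d \<Longrightarrow> integrable P (T i j)"
  by (rule in_Lp_imp_integrable[OF finite_measure_axioms T_Lp p_pos(2)])

lemma integrable_S_kern: assumes "i < d" shows "integrable P (\<lambda>\<omega>. S i \<omega> * kern x \<omega>)"
proof (rule Bochner_Integration.integrable_bound)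
  show "integrable P (\<lambda>\<omega>. S i \<omega> * (1 / sqrt (2 * pi * s\<^sup>2)) ^ d)" using integrable_S[OF assms] by simp
  show "AE \<omega> in P. norm (S i \<omega> * kern x \<omega>) \<le> norm (S i \<omega> * (1 / sqrt (2 * pi * s\<^sup>2)) ^ d)"
  proof (rule AE_I2)
    fix \<omega>
    have "\<bar>kern x \<omega>\<bar> \<le> \<bar>(1 / sqrt (2 * pi * s\<^sup>2)) ^ d\<bar>"
      using kern_le[of x \<omega>] kern_pos[of x \<omega>] by linarith
    then show "norm (S i \<omega> * kern x \<omega>) \<le> norm (S i \<omega> * (1 / sqrt (2 * pi * s\<^sup>2)) ^ d)"
      unfolding real_norm_def abs_mult by (intro mult_left_mono) auto
  qed
qed (use assms in measurable)

lemma integrable_T_residual_kern: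
  assumes "i < d" "j < d" shows "integrable P (\<lambda>\<omega>. T i j \<omega> * (residual x \<omega> j * kern x \<omega>))"
proof (rule Bochner_Integration.integrable_bound)
  show "integrable P (\<lambda>\<omega>. T i j \<omega> * (1 / sqrt (2 * pi * s\<^sup>2)) ^ d)" using integrable_T[OF assms] by simp
  show "AE \<omega> in P. norm (T i j \<omega> * (residual x \<omega> j * kern x \<omega>)) \<le> norm (T i j \<omega> * (1 / sqrt (2 * pi * s\<^sup>2)) ^ d)"
  proof (rule AE_I2)
    fix \<omega>
    have "\<bar>residual x \<omega> j * kern x \<omega>\<bar> \<le> \<bar>(1 / sqrt (2 * pi * s\<^sup>2)) ^ d\<bar>"
      using kern_residual_le[OF assms(2), of x \<omega>] kern_pos[of x \<omega>] by (simp add: abs_mult mult.commute)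
    then show "norm (T i j \<omega> * (residual x \<omega> j * kern x \<omega>)) \<le> norm (T i j \<omega> * (1 / sqrt (2 * pi * s\<^sup>2)) ^ d)"
      unfolding real_norm_def abs_mult[of "T i j \<omega>"] by (intro mult_left_mono) auto
  qed
qed (use assms residual_measurable' in measurable)

lemma integrable_residual_kern:
  assumes "j < d" shows "integrable P (\<lambda>\<omega>. residual x \<omega> j * kern x \<omega>)"
proof (rule integrable_const_bound)
  show "AE \<omega> in P. norm (residual x \<omega> j * kern x \<omega>) \<le> (1 / sqrt (2 * pi * s\<^sup>2)) ^ d"
    using kern_residual_le[OF assms, of x]
    by (intro AE_I2) (simp add: abs_mult abs_of_pos[OF kern_pos] mult.commute)
qed (use assms residual_measurable' in measurable)

lemma integrable_defect_kern:
  assumes "i < d" shows "integrable P (\<lambda>\<omega>. defect i \<omega> (residual x \<omega>) * kern x \<omega>)"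
proof -
  have "(\<lambda>\<omega>. defect i \<omega> (residual x \<omega>) * kern x \<omega>)
    = (\<lambda>\<omega>. (\<Sum>j<d. T i j \<omega> * (residual x \<omega> j * kern x \<omega>)) - residual x \<omega> i * kern x \<omega>)"
    by (simp only: defect_def left_diff_distrib sum_distrib_right mult.assoc)
  moreover have "integrable P (\<lambda>\<omega>. (\<Sum>j<d. T i j \<omega> * (residual x \<omega> j * kern x \<omega>)) - residual x \<omega> i * kern x \<omega>)"
    using assms by (intro Bochner_Integration.integrable_diff Bochner_Integration.integrable_sum
        integrable_T_residual_kern integrable_residual_kern) auto
  ultimately show ?thesis by simp
qed

lemma integrable_rotated_kern:
  assumes "i < d" shows "integrable P (\<lambda>\<omega>. rotated i \<omega> (residual x \<omega>) * kern x \<omega>)"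
proof -
  have "(\<lambda>\<omega>. rotated i \<omega> (residual x \<omega>) * kern x \<omega>)
    = (\<lambda>\<omega>. c * (residual x \<omega> i * kern x \<omega>) - s * (S i \<omega> * kern x \<omega>))"
    by (simp add: rotated_def algebra_simps)
  then show ?thesis using assms
    by (simp add: integrable_S_kern integrable_residual_kern)
qed

text \<open>Stein's identity, tested against the Gaussian kernel, turns the conditional velocity of the
  rotation into an average of \<open>(T - I) z\<close>.\<close>

lemma rotated_kern_eq:
  assumes i: "i < d"
  shows "expectation (\<lambda>\<omega>. rotated i \<omega> (residual x \<omega>) * kern x \<omega>)
    = - c * expectation (\<lambda>\<omega>. defect i \<omega> (residual x \<omega>) * kern x \<omega>)"
proof -
  define A where "A = expectation (\<lambda>\<omega>. S i \<omega> * kern x \<omega>)"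
  define R where "R = expectation (\<lambda>\<omega>. residual x \<omega> i * kern x \<omega>)"
  define B where "B = expectation (\<lambda>\<omega>. (\<Sum>j<d. T i j \<omega> * residual x \<omega> j) * kern x \<omega>)"
  have "(\<lambda>\<omega>. (\<Sum>j<d. T i j \<omega> * (x j - c * S j \<omega>)) * kern x \<omega>)
      = (\<lambda>\<omega>. s * ((\<Sum>j<d. T i j \<omega> * residual x \<omega> j) * kern x \<omega>))"
    using s_pos by (simp add: residual_def sum_divide_distrib[symmetric])
  then have "s\<^sup>2 * A = c * (s * B)"
    using stein[OF i, of x] unfolding A_def B_def by simp
  \<comment> \<open>Stein's identity trades the average of S_i for that of T z. The velocity c z - s
    S then averages to c R - c B, which is - c times the average of (T - I) z.\<close>
  then have st: "s * A = c * B" using s_pos by (simp add: power2_eq_square)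
  have l: "expectation (\<lambda>\<omega>. rotated i \<omega> (residual x \<omega>) * kern x \<omega>) = c * R - s * A"
  proof -
    have "(\<lambda>\<omega>. rotated i \<omega> (residual x \<omega>) * kern x \<omega>)
      = (\<lambda>\<omega>. c * (residual x \<omega> i * kern x \<omega>) - s * (S i \<omega> * kern x \<omega>))"
      by (simp add: rotated_def algebra_simps)
    then show ?thesis using integrable_S_kern[OF i] integrable_residual_kern[OF i] by (simp add: A_def R_def)
  qed
  have r: "expectation (\<lambda>\<omega>. defect i \<omega> (residual x \<omega>) * kern x \<omega>) = B - R"
  proof -
    have "(\<lambda>\<omega>. defect i \<omega> (residual x \<omega>) * kern x \<omega>)
      = (\<lambda>\<omega>. (\<Sum>j<d. T i j \<omega> * residual x \<omega> j) * kern x \<omega> - residual x \<omega> i * kern x \<omega>)"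
      by (simp add: defect_def algebra_simps)
    moreover have "integrable P (\<lambda>\<omega>. (\<Sum>j<d. T i j \<omega> * residual x \<omega> j) * kern x \<omega>)"
    proof -
      have "integrable P (\<lambda>\<omega>. (\<Sum>j<d. T i j \<omega> * (residual x \<omega> j * kern x \<omega>)))"
        using i by (intro Bochner_Integration.integrable_sum integrable_T_residual_kern) auto
      then show ?thesis by (simp add: sum_distrib_right mult.assoc)
    qed
    ultimately show ?thesis using integrable_residual_kern[OF i] by (simp add: B_def R_def)
  qed
  show ?thesis unfolding l r st by (simp add: algebra_simps)
qed

lemma drift_eq_rotated:
  assumes i: "i < d"
  shows "drift i x = (\<integral>\<omega>. posterior x \<omega> * rotated i \<omega> (residual x \<omega>) \<partial>P)"
proof -
  have "drift i x = (\<integral>\<omega>. (- c / mix_density x) * (defect i \<omega> (residual x \<omega>) * kern x \<omega>) \<partial>P)"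
    unfolding drift_def posterior_def by (intro Bochner_Integration.integral_cong) (auto simp: field_simps)
  also have "\<dots> = (1 / mix_density x) * (- c * expectation (\<lambda>\<omega>. defect i \<omega> (residual x \<omega>) * kern x \<omega>))"
    by simp
  also have "\<dots> = (\<integral>\<omega>. (1 / mix_density x) * (rotated i \<omega> (residual x \<omega>) * kern x \<omega>) \<partial>P)"
    unfolding rotated_kern_eq[OF i, symmetric] by simp
  also have "\<dots> = (\<integral>\<omega>. posterior x \<omega> * rotated i \<omega> (residual x \<omega>) \<partial>P)"
    unfolding posterior_def by (intro Bochner_Integration.integral_cong) (auto simp: field_simps)
  finally show ?thesis .
qed

lemma integrable_posterior_rotated:
  assumes "i < d" shows "integrable P (\<lambda>\<omega>. posterior x \<omega> * rotated i \<omega> (residual x \<omega>))"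
proof -
  have "(\<lambda>\<omega>. posterior x \<omega> * rotated i \<omega> (residual x \<omega>)) = (\<lambda>\<omega>. (1 / mix_density x) * (rotated i \<omega> (residual x \<omega>) * kern x \<omega>))"
    by (auto simp: posterior_def field_simps)
  then show ?thesis using integrable_rotated_kern[OF assms, of x] by simp
qed

lemma integrable_posterior_defect:
  assumes "i < d" shows "integrable P (\<lambda>\<omega>. posterior x \<omega> * (- c * defect i \<omega> (residual x \<omega>)))"
proof -
  have "(\<lambda>\<omega>. posterior x \<omega> * (- c * defect i \<omega> (residual x \<omega>))) = (\<lambda>\<omega>. (- c / mix_density x) * (defect i \<omega> (residual x \<omega>) * kern x \<omega>))"
    by (auto simp: posterior_def field_simps)
  then show ?thesis using integrable_defect_kern[OF assms, of x] by simp
qed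

lemma residual_mix_point: "j < d \<Longrightarrow> residual (mix_point y) (fst y) j = snd y j"
  using s_pos by (simp add: residual_def gauss_comb_def case_prod_beta)

lemma defect_mix_point: "i < d \<Longrightarrow> defect i (fst y) (residual (mix_point y) (fst y)) = defect i (fst y) (snd y)"
  by (simp add: defect_def residual_mix_point)

lemma rotated_mix_point: "i < d \<Longrightarrow> rotated i (fst y) (residual (mix_point y) (fst y)) = rotated i (fst y) (snd y)"
  by (simp add: rotated_def residual_mix_point)

lemma in_Lp_Z: "i < d \<Longrightarrow> in_Lp p (std_gaussian d) (\<lambda>z. z i)"
  by (rule in_Lp_std_gaussian) (use p_pos in auto)

lemma in_Lp_defect:
  assumes "i < d" shows "in_Lp p (P \<Otimes>\<^sub>M std_gaussian d) (\<lambda>y. defect i (fst y) (snd y))"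
  unfolding defect_def using assms p_pos
  by (intro in_Lp_diff in_Lp_sum PG.in_Lp_pair_mult T_Lp in_Lp_Z PG.in_Lp_snd[of p "\<lambda>z. z i"]) auto

lemma
  assumes i: "i < d"
  shows in_Lp_rotated: "in_Lp p (P \<Otimes>\<^sub>M std_gaussian d) (\<lambda>y. rotated i (fst y) (snd y))"
    and Lp_norm_rotated: "Lp_norm p (P \<Otimes>\<^sub>M std_gaussian d) (\<lambda>y. rotated i (fst y) (snd y)) \<le> radius i"
proof -
  have eq: "rotated i (fst y) (snd y) = (- s) * S i (fst y) + c * snd y i" for y
    by (simp add: rotated_def)
  show "in_Lp p (P \<Otimes>\<^sub>M std_gaussian d) (\<lambda>y. rotated i (fst y) (snd y))"
    unfolding eq by (rule in_Lp_gauss_combination[OF S_Lp[OF i] i p_pos(2)])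
  have "Lp_norm p (P \<Otimes>\<^sub>M std_gaussian d) (\<lambda>y. rotated i (fst y) (snd y)) \<le> \<bar>- s\<bar> * Lp_norm p P (S i) + \<bar>c\<bar> * normal_norm p"
    unfolding eq by (rule Lp_norm_gauss_combination[OF S_Lp[OF i] i p_pos(2)])
  also have "\<dots> \<le> 1 * Lp_norm p P (S i) + 1 * normal_norm p"
    using abs_c_le s_le s_pos by (intro add_mono mult_right_mono) (auto simp: normal_norm_def)
  finally show "Lp_norm p (P \<Otimes>\<^sub>M std_gaussian d) (\<lambda>y. rotated i (fst y) (snd y)) \<le> radius i" by simp
qed

lemma
  assumes i: "i < d"
  shows in_Lp_mix_law: "in_Lp p mix_law (\<lambda>x. x i)"
    and Lp_norm_mix_law: "Lp_norm p mix_law (\<lambda>x. x i) \<le> radius i"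
proof -
  have eq: "mix_point y i = c * S i (fst y) + s * snd y i" for y
    using i by (simp add: gauss_comb_def case_prod_beta)
  note d = in_Lp_distr[OF mix_point_measurable borel_RR_component[OF i], folded gauss_comb_law_def]
  show "in_Lp p mix_law (\<lambda>x. x i)"
    unfolding d eq by (rule in_Lp_gauss_combination[OF S_Lp[OF i] i p_pos(2)])
  have "Lp_norm p mix_law (\<lambda>x. x i) \<le> \<bar>c\<bar> * Lp_norm p P (S i) + \<bar>s\<bar> * normal_norm p"
    unfolding d eq by (rule Lp_norm_gauss_combination[OF S_Lp[OF i] i p_pos(2)])
  also have "\<dots> \<le> 1 * Lp_norm p P (S i) + 1 * normal_norm p"
    using abs_c_le s_le s_pos by (intro add_mono mult_right_mono) (auto simp: normal_norm_def)
  finally show "Lp_norm p mix_law (\<lambda>x. x i) \<le> radius i" by simp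
qed

text \<open>Conditional expectation does not increase the p-norm: Jensen under the posterior, then
  disintegration returns the integral to the independent pair (\<omega>, z), where the residual is z
  itself. The factor |c| <= 1 is dropped.\<close>

lemma
  assumes i: "i < d"
  shows in_Lp_drift: "in_Lp p mix_law (drift i)"
    and Lp_norm_drift: "Lp_norm p mix_law (drift i) \<le> defect_norm i"
proof -
  have [measurable]: "drift i \<in> borel_measurable (borel_RR d)" by (rule drift_measurable[OF i])
  have dm: "(\<lambda>v. defect i (snd v) (residual (fst v) (snd v))) \<in> borel_measurable (borel_RR d \<Otimes>\<^sub>M P)"
    by (rule defect_measurable[OF i])
  have "(\<integral>\<^sup>+x. ennreal (\<bar>drift i x\<bar> powr p) \<partial>mix_law)
      \<le> (\<integral>\<^sup>+x. \<integral>\<^sup>+\<omega>. ennreal (posterior x \<omega>) * ennreal (\<bar>- c * defect i \<omega> (residual x \<omega>)\<bar> powr p) \<partial>P \<partial>mix_law)"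
    unfolding drift_def using posterior_nonneg nn_integral_posterior defect_measurable'[OF i] integrable_posterior_defect[OF i]
    by (intro nn_integral_mono abs_integral_powr_le[OF p_pos(2)]) auto
  also have "\<dots> = (\<integral>\<^sup>+y. ennreal (\<bar>- c * defect i (fst y) (residual (mix_point y) (fst y))\<bar> powr p) \<partial>(P \<Otimes>\<^sub>M std_gaussian d))"
    using nn_integral_mix_disintegration[of "\<lambda>v. ennreal (\<bar>- c * defect i (snd v) (residual (fst v) (snd v))\<bar> powr p)"] dm
    by simp
  also have "\<dots> \<le> (\<integral>\<^sup>+y. ennreal (\<bar>defect i (fst y) (snd y)\<bar> powr p) \<partial>(P \<Otimes>\<^sub>M std_gaussian d))"
    unfolding defect_mix_point[OF i] abs_mult abs_minus_cancel using abs_c_le p_pos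
    by (intro nn_integral_mono ennreal_leI powr_mono2) (auto intro: mult_left_le_one_le)
  finally have le: "(\<integral>\<^sup>+x. ennreal (\<bar>drift i x\<bar> powr p) \<partial>mix_law)
      \<le> (\<integral>\<^sup>+y. ennreal (\<bar>defect i (fst y) (snd y)\<bar> powr p) \<partial>(P \<Otimes>\<^sub>M std_gaussian d))" .
  have dl: "drift i \<in> borel_measurable mix_law"
    by (subst measurable_cong_sets[OF sets_gauss_comb_law refl]) measurable
  show "in_Lp p mix_law (drift i)" "Lp_norm p mix_law (drift i) \<le> defect_norm i"
    using Lp_norm_le_nn_integral[OF p_pos(1) dl in_Lp_defect[OF i] le] by auto
qed

end

subsection \<open>One step of the coupling chain\<close>

context stein_mixture
begin

text \<open>\<open>a\<close> and \<open>b\<close> will be the cosine and sine of the angle step. The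
  first marginal stays fixed along the chain; only the second one moves with the rotation.\<close>

context
  fixes \<nu> :: "rvec measure" and \<pi> :: "(rvec \<times> rvec) measure" and a b :: real
  assumes \<pi>: "\<pi> \<in> couplings d \<nu> mix_law"
    and \<pi>_Lp: "\<And>i. i < d \<Longrightarrow> in_Lp p \<pi> (\<lambda>u. fst u i - snd u i)"
begin

lemma sets_pi: "sets \<pi> = sets (borel_RR d \<Otimes>\<^sub>M borel_RR d)"
  using \<pi> by (simp add: couplings_def)

lemma pi_snd: "distr \<pi> (borel_RR d) snd = mix_law"
  using \<pi> by (simp add: couplings_def)

lemma measurable_pi: "f \<in> borel_RR d \<Otimes>\<^sub>M borel_RR d \<rightarrow>\<^sub>M N \<Longrightarrow> f \<in> \<pi> \<rightarrow>\<^sub>M N"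
  by (simp add: measurable_cong_sets[OF sets_pi refl])

lemma prob_space_pi: "prob_space \<pi>"
proof (rule prob_space_distrD)
  show "snd \<in> \<pi> \<rightarrow>\<^sub>M borel_RR d" by (rule measurable_pi) measurable
  show "prob_space (distr \<pi> (borel_RR d) snd)" unfolding pi_snd by (rule prob_space_mix_law)
qed

interpretation pi: prob_space \<pi> by (rule prob_space_pi)
interpretation PP: pair_prob_space \<pi> P ..

definition step_weight :: "(rvec \<times> rvec) \<times> 'w \<Rightarrow> real" where
  "step_weight v = posterior (snd (fst v)) (snd v)"

text \<open>Gluing: the pair comes from \<open>\<pi>\<close>, then \<omega> is drawn from the
  posterior of the second entry alone, which is the Markov property of the chain. As a density
  against a product measure this involves no abstract regular conditional laws.\<close>

definition step_space :: "((rvec \<times> rvec) \<times> 'w) measure" where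
  "step_space = density (\<pi> \<Otimes>\<^sub>M P) (\<lambda>v. ennreal (step_weight v))"

lemma joint_measurable: "(\<lambda>v. (snd (fst v), snd v)) \<in> \<pi> \<Otimes>\<^sub>M P \<rightarrow>\<^sub>M borel_RR d \<Otimes>\<^sub>M P"
  by (intro measurable_Pair measurable_compose[OF measurable_fst] measurable_snd measurable_pi)

lemma step_weight_measurable: "step_weight \<in> borel_measurable (\<pi> \<Otimes>\<^sub>M P)"
  using measurable_compose[OF joint_measurable posterior_measurable_pair] by (simp add: step_weight_def[abs_def])

lemma step_weight_nonneg: "0 \<le> step_weight v"
  by (simp add: step_weight_def posterior_nonneg)

lemma nn_integral_step:
  assumes F: "F \<in> borel_measurable (\<pi> \<Otimes>\<^sub>M P)"
  shows "(\<integral>\<^sup>+v. F v \<partial>step_space) = (\<integral>\<^sup>+u. \<integral>\<^sup>+\<omega>. ennreal (posterior (snd u) \<omega>) * F (u, \<omega>) \<partial>P \<partial>\<pi>)"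
proof -
  note [measurable] = F step_weight_measurable
  have "(\<integral>\<^sup>+v. F v \<partial>step_space) = (\<integral>\<^sup>+v. ennreal (step_weight v) * F v \<partial>(\<pi> \<Otimes>\<^sub>M P))"
    unfolding step_space_def by (rule nn_integral_density) measurable
  also have "\<dots> = (\<integral>\<^sup>+u. \<integral>\<^sup>+\<omega>. ennreal (step_weight (u, \<omega>)) * F (u, \<omega>) \<partial>P \<partial>\<pi>)"
    by (rule nn_integral_fst[symmetric]) measurable
  finally show ?thesis by (simp add: step_weight_def)
qed

lemma nn_integral_step_fst:
  assumes F: "F \<in> borel_measurable \<pi>"
  shows "(\<integral>\<^sup>+v. F (fst v) \<partial>step_space) = (\<integral>\<^sup>+u. F u \<partial>\<pi>)"
  using F by (subst nn_integral_step) (auto simp: nn_integral_multc nn_integral_posterior)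

lemma nn_integral_step_mix:
  assumes F: "F \<in> borel_measurable (borel_RR d)"
  shows "(\<integral>\<^sup>+v. F (snd (fst v)) \<partial>step_space) = (\<integral>\<^sup>+x. F x \<partial>mix_law)"
proof -
  have m: "snd \<in> \<pi> \<rightarrow>\<^sub>M borel_RR d" by (rule measurable_pi) measurable
  have "(\<integral>\<^sup>+v. F (snd (fst v)) \<partial>step_space) = (\<integral>\<^sup>+u. F (snd u) \<partial>\<pi>)"
    by (rule nn_integral_step_fst[OF measurable_compose[OF m F]])
  also have "\<dots> = (\<integral>\<^sup>+x. F x \<partial>distr \<pi> (borel_RR d) snd)"
    by (rule nn_integral_distr[symmetric, OF m]) (use F in simp)
  finally show ?thesis by (simp add: pi_snd)
qed

text \<open>The second entry has law \<open>mix_law\<close> and \<omega> its posterior, so by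
  disintegration they are jointly distributed as the point and the sample of an independent pair.
  Statements about \<omega> can thus be computed with z in place of the residual.\<close>

lemma nn_integral_step_joint:
  assumes F: "F \<in> borel_measurable (borel_RR d \<Otimes>\<^sub>M P)"
  shows "(\<integral>\<^sup>+v. F (snd (fst v), snd v) \<partial>step_space) = (\<integral>\<^sup>+y. F (mix_point y, fst y) \<partial>(P \<Otimes>\<^sub>M std_gaussian d))"
proof -
  note [measurable] = F
  have m: "snd \<in> \<pi> \<rightarrow>\<^sub>M borel_RR d" by (rule measurable_pi) measurable
  let ?H = "\<lambda>x. \<integral>\<^sup>+\<omega>. ennreal (posterior x \<omega>) * F (x, \<omega>) \<partial>P"
  have H: "?H \<in> borel_measurable (borel_RR d)" by measurable
  have "(\<integral>\<^sup>+v. F (snd (fst v), snd v) \<partial>step_space) = (\<integral>\<^sup>+u. ?H (snd u) \<partial>\<pi>)"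
    using nn_integral_step[OF measurable_compose[OF joint_measurable F]] by simp
  also have "\<dots> = (\<integral>\<^sup>+x. ?H x \<partial>distr \<pi> (borel_RR d) snd)"
    by (rule nn_integral_distr[symmetric, OF m]) (use H in simp)
  also have "\<dots> = (\<integral>\<^sup>+y. F (mix_point y, fst y) \<partial>(P \<Otimes>\<^sub>M std_gaussian d))"
    unfolding pi_snd by (rule nn_integral_mix_disintegration[symmetric, OF F])
  finally show ?thesis .
qed

lemma sets_step: "sets step_space = sets (\<pi> \<Otimes>\<^sub>M P)"
  by (simp add: step_space_def)

lemma measurable_step: "f \<in> \<pi> \<Otimes>\<^sub>M P \<rightarrow>\<^sub>M N \<Longrightarrow> f \<in> step_space \<rightarrow>\<^sub>M N"
  by (simp add: measurable_cong_sets[OF sets_step refl])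

lemma
  assumes f: "in_Lp p \<pi> f"
  shows in_Lp_step_fst: "in_Lp p step_space (\<lambda>v. f (fst v))"
    and Lp_norm_step_fst: "Lp_norm p step_space (\<lambda>v. f (fst v)) \<le> Lp_norm p \<pi> f"
proof -
  have [measurable]: "f \<in> borel_measurable \<pi>" using f by (simp add: in_Lp_def)
  have m: "(\<lambda>v. f (fst v)) \<in> borel_measurable step_space"
    by (rule measurable_step) measurable
  have "(\<integral>\<^sup>+v. ennreal (\<bar>f (fst v)\<bar> powr p) \<partial>step_space) \<le> (\<integral>\<^sup>+u. ennreal (\<bar>f u\<bar> powr p) \<partial>\<pi>)"
    by (subst nn_integral_step_fst[of "\<lambda>u. ennreal (\<bar>f u\<bar> powr p)"]) auto
  from Lp_norm_le_nn_integral[OF p_pos(1) m f this]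
  show "in_Lp p step_space (\<lambda>v. f (fst v))" "Lp_norm p step_space (\<lambda>v. f (fst v)) \<le> Lp_norm p \<pi> f" by auto
qed

lemma
  assumes f: "in_Lp p mix_law f"
  shows in_Lp_step_mix: "in_Lp p step_space (\<lambda>v. f (snd (fst v)))"
    and Lp_norm_step_mix: "Lp_norm p step_space (\<lambda>v. f (snd (fst v))) \<le> Lp_norm p mix_law f"
proof -
  have fm[measurable]: "f \<in> borel_measurable (borel_RR d)"
    using f by (simp add: in_Lp_def measurable_cong_sets[OF sets_gauss_comb_law refl])
  have s: "snd \<in> \<pi> \<rightarrow>\<^sub>M borel_RR d" by (rule measurable_pi) measurable
  have m: "(\<lambda>v. f (snd (fst v))) \<in> borel_measurable step_space"
    by (rule measurable_step) (rule measurable_compose[OF measurable_fst measurable_compose[OF s fm]])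
  have "(\<integral>\<^sup>+v. ennreal (\<bar>f (snd (fst v))\<bar> powr p) \<partial>step_space) \<le> (\<integral>\<^sup>+x. ennreal (\<bar>f x\<bar> powr p) \<partial>mix_law)"
    by (subst nn_integral_step_mix[of "\<lambda>x. ennreal (\<bar>f x\<bar> powr p)"]) auto
  from Lp_norm_le_nn_integral[OF p_pos(1) m f this]
  show "in_Lp p step_space (\<lambda>v. f (snd (fst v)))" "Lp_norm p step_space (\<lambda>v. f (snd (fst v))) \<le> Lp_norm p mix_law f" by auto
qed

lemma
  assumes i: "i < d"
  shows in_Lp_step_rotated: "in_Lp p step_space (\<lambda>v. rotated i (snd v) (residual (snd (fst v)) (snd v)))"
    and Lp_norm_step_rotated: "Lp_norm p step_space (\<lambda>v. rotated i (snd v) (residual (snd (fst v)) (snd v))) \<le> radius i"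
proof -
  let ?r = "\<lambda>v. rotated i (snd v) (residual (fst v) (snd v))"
  note r[measurable] = rotated_measurable[OF i]
  have m: "(\<lambda>v. rotated i (snd v) (residual (snd (fst v)) (snd v))) \<in> borel_measurable step_space"
    using measurable_compose[OF joint_measurable r] by (intro measurable_step) simp
  have "(\<integral>\<^sup>+v. ennreal (\<bar>rotated i (snd v) (residual (snd (fst v)) (snd v))\<bar> powr p) \<partial>step_space)
      = (\<integral>\<^sup>+y. ennreal (\<bar>rotated i (fst y) (residual (mix_point y) (fst y))\<bar> powr p) \<partial>(P \<Otimes>\<^sub>M std_gaussian d))"
    using nn_integral_step_joint[of "\<lambda>v. ennreal (\<bar>?r v\<bar> powr p)"] by simp
  then have "(\<integral>\<^sup>+v. ennreal (\<bar>rotated i (snd v) (residual (snd (fst v)) (snd v))\<bar> powr p) \<partial>step_space)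
      \<le> (\<integral>\<^sup>+y. ennreal (\<bar>rotated i (fst y) (snd y)\<bar> powr p) \<partial>(P \<Otimes>\<^sub>M std_gaussian d))"
    by (simp add: rotated_mix_point[OF i])
  from Lp_norm_le_nn_integral[OF p_pos(1) m in_Lp_rotated[OF i] this] Lp_norm_rotated[OF i]
  show "in_Lp p step_space (\<lambda>v. rotated i (snd v) (residual (snd (fst v)) (snd v)))"
    "Lp_norm p step_space (\<lambda>v. rotated i (snd v) (residual (snd (fst v)) (snd v))) \<le> radius i" by auto
qed

lemma posterior_integrable: "integrable P (posterior x)"
  by (rule integrableI_nonneg) (auto simp: posterior_nonneg nn_integral_posterior)

lemma integral_posterior: "(\<integral>\<omega>. posterior x \<omega> \<partial>P) = 1"
  using nn_integral_eq_integral[OF posterior_integrable[of x]] posterior_nonneg nn_integral_posterior[of x]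
  by simp

text \<open>Given the old pair, \<omega> has the posterior law, under which the velocity has mean
  \<open>drift\<close>. Integrating over \<omega> first, with the function of the old pair held
  fixed, makes the centred velocity vanish.\<close>

lemma step_orthogonal:
  assumes i: "i < d" and f: "in_Lp p step_space (\<lambda>v. f (fst v))"
    and g: "in_Lp p step_space (\<lambda>v. k * (rotated i (snd v) (residual (snd (fst v)) (snd v)) - drift i (snd (fst v))))"
  shows "(\<integral>v. sgn (f (fst v)) * \<bar>f (fst v)\<bar> powr (p - 1)
      * (k * (rotated i (snd v) (residual (snd (fst v)) (snd v)) - drift i (snd (fst v)))) \<partial>step_space) = 0"
    (is "(\<integral>v. ?h v \<partial>step_space) = 0")
proof -
  have hi: "integrable step_space ?h"
    by (rule integrable_sgn_powr_mult[OF f g p_pos(2)])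
  then have hm: "?h \<in> borel_measurable (\<pi> \<Otimes>\<^sub>M P)"
    using measurable_cong_sets[OF sets_step refl] by blast
  have wi: "integrable (\<pi> \<Otimes>\<^sub>M P) (\<lambda>v. step_weight v * ?h v)"
    using hi integrable_density[OF hm step_weight_measurable] step_weight_nonneg by (simp add: step_space_def)
  have "(\<integral>v. ?h v \<partial>step_space) = (\<integral>v. step_weight v * ?h v \<partial>(\<pi> \<Otimes>\<^sub>M P))"
    unfolding step_space_def using integral_density[OF hm step_weight_measurable] step_weight_nonneg by simp
  also have "\<dots> = (\<integral>u. (\<integral>\<omega>. step_weight (u, \<omega>) * ?h (u, \<omega>) \<partial>P) \<partial>\<pi>)"
    by (rule PP.integral_fst'[symmetric, OF wi])
  also have "\<dots> = (\<integral>u. 0 \<partial>\<pi>)"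
  proof (rule Bochner_Integration.integral_cong[OF refl])
    fix u
    let ?K = "sgn (f u) * \<bar>f u\<bar> powr (p - 1) * k"
    have "(\<integral>\<omega>. step_weight (u, \<omega>) * ?h (u, \<omega>) \<partial>P)
        = (\<integral>\<omega>. ?K * (posterior (snd u) \<omega> * rotated i \<omega> (residual (snd u) \<omega>) - drift i (snd u) * posterior (snd u) \<omega>) \<partial>P)"
      by (intro Bochner_Integration.integral_cong) (auto simp: step_weight_def algebra_simps)
    also have "\<dots> = ?K * (drift i (snd u) - drift i (snd u) * 1)"
      using integrable_posterior_rotated[OF i, of "snd u"] posterior_integrable[of "snd u"]
      by (simp add: integral_posterior flip: drift_eq_rotated[OF i])
    finally show "(\<integral>\<omega>. step_weight (u, \<omega>) * ?h (u, \<omega>) \<partial>P) = 0" by simp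
  qed
  finally show ?thesis by simp
qed

text \<open>By the addition formulas this is the point of the rotation at the advanced angle, formed
  from the resampled \<omega> and the Gaussian vector that \<omega> and the current point
  determine.\<close>

definition next_point :: "(rvec \<times> rvec) \<times> 'w \<Rightarrow> rvec" where
  "next_point v = (\<lambda>j\<in>{..<d}. (c * a - s * b) * S j (snd v) + (s * a + c * b) * residual (snd (fst v)) (snd v) j)"

definition next_coupling :: "(rvec \<times> rvec) measure" where
  "next_coupling = distr step_space (borel_RR d \<Otimes>\<^sub>M borel_RR d) (\<lambda>v. (fst (fst v), next_point v))"

lemma next_point_measurable': "(\<lambda>y. \<lambda>j\<in>{..<d}. (c * a - s * b) * S j (snd y) + (s * a + c * b) * residual (fst y) (snd y) j)
    \<in> borel_RR d \<Otimes>\<^sub>M P \<rightarrow>\<^sub>M borel_RR d"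
proof -
  have "(\<lambda>y. (c * a - s * b) * S j (snd y) + (s * a + c * b) * residual (fst y) (snd y) j) \<in> borel_measurable (borel_RR d \<Otimes>\<^sub>M P)"
    if "j < d" for j using that
    by (intro borel_measurable_add borel_measurable_times borel_measurable_const
      residual_measurable measurable_compose[OF measurable_snd S_measurable])
  then show ?thesis unfolding borel_RR_def by (intro measurable_restrict) auto
qed

lemma next_pair_measurable: "(\<lambda>v. (fst (fst v), next_point v)) \<in> step_space \<rightarrow>\<^sub>M borel_RR d \<Otimes>\<^sub>M borel_RR d"
proof (rule measurable_step, rule measurable_Pair)
  show "(\<lambda>v. fst (fst v)) \<in> \<pi> \<Otimes>\<^sub>M P \<rightarrow>\<^sub>M borel_RR d"
    by (rule measurable_compose[OF measurable_fst measurable_pi[OF measurable_fst]])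
  show "next_point \<in> \<pi> \<Otimes>\<^sub>M P \<rightarrow>\<^sub>M borel_RR d"
    using measurable_compose[OF joint_measurable next_point_measurable'] by (simp add: next_point_def[abs_def])
qed

text \<open>The first marginal survives because the posterior has mass 1. For the second, the
  current point and \<omega> are jointly distributed as for the independent pair, on which the
  residual equals z.\<close>

lemma next_coupling_in: "next_coupling \<in> couplings d \<nu> (gauss_comb_law P d S (c * a - s * b) (s * a + c * b))"
proof -
  have f: "distr next_coupling (borel_RR d) fst = \<nu>"
  proof -
    have fm: "fst \<in> \<pi> \<rightarrow>\<^sub>M borel_RR d" by (rule measurable_pi) measurable
    have "distr next_coupling (borel_RR d) fst = distr step_space (borel_RR d) (\<lambda>v. fst (fst v))"
      unfolding next_coupling_def by (subst distr_distr[OF _ next_pair_measurable]) (auto simp: comp_def)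
    also have "\<dots> = distr \<pi> (borel_RR d) fst"
    proof (rule measure_eqI)
      fix A assume "A \<in> sets (distr step_space (borel_RR d) (\<lambda>v. fst (fst v)))"
      then have A[measurable]: "A \<in> sets (borel_RR d)" by simp
      have m: "(\<lambda>v. fst (fst v)) \<in> step_space \<rightarrow>\<^sub>M borel_RR d"
        using measurable_compose[OF next_pair_measurable measurable_fst] by simp
      have "emeasure (distr step_space (borel_RR d) (\<lambda>v. fst (fst v))) A = (\<integral>\<^sup>+v. indicator A (fst (fst v)) \<partial>step_space)"
        by (subst nn_integral_distr[OF m, of "indicator A", symmetric]) auto
      also have "\<dots> = (\<integral>\<^sup>+u. indicator A (fst u) \<partial>\<pi>)"
        by (rule nn_integral_step_fst) (rule measurable_compose[OF fm], measurable)
      also have "\<dots> = emeasure (distr \<pi> (borel_RR d) fst) A"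
        by (subst nn_integral_distr[OF fm, of "indicator A", symmetric]) auto
      finally show "emeasure (distr step_space (borel_RR d) (\<lambda>v. fst (fst v))) A = emeasure (distr \<pi> (borel_RR d) fst) A" .
    qed simp
    also have "\<dots> = \<nu>" using \<pi> by (simp add: couplings_def)
    finally show ?thesis .
  qed
  have sn: "distr next_coupling (borel_RR d) snd = gauss_comb_law P d S (c * a - s * b) (s * a + c * b)"
  proof -
    have m: "next_point \<in> step_space \<rightarrow>\<^sub>M borel_RR d"
      using measurable_compose[OF next_pair_measurable measurable_snd] by simp
    have gm: "gauss_comb d S (c * a - s * b) (s * a + c * b) \<in> P \<Otimes>\<^sub>M std_gaussian d \<rightarrow>\<^sub>M borel_RR d"
      by (rule gauss_comb_measurable) measurable
    have "distr next_coupling (borel_RR d) snd = distr step_space (borel_RR d) next_point"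
      unfolding next_coupling_def by (subst distr_distr[OF _ next_pair_measurable]) (auto simp: comp_def)
    also have "\<dots> = gauss_comb_law P d S (c * a - s * b) (s * a + c * b)"
    proof (rule measure_eqI)
      fix A assume "A \<in> sets (distr step_space (borel_RR d) next_point)"
      then have A[measurable]: "A \<in> sets (borel_RR d)" by simp
      have "emeasure (distr step_space (borel_RR d) next_point) A = (\<integral>\<^sup>+v. indicator A (next_point v) \<partial>step_space)"
        by (subst nn_integral_distr[OF m, of "indicator A", symmetric]) auto
      also have "\<dots> = (\<integral>\<^sup>+y. indicator A (\<lambda>j\<in>{..<d}. (c * a - s * b) * S j (fst y)
          + (s * a + c * b) * residual (mix_point y) (fst y) j) \<partial>(P \<Otimes>\<^sub>M std_gaussian d))"
        using nn_integral_step_joint[OF measurable_compose[OF next_point_measurable' borel_measurable_indicator[OF A]]]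
        by (simp add: next_point_def)
      also have "\<dots> = (\<integral>\<^sup>+y. indicator A (gauss_comb d S (c * a - s * b) (s * a + c * b) y) \<partial>(P \<Otimes>\<^sub>M std_gaussian d))"
      proof (intro nn_integral_cong arg_cong[where f = "indicator A"])
        fix y
        show "(\<lambda>j\<in>{..<d}. (c * a - s * b) * S j (fst y) + (s * a + c * b) * residual (mix_point y) (fst y) j)
            = gauss_comb d S (c * a - s * b) (s * a + c * b) y"
          unfolding gauss_comb_def[of d S "c * a - s * b"] case_prod_beta
          by (intro restrict_ext) (simp add: residual_mix_point)
      qed
      also have "\<dots> = emeasure (gauss_comb_law P d S (c * a - s * b) (s * a + c * b)) A"
        unfolding gauss_comb_law_def by (subst nn_integral_distr[OF gm, of "indicator A", symmetric]) auto
      finally show "emeasure (distr step_space (borel_RR d) next_point) A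
          = emeasure (gauss_comb_law P d S (c * a - s * b) (s * a + c * b)) A" .
    qed (simp add: gauss_comb_law_def)
    finally show ?thesis .
  qed
  show ?thesis unfolding couplings_def using f sn by (simp add: next_coupling_def)
qed

text \<open>The new point is a x + b times the velocity. Up to signs, the new difference is the old
  one, plus 1 - a times x, plus the conditional mean of the displacement, all functions of the old
  pair (\<open>f\<close>), plus a conditionally centred rest (\<open>g\<close>). The parts of
  \<open>f\<close> add by the triangle inequality; \<open>g\<close> enters only through its
  square.\<close>

lemma
  assumes i: "i < d"
  shows in_Lp_next: "in_Lp p next_coupling (\<lambda>u. fst u i - snd u i)"
    and Lp_norm_next: "(Lp_norm p next_coupling (\<lambda>u. fst u i - snd u i))\<^sup>2
      \<le> (Lp_norm p \<pi> (\<lambda>u. fst u i - snd u i) + \<bar>a - 1\<bar> * radius i + \<bar>b\<bar> * defect_norm i)\<^sup>2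
        + orth_const p * (\<bar>b\<bar> * (radius i + defect_norm i))\<^sup>2"
proof -
  let ?rot = "\<lambda>v. rotated i (snd v) (residual (snd (fst v)) (snd v))"
  define f where "f u = (fst u i - snd u i) + ((1 - a) * snd u i + (- b) * drift i (snd u))" for u :: "rvec \<times> rvec"
  define g where "g v = - b * (?rot v - drift i (snd (fst v)))" for v :: "(rvec \<times> rvec) \<times> 'w"
  have mc: "(\<lambda>u. fst u i - snd u i) \<in> borel_measurable (borel_RR d \<Otimes>\<^sub>M borel_RR d)"
    by (intro borel_measurable_diff measurable_compose[OF measurable_fst borel_RR_component[OF i]]
        measurable_compose[OF measurable_snd borel_RR_component[OF i]])
  note nx = in_Lp_distr[OF next_pair_measurable mc, folded next_coupling_def]
  have eq: "fst (fst v) i - next_point v i = f (fst v) + g v" for v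
  proof -
    have "snd (fst v) i = c * S i (snd v) + s * residual (snd (fst v)) (snd v) i"
      using s_pos by (simp add: residual_def)
    then show ?thesis using i
      by (simp add: f_def g_def next_point_def rotated_def algebra_simps)
  qed
  note D = in_Lp_step_fst[OF \<pi>_Lp[OF i]] Lp_norm_step_fst[OF \<pi>_Lp[OF i]]
  note X = in_Lp_step_mix[OF in_Lp_mix_law[OF i]] order_trans[OF Lp_norm_step_mix[OF in_Lp_mix_law[OF i]] Lp_norm_mix_law[OF i]]
  note E = in_Lp_step_mix[OF in_Lp_drift[OF i]] order_trans[OF Lp_norm_step_mix[OF in_Lp_drift[OF i]] Lp_norm_drift[OF i]]
  note R = in_Lp_step_rotated[OF i] Lp_norm_step_rotated[OF i]
  note Xc = in_Lp_cmult[OF X(1) p_pos(1), of "1 - a"]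
  note Ec = in_Lp_cmult[OF E(1) p_pos(1), of "- b"]
  note XE = in_Lp_add[OF Xc Ec p_pos(1)]
  have fL: "in_Lp p step_space (\<lambda>v. f (fst v))"
    unfolding f_def by (rule in_Lp_add[OF D(1) XE p_pos(1)])
  have RE: "in_Lp p step_space (\<lambda>v. ?rot v - drift i (snd (fst v)))"
    by (rule in_Lp_diff[OF R(1) E(1) p_pos(1)])
  have gL: "in_Lp p step_space g"
    unfolding g_def by (rule in_Lp_cmult[OF RE p_pos(1)])
  have fN: "Lp_norm p step_space (\<lambda>v. f (fst v))
      \<le> Lp_norm p \<pi> (\<lambda>u. fst u i - snd u i) + \<bar>a - 1\<bar> * radius i + \<bar>b\<bar> * defect_norm i"
  proof -
    have "Lp_norm p step_space (\<lambda>v. f (fst v)) \<le> Lp_norm p step_space (\<lambda>v. fst (fst v) i - snd (fst v) i)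
        + (Lp_norm p step_space (\<lambda>v. (1 - a) * snd (fst v) i) + Lp_norm p step_space (\<lambda>v. (- b) * drift i (snd (fst v))))"
      unfolding f_def
      by (intro order_trans[OF Lp_norm_add_le[OF D(1) XE p_pos(2)]] add_left_mono Lp_norm_add_le[OF Xc Ec p_pos(2)])
    also have "\<dots> \<le> Lp_norm p \<pi> (\<lambda>u. fst u i - snd u i) + (\<bar>a - 1\<bar> * radius i + \<bar>b\<bar> * defect_norm i)"
      unfolding Lp_norm_cmult[OF X(1) p_pos(1)] Lp_norm_cmult[OF E(1) p_pos(1)] abs_minus_cancel abs_minus_commute[of 1 a]
      by (intro add_mono mult_left_mono D X E) auto
    finally show ?thesis by simp
  qed
  have gN: "Lp_norm p step_space g \<le> \<bar>b\<bar> * (radius i + defect_norm i)"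
  proof -
    have "Lp_norm p step_space g = \<bar>b\<bar> * Lp_norm p step_space (\<lambda>v. ?rot v - drift i (snd (fst v)))"
      unfolding g_def by (subst Lp_norm_cmult[OF RE p_pos(1)]) simp
    also have "\<dots> \<le> \<bar>b\<bar> * (radius i + defect_norm i)"
      by (intro mult_left_mono order_trans[OF Lp_norm_diff_le[OF R(1) E(1) p_pos(2)]] add_mono R E) auto
    finally show ?thesis .
  qed
  have orth: "(\<integral>v. sgn (f (fst v)) * \<bar>f (fst v)\<bar> powr (p - 1) * g v \<partial>step_space) = 0"
    unfolding g_def by (rule step_orthogonal[OF i fL gL[unfolded g_def]])
  show "in_Lp p next_coupling (\<lambda>u. fst u i - snd u i)"
    unfolding nx fst_conv snd_conv eq by (rule in_Lp_add[OF fL gL p_pos(1)])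
  have "(Lp_norm p next_coupling (\<lambda>u. fst u i - snd u i))\<^sup>2
      \<le> (Lp_norm p step_space (\<lambda>v. f (fst v)))\<^sup>2 + orth_const p * (Lp_norm p step_space g)\<^sup>2"
    unfolding nx fst_conv snd_conv eq by (rule Lp_norm_orthogonal_add[OF p_ge fL gL orth])
  also have "\<dots> \<le> (Lp_norm p \<pi> (\<lambda>u. fst u i - snd u i) + \<bar>a - 1\<bar> * radius i + \<bar>b\<bar> * defect_norm i)\<^sup>2
        + orth_const p * (\<bar>b\<bar> * (radius i + defect_norm i))\<^sup>2"
    using orth_const_pos[OF p_ge] by (intro add_mono mult_left_mono power_mono fN gN) auto
  finally show "(Lp_norm p next_coupling (\<lambda>u. fst u i - snd u i))\<^sup>2
      \<le> (Lp_norm p \<pi> (\<lambda>u. fst u i - snd u i) + \<bar>a - 1\<bar> * radius i + \<bar>b\<bar> * defect_norm i)\<^sup>2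
        + orth_const p * (\<bar>b\<bar> * (radius i + defect_norm i))\<^sup>2" .
qed

end

lemma coupling_step:
  assumes "\<pi> \<in> couplings d \<nu> mix_law"
    and "\<And>i. i < d \<Longrightarrow> in_Lp p \<pi> (\<lambda>u. fst u i - snd u i)"
  shows "\<exists>\<pi>'\<in>couplings d \<nu> (gauss_comb_law P d S (c * a - s * b) (s * a + c * b)).
    \<forall>i<d. in_Lp p \<pi>' (\<lambda>u. fst u i - snd u i) \<and>
      (Lp_norm p \<pi>' (\<lambda>u. fst u i - snd u i))\<^sup>2
      \<le> (Lp_norm p \<pi> (\<lambda>u. fst u i - snd u i) + \<bar>a - 1\<bar> * radius i + \<bar>b\<bar> * defect_norm i)\<^sup>2
        + orth_const p * (\<bar>b\<bar> * (radius i + defect_norm i))\<^sup>2"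
  using next_coupling_in[OF assms, of a b] in_Lp_next[OF assms, of _ a b] Lp_norm_next[OF assms, of _ a b]
  by blast

end

subsection \<open>The coupling along the rotation\<close>

text \<open>The Stein identity is required for all \<open>c\<close> and all \<open>s > 0\<close> at
  once, so that every angle with positive sine gives an instance of \<open>stein_mixture\<close>
  over the same sample space.\<close>

locale stein_pair = prob_space P for P :: "'w measure" +
  fixes d :: nat and S :: "nat \<Rightarrow> 'w \<Rightarrow> real" and T :: "nat \<Rightarrow> nat \<Rightarrow> 'w \<Rightarrow> real" and p :: real
  assumes p_ge: "p \<ge> 2"
    and S_Lp: "\<And>i. i < d \<Longrightarrow> in_Lp p P (S i)"
    and T_Lp: "\<And>i j. i < d \<Longrightarrow> j < d \<Longrightarrow> in_Lp p P (T i j)"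
    and stein: "\<And>i x c s. i < d \<Longrightarrow> s > 0 \<Longrightarrow>
        s\<^sup>2 * expectation (\<lambda>\<omega>. S i \<omega> * gauss_density d s (\<lambda>j. c * S j \<omega>) x)
        = c * expectation (\<lambda>\<omega>. (\<Sum>j<d. T i j \<omega> * (x j - c * S j \<omega>)) * gauss_density d s (\<lambda>j. c * S j \<omega>) x)"
begin

lemma p_pos: "p > 0" "p \<ge> 1" using p_ge by auto

lemma S_measurable [measurable]: "i < d \<Longrightarrow> S i \<in> borel_measurable P"
  using S_Lp by (auto simp: in_Lp_def)

lemma stein_mixture:
  assumes "s > 0" "c\<^sup>2 + s\<^sup>2 = 1"
  shows "stein_mixture P d S c s T p"
proof -
  interpret gauss_mixture P d S c s
    by unfold_locales (use assms in auto)
  show ?thesis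
    by unfold_locales (use p_ge S_Lp T_Lp assms in \<open>auto simp: kern_def stein\<close>)
qed

sublocale Gm: prob_space "std_gaussian d"
  by (rule prob_space_std_gaussian)

sublocale PG: pair_prob_space P "std_gaussian d" ..

definition discrepancy :: "nat \<Rightarrow> real" where
  "discrepancy i = Lp_norm p (P \<Otimes>\<^sub>M std_gaussian d) (\<lambda>y. (\<Sum>j<d. T i j (fst y) * snd y j) - snd y i)"

definition size_bound :: "nat \<Rightarrow> real" where
  "size_bound i = Lp_norm p P (S i) + normal_norm p"

lemma normal_norm_nonneg: "0 \<le> normal_norm p"
  by (simp add: normal_norm_def)

lemma discrepancy_nonneg: "0 \<le> discrepancy i" and size_bound_nonneg: "0 \<le> size_bound i"
  using normal_norm_nonneg by (auto simp: discrepancy_def size_bound_def)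

lemma orth_const_ge_1: "1 \<le> orth_const p"
  using smooth_const_pos[OF p_ge] by (simp add: orth_const_def)

definition source_law :: "rvec measure" where
  "source_law = distr P (borel_RR d) (\<lambda>\<omega>. \<lambda>i\<in>{..<d}. S i \<omega>)"

lemma source_measurable: "(\<lambda>\<omega>. \<lambda>i\<in>{..<d}. S i \<omega>) \<in> P \<rightarrow>\<^sub>M borel_RR d"
  unfolding borel_RR_def by (intro measurable_restrict) auto

text \<open>At angle 0 there is no Gaussian part and hence no density to condition on. The chain
  therefore starts at the first positive angle, with S and c S + s Z coupled on their common space;
  the cost is of the order of one angle step.\<close>

lemma initial_coupling:
  fixes c s :: real
  defines "\<pi> \<equiv> distr (P \<Otimes>\<^sub>M std_gaussian d) (borel_RR d \<Otimes>\<^sub>M borel_RR d)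
      (\<lambda>y. (\<lambda>i\<in>{..<d}. S i (fst y), gauss_comb d S c s y))"
  shows "\<pi> \<in> couplings d source_law (gauss_comb_law P d S c s)"
    and "i < d \<Longrightarrow> in_Lp p \<pi> (\<lambda>u. fst u i - snd u i)"
    and "i < d \<Longrightarrow> Lp_norm p \<pi> (\<lambda>u. fst u i - snd u i) \<le> \<bar>c - 1\<bar> * size_bound i + \<bar>s\<bar> * size_bound i"
proof -
  have gm: "gauss_comb d S c s \<in> P \<Otimes>\<^sub>M std_gaussian d \<rightarrow>\<^sub>M borel_RR d"
    by (rule gauss_comb_measurable) measurable
  have sm: "(\<lambda>y. \<lambda>i\<in>{..<d}. S i (fst y)) \<in> P \<Otimes>\<^sub>M std_gaussian d \<rightarrow>\<^sub>M borel_RR d"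
    by (rule measurable_compose[OF measurable_fst source_measurable])
  have m: "(\<lambda>y. (\<lambda>i\<in>{..<d}. S i (fst y), gauss_comb d S c s y)) \<in> P \<Otimes>\<^sub>M std_gaussian d \<rightarrow>\<^sub>M borel_RR d \<Otimes>\<^sub>M borel_RR d"
    using sm gm by (intro measurable_Pair)
  have f: "distr \<pi> (borel_RR d) fst = source_law"
  proof -
    have "distr \<pi> (borel_RR d) fst = distr (P \<Otimes>\<^sub>M std_gaussian d) (borel_RR d) (\<lambda>y. \<lambda>i\<in>{..<d}. S i (fst y))"
      unfolding \<pi>_def by (subst distr_distr[OF _ m]) (auto simp: comp_def)
    also have "\<dots> = distr (distr (P \<Otimes>\<^sub>M std_gaussian d) P fst) (borel_RR d) (\<lambda>\<omega>. \<lambda>i\<in>{..<d}. S i \<omega>)"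
      by (subst distr_distr[OF source_measurable]) (auto simp: comp_def)
    also have "distr (P \<Otimes>\<^sub>M std_gaussian d) P fst = P" by (rule Gm.distr_pair_fst)
    finally show ?thesis unfolding source_law_def .
  qed
  have "distr \<pi> (borel_RR d) snd = gauss_comb_law P d S c s"
    unfolding \<pi>_def gauss_comb_law_def by (subst distr_distr[OF _ m]) (auto simp: comp_def)
  then show "\<pi> \<in> couplings d source_law (gauss_comb_law P d S c s)"
    unfolding couplings_def using f by (simp add: \<pi>_def)
  assume i: "i < d"
  have mc: "(\<lambda>u. fst u i - snd u i) \<in> borel_measurable (borel_RR d \<Otimes>\<^sub>M borel_RR d)"
    by (intro borel_measurable_diff measurable_compose[OF measurable_fst borel_RR_component[OF i]]
        measurable_compose[OF measurable_snd borel_RR_component[OF i]])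
  note d = in_Lp_distr[OF m mc, folded \<pi>_def]
  have eq: "(\<lambda>i\<in>{..<d}. S i (fst y)) i - gauss_comb d S c s y i = (1 - c) * S i (fst y) + (- s) * snd y i" for y
    using i by (simp add: gauss_comb_def case_prod_beta algebra_simps)
  show "in_Lp p \<pi> (\<lambda>u. fst u i - snd u i)"
    unfolding d fst_conv snd_conv eq by (rule in_Lp_gauss_combination[OF S_Lp[OF i] i p_pos(2)])
  have "Lp_norm p \<pi> (\<lambda>u. fst u i - snd u i) \<le> \<bar>1 - c\<bar> * Lp_norm p P (S i) + \<bar>- s\<bar> * normal_norm p"
    unfolding d fst_conv snd_conv eq by (rule Lp_norm_gauss_combination[OF S_Lp[OF i] i p_pos(2)])
  also have "\<dots> = \<bar>c - 1\<bar> * Lp_norm p P (S i) + \<bar>s\<bar> * normal_norm p"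
    by (simp add: abs_minus_commute)
  also have "\<dots> \<le> \<bar>c - 1\<bar> * size_bound i + \<bar>s\<bar> * size_bound i"
    unfolding size_bound_def using normal_norm_nonneg by (intro add_mono mult_left_mono) auto
  finally show "Lp_norm p \<pi> (\<lambda>u. fst u i - snd u i) \<le> \<bar>c - 1\<bar> * size_bound i + \<bar>s\<bar> * size_bound i" .
qed

lemma rotation_step:
  assumes \<theta>: "0 < sin \<theta>"
    and \<pi>: "\<pi> \<in> couplings d source_law (gauss_comb_law P d S (cos \<theta>) (sin \<theta>))"
      "\<And>i. i < d \<Longrightarrow> in_Lp p \<pi> (\<lambda>u. fst u i - snd u i)"
  shows "\<exists>\<pi>'\<in>couplings d source_law (gauss_comb_law P d S (cos (\<theta> + \<delta>)) (sin (\<theta> + \<delta>))).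
    \<forall>i<d. in_Lp p \<pi>' (\<lambda>u. fst u i - snd u i) \<and>
      (Lp_norm p \<pi>' (\<lambda>u. fst u i - snd u i))\<^sup>2
      \<le> (Lp_norm p \<pi> (\<lambda>u. fst u i - snd u i) + \<bar>cos \<delta> - 1\<bar> * size_bound i + \<bar>sin \<delta>\<bar> * discrepancy i)\<^sup>2
        + orth_const p * (\<bar>sin \<delta>\<bar> * (size_bound i + discrepancy i))\<^sup>2"
proof -
  interpret stein_mixture P d S "cos \<theta>" "sin \<theta>" T p
    by (rule stein_mixture) (use \<theta> in auto)
  have dn: "defect_norm i = discrepancy i" for i
    by (simp add: discrepancy_def defect_def)
  show ?thesis
    using coupling_step[OF \<pi>, of "cos \<delta>" "sin \<delta>"] unfolding dn size_bound_def
    by (simp only: cos_add sin_add)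
qed

text \<open>Conditional means add up linearly, fluctuations in squares. The form k m + sqrt(K k) q
  is reproduced by one step because (A + sqrt(K k) q)^2 + K q^2 <= (A + sqrt(K (k + 1)) q)^2 for
  nonnegative A and q.\<close>

lemma chain_coupling:
  fixes n k :: nat and \<delta> :: real
  assumes n: "k < n" and \<delta>: "\<delta> = pi / (2 * real n)"
  shows "\<exists>\<pi>\<in>couplings d source_law (gauss_comb_law P d S (cos (real (Suc k) * \<delta>)) (sin (real (Suc k) * \<delta>))).
    \<forall>i<d. in_Lp p \<pi> (\<lambda>u. fst u i - snd u i) \<and>
      Lp_norm p \<pi> (\<lambda>u. fst u i - snd u i)
      \<le> real (Suc k) * (\<bar>cos \<delta> - 1\<bar> * size_bound i + \<bar>sin \<delta>\<bar> * discrepancy i)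
        + sqrt (orth_const p * real (Suc k)) * (\<bar>sin \<delta>\<bar> * (size_bound i + discrepancy i))"
  using n
proof (induction k)
  case 0
  have "\<bar>cos \<delta> - 1\<bar> * size_bound i + \<bar>sin \<delta>\<bar> * size_bound i
    \<le> (\<bar>cos \<delta> - 1\<bar> * size_bound i + \<bar>sin \<delta>\<bar> * discrepancy i)
        + sqrt (orth_const p) * (\<bar>sin \<delta>\<bar> * (size_bound i + discrepancy i))" for i
  proof -
    \<comment> \<open>Besides the cosine term, the initial coupling costs |sin \<delta>| times the
      size; since \<open>orth_const p\<close> is at least 1, this passes as the first
      fluctuation.\<close>
    have "1 * (\<bar>sin \<delta>\<bar> * (size_bound i + 0)) \<le> sqrt (orth_const p) * (\<bar>sin \<delta>\<bar> * (size_bound i + discrepancy i))"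
      using orth_const_ge_1 discrepancy_nonneg[of i] size_bound_nonneg[of i]
      by (intro mult_mono add_mono) auto
    moreover have "0 \<le> \<bar>sin \<delta>\<bar> * discrepancy i" using discrepancy_nonneg by simp
    ultimately show ?thesis by simp
  qed
  note b = order_trans[OF initial_coupling(3)[where c = "cos \<delta>" and s = "sin \<delta>"] this]
  show ?case
    using b initial_coupling(2)[where c = "cos \<delta>" and s = "sin \<delta>"]
    by (intro bexI[OF _ initial_coupling(1)[where c = "cos (real (Suc 0) * \<delta>)" and s = "sin (real (Suc 0) * \<delta>)"]]) auto
next
  case (Suc k)
  define K where "K = orth_const p"
  have K: "K \<ge> 0" using orth_const_ge_1 by (simp add: K_def)
  from Suc obtain \<pi> where \<pi>: "\<pi> \<in> couplings d source_law (gauss_comb_law P d S (cos (real (Suc k) * \<delta>)) (sin (real (Suc k) * \<delta>)))"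
    "\<And>i. i < d \<Longrightarrow> in_Lp p \<pi> (\<lambda>u. fst u i - snd u i)"
    "\<And>i. i < d \<Longrightarrow> Lp_norm p \<pi> (\<lambda>u. fst u i - snd u i)
      \<le> real (Suc k) * (\<bar>cos \<delta> - 1\<bar> * size_bound i + \<bar>sin \<delta>\<bar> * discrepancy i)
        + sqrt (K * real (Suc k)) * (\<bar>sin \<delta>\<bar> * (size_bound i + discrepancy i))"
    unfolding K_def by auto
  \<comment> \<open>The current angle is still at most pi/2, so its sine is positive and the
    posterior is available.\<close>
  have s: "0 < sin (real (Suc k) * \<delta>)"
  proof (rule sin_gt_zero)
    show "0 < real (Suc k) * \<delta>" using Suc.prems by (simp add: \<delta>)
    have "real (Suc k) * \<delta> \<le> real n * \<delta>" using Suc.prems by (intro mult_right_mono) (auto simp: \<delta>)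
    also have "\<dots> = pi / 2" using Suc.prems by (simp add: \<delta>)
    also have "\<dots> < pi" by simp
    finally show "real (Suc k) * \<delta> < pi" .
  qed
  have ang: "real (Suc k) * \<delta> + \<delta> = real (Suc (Suc k)) * \<delta>" by (simp add: algebra_simps)
  from rotation_step[OF s \<pi>(1,2), of \<delta>] obtain \<pi>' where
    \<pi>': "\<pi>' \<in> couplings d source_law (gauss_comb_law P d S (cos (real (Suc (Suc k)) * \<delta>)) (sin (real (Suc (Suc k)) * \<delta>)))"
    "\<And>i. i < d \<Longrightarrow> in_Lp p \<pi>' (\<lambda>u. fst u i - snd u i)"
    "\<And>i. i < d \<Longrightarrow> (Lp_norm p \<pi>' (\<lambda>u. fst u i - snd u i))\<^sup>2
      \<le> (Lp_norm p \<pi> (\<lambda>u. fst u i - snd u i) + \<bar>cos \<delta> - 1\<bar> * size_bound i + \<bar>sin \<delta>\<bar> * discrepancy i)\<^sup>2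
        + K * (\<bar>sin \<delta>\<bar> * (size_bound i + discrepancy i))\<^sup>2"
    unfolding ang K_def by blast
  have "Lp_norm p \<pi>' (\<lambda>u. fst u i - snd u i)
      \<le> real (Suc (Suc k)) * (\<bar>cos \<delta> - 1\<bar> * size_bound i + \<bar>sin \<delta>\<bar> * discrepancy i)
        + sqrt (K * real (Suc (Suc k))) * (\<bar>sin \<delta>\<bar> * (size_bound i + discrepancy i))" if i: "i < d" for i
  proof -
    define m where "m = \<bar>cos \<delta> - 1\<bar> * size_bound i + \<bar>sin \<delta>\<bar> * discrepancy i"
    define q where "q = \<bar>sin \<delta>\<bar> * (size_bound i + discrepancy i)"
    define A where "A = real (Suc (Suc k)) * m"
    have m: "m \<ge> 0" and q: "q \<ge> 0" using size_bound_nonneg discrepancy_nonneg by (auto simp: m_def q_def)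
    then have A: "A \<ge> 0" by (simp add: A_def)
    have "(Lp_norm p \<pi>' (\<lambda>u. fst u i - snd u i))\<^sup>2 \<le> (Lp_norm p \<pi> (\<lambda>u. fst u i - snd u i) + m)\<^sup>2 + K * q\<^sup>2"
      using \<pi>'(3)[OF i] by (simp add: m_def q_def add.assoc)
    also have "\<dots> \<le> ((real (Suc k) * m + sqrt (K * real (Suc k)) * q) + m)\<^sup>2 + K * q\<^sup>2"
      using \<pi>(3)[OF i] m by (intro add_right_mono power_mono) (auto simp: m_def q_def)
    also have "\<dots> = A\<^sup>2 + 2 * A * (sqrt (K * real (Suc k)) * q) + (sqrt (K * real (Suc k)))\<^sup>2 * q\<^sup>2 + K * q\<^sup>2"
      by (simp add: A_def power2_eq_square algebra_simps)
    also have "(sqrt (K * real (Suc k)))\<^sup>2 = K * real (Suc k)" using K by simp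
    also have "A\<^sup>2 + 2 * A * (sqrt (K * real (Suc k)) * q) + K * real (Suc k) * q\<^sup>2 + K * q\<^sup>2
        \<le> A\<^sup>2 + 2 * A * (sqrt (K * real (Suc (Suc k))) * q) + K * real (Suc (Suc k)) * q\<^sup>2"
    proof -
      have "2 * A * (sqrt (K * real (Suc k)) * q) \<le> 2 * A * (sqrt (K * real (Suc (Suc k))) * q)"
        using A q K by (intro mult_left_mono mult_right_mono real_sqrt_le_mono) auto
      moreover have "K * real (Suc k) * q\<^sup>2 + K * q\<^sup>2 = K * real (Suc (Suc k)) * q\<^sup>2"
        by (simp add: algebra_simps)
      ultimately show ?thesis by linarith
    qed
    also have "\<dots> = (A + sqrt (K * real (Suc (Suc k))) * q)\<^sup>2"
      using K by (simp add: power2_sum power_mult_distrib)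
    finally show ?thesis
      using A q K unfolding A_def m_def[symmetric] q_def[symmetric] by (intro power2_le_imp_le[of "Lp_norm p \<pi>' _"]) auto
  qed
  then show ?case using \<pi>'(1,2) unfolding K_def by (intro bexI[of _ \<pi>']) auto
qed

lemma target_law: "gauss_comb_law P d S 0 1 = std_gaussian d"
proof -
  have gm: "gauss_comb d S 0 1 \<in> P \<Otimes>\<^sub>M std_gaussian d \<rightarrow>\<^sub>M borel_RR d"
    by (rule gauss_comb_measurable) measurable
  show ?thesis
  proof (rule measure_eqI)
    fix A assume "A \<in> sets (gauss_comb_law P d S 0 1)"
    then have A: "A \<in> sets (borel_RR d)" by simp
    then have A': "A \<in> sets (std_gaussian d)" by (simp add: sets_std_gaussian)
    have im: "indicator A \<in> borel_measurable (borel_RR d)" "indicator A \<in> borel_measurable (std_gaussian d)"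
      using A A' by auto
    have "emeasure (gauss_comb_law P d S 0 1) A = (\<integral>\<^sup>+y. indicator A (gauss_comb d S 0 1 y) \<partial>(P \<Otimes>\<^sub>M std_gaussian d))"
      unfolding gauss_comb_law_def using A by (subst nn_integral_distr[OF gm, of "indicator A", symmetric]) auto
    also have "\<dots> = (\<integral>\<^sup>+y. indicator A (snd y) \<partial>(P \<Otimes>\<^sub>M std_gaussian d))"
    proof (rule nn_integral_cong)
      fix y assume "y \<in> space (P \<Otimes>\<^sub>M std_gaussian d)"
      then have "snd y \<in> space (std_gaussian d)" by (auto simp: space_pair_measure)
      then have "snd y \<in> extensional {..<d}" by (auto simp: std_gaussian_def space_PiM PiE_def)
      then have "gauss_comb d S 0 1 y = snd y"
        by (simp add: gauss_comb_def case_prod_beta extensional_restrict)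
      then show "indicator A (gauss_comb d S 0 1 y) = (indicator A (snd y) :: ennreal)" by simp
    qed
    also have "\<dots> = (\<integral>\<^sup>+z. indicator A z \<partial>std_gaussian d)"
      using A' by (subst Gm.nn_integral_fst[symmetric]) (auto simp: emeasure_space_1)
    also have "\<dots> = emeasure (std_gaussian d) A" using A' by simp
    finally show "emeasure (gauss_comb_law P d S 0 1) A = emeasure (std_gaussian d) A" .
  qed (simp add: sets_std_gaussian)
qed

text \<open>For n steps of size \<delta> = pi / (2 n), the drift accumulates to n sin \<delta> <= 2
  (from pi < 4), the cosine terms to n (1 - cos \<delta>) <= 2 / n, and the fluctuations to sqrt n
  sin \<delta> <= 2 / sqrt n, so only the first survives.\<close>

lemma gaussian_coupling:
  assumes n: "n > 0"
  shows "\<exists>\<pi>\<in>couplings d source_law (std_gaussian d).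
    \<forall>i<d. in_Lp p \<pi> (\<lambda>u. fst u i - snd u i) \<and>
      Lp_norm p \<pi> (\<lambda>u. fst u i - snd u i) \<le> 2 * discrepancy i
        + (2 / real n * size_bound i + 2 * sqrt (orth_const p) / sqrt (real n) * (size_bound i + discrepancy i))"
proof -
  define \<delta> where "\<delta> = pi / (2 * real n)"
  have nd: "real n * \<delta> = pi / 2" using n by (simp add: \<delta>_def)
  have \<delta>: "0 < \<delta>" "\<delta> \<le> 2 / real n" using n pi_less_4 by (auto simp: \<delta>_def field_simps)
  obtain k where k: "n = Suc k" using n by (cases n) auto
  have sd: "\<bar>sin \<delta>\<bar> \<le> 2 / real n" using abs_sin_x_le_abs_x[of \<delta>] \<delta> by simp
  have cd: "\<bar>cos \<delta> - 1\<bar> \<le> 2 / (real n)\<^sup>2"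
  proof -
    have "cos \<delta> = 1 - 2 * (sin (\<delta> / 2))\<^sup>2" using cos_double_sin[of "\<delta> / 2"] by simp
    then have "\<bar>cos \<delta> - 1\<bar> = 2 * \<bar>sin (\<delta> / 2)\<bar>\<^sup>2" by simp
    also have "\<dots> \<le> 2 * (\<delta> / 2)\<^sup>2"
      using abs_sin_x_le_abs_x[of "\<delta> / 2"] \<delta> by (intro mult_left_mono power_mono) auto
    also have "\<dots> \<le> 2 * (1 / real n)\<^sup>2"
      using \<delta> by (intro mult_left_mono power_mono) auto
    finally show ?thesis by (simp add: power_divide)
  qed
  from chain_coupling[of k n \<delta>] k obtain \<pi> where
    \<pi>: "\<pi> \<in> couplings d source_law (gauss_comb_law P d S (cos (real n * \<delta>)) (sin (real n * \<delta>)))"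
    "\<And>i. i < d \<Longrightarrow> in_Lp p \<pi> (\<lambda>u. fst u i - snd u i)"
    "\<And>i. i < d \<Longrightarrow> Lp_norm p \<pi> (\<lambda>u. fst u i - snd u i)
      \<le> real n * (\<bar>cos \<delta> - 1\<bar> * size_bound i + \<bar>sin \<delta>\<bar> * discrepancy i)
        + sqrt (orth_const p * real n) * (\<bar>sin \<delta>\<bar> * (size_bound i + discrepancy i))"
    using \<delta>_def by blast
  have "\<pi> \<in> couplings d source_law (std_gaussian d)"
    using \<pi>(1) by (simp add: nd target_law)
  moreover have "Lp_norm p \<pi> (\<lambda>u. fst u i - snd u i) \<le> 2 * discrepancy i
        + (2 / real n * size_bound i + 2 * sqrt (orth_const p) / sqrt (real n) * (size_bound i + discrepancy i))"
    if i: "i < d" for i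
  proof -
    have 1: "real n * (\<bar>cos \<delta> - 1\<bar> * size_bound i + \<bar>sin \<delta>\<bar> * discrepancy i)
        \<le> real n * (2 / (real n)\<^sup>2 * size_bound i + 2 / real n * discrepancy i)"
      using size_bound_nonneg discrepancy_nonneg by (intro mult_left_mono add_mono mult_right_mono cd sd) auto
    have 2: "real n * (2 / (real n)\<^sup>2 * size_bound i + 2 / real n * discrepancy i)
        = 2 / real n * size_bound i + 2 * discrepancy i"
      using n by (simp add: power2_eq_square field_simps)
    have 3: "sqrt (orth_const p * real n) * (\<bar>sin \<delta>\<bar> * (size_bound i + discrepancy i))
        \<le> sqrt (orth_const p * real n) * (2 / real n * (size_bound i + discrepancy i))"
      using size_bound_nonneg[of i] discrepancy_nonneg[of i] orth_const_ge_1 sd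
      by (intro mult_left_mono mult_right_mono) auto
    have 4: "sqrt (orth_const p * real n) * (2 / real n * (size_bound i + discrepancy i))
        = 2 * sqrt (orth_const p) / sqrt (real n) * (size_bound i + discrepancy i)"
    proof -
      have "sqrt (real n) / real n = 1 / sqrt (real n)"
        using n by (simp add: real_div_sqrt field_simps)
      moreover have "sqrt (orth_const p * real n) * (2 / real n * Q) = 2 * sqrt (orth_const p) * (sqrt (real n) / real n) * Q" for Q
        by (simp add: real_sqrt_mult)
      ultimately show ?thesis by (simp only: times_divide_eq_right mult_1_right)
    qed
    show ?thesis using \<pi>(3)[OF i] 1 3 unfolding 2 4 by linarith
  qed
  ultimately show ?thesis using \<pi>(2) by blast
qed

end

subsection \<open>From the coupling to the Wasserstein distance\<close>

text \<open>Power mean inequality: the tangents at the average are summed, and their linear terms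
  cancel.\<close>

lemma sum_powr_le:
  fixes a :: "nat \<Rightarrow> real"
  assumes q: "q \<ge> 1" and a: "\<And>i. i < d \<Longrightarrow> 0 \<le> a i"
  shows "(\<Sum>i<d. a i) powr q \<le> real d powr (q - 1) * (\<Sum>i<d. a i powr q)"
proof (cases "(\<Sum>i<d. a i) = 0")
  case True
  then show ?thesis by (simp add: sum_nonneg)
next
  case False
  then have d: "d > 0" by (cases d) auto
  define y where "y = (\<Sum>i<d. a i) / real d"
  have S: "(\<Sum>i<d. a i) = real d * y" using d by (simp add: y_def)
  have "(\<Sum>i<d. a i) \<ge> 0" using a by (intro sum_nonneg) auto
  then have y: "y > 0" using False d by (simp add: y_def)
  have "(\<Sum>i<d. y powr q + q * y powr (q - 1) * (a i - y)) \<le> (\<Sum>i<d. a i powr q)"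
    using powr_above_tangent[OF q a y] by (intro sum_mono) auto
  moreover have "(\<Sum>i<d. y powr q + q * y powr (q - 1) * (a i - y)) = real d * y powr q"
    by (simp add: sum.distrib sum_distrib_left[symmetric] sum_subtractf S)
  ultimately have "real d * y powr q \<le> (\<Sum>i<d. a i powr q)" by simp
  then have "real d powr (q - 1) * (real d * y powr q) \<le> real d powr (q - 1) * (\<Sum>i<d. a i powr q)"
    by (intro mult_left_mono) auto
  moreover have "real d powr (q - 1) * (real d * y powr q) = (\<Sum>i<d. a i) powr q"
    using d y unfolding S by (simp add: powr_mult powr_diff)
  ultimately show ?thesis by simp
qed

text \<open>The passage from the Euclidean norm to single coordinates; its d^(p/2-1) is the first
  half of the dimension factor.\<close>

lemma edist_powr_le:
  assumes p: "p \<ge> 2"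
  shows "edist d x y powr p \<le> real d powr (p / 2 - 1) * (\<Sum>i<d. \<bar>x i - y i\<bar> powr p)"
proof -
  have "edist d x y powr p = ((edist d x y)\<^sup>2) powr (p / 2)"
    by (rule square_powr_half[symmetric]) (simp add: edist_def)
  also have "(edist d x y)\<^sup>2 = (\<Sum>i<d. (x i - y i)\<^sup>2)"
    by (simp add: edist_def L2_set_def sum_nonneg)
  also have "(\<Sum>i<d. (x i - y i)\<^sup>2) powr (p / 2) \<le> real d powr (p / 2 - 1) * (\<Sum>i<d. ((x i - y i)\<^sup>2) powr (p / 2))"
    using p by (intro sum_powr_le) auto
  also have "(\<Sum>i<d. ((x i - y i)\<^sup>2) powr (p / 2)) = (\<Sum>i<d. \<bar>x i - y i\<bar> powr p)"
    by (intro sum.cong refl) (metis abs_ge_zero power2_abs square_powr_half)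
  finally show ?thesis .
qed

lemma indep_vars_PiM_coordinates:
  assumes I: "I \<noteq> {}" and M: "\<And>i. prob_space (M i)"
  shows "prob_space.indep_vars (PiM I M) M (\<lambda>i \<omega>. \<omega> i) I"
proof -
  interpret prob_space "PiM I M" by (rule prob_space_PiM[OF M])
  have "distr (PiM I M) (PiM I M) (\<lambda>\<omega>. \<lambda>i\<in>I. \<omega> i) = distr (PiM I M) (PiM I M) (\<lambda>\<omega>. \<omega>)"
    by (intro distr_cong refl) (auto simp: space_PiM PiE_def extensional_restrict)
  also have "\<dots> = PiM I M" by (rule distr_id2) simp
  also have "\<dots> = PiM I (\<lambda>i. distr (PiM I M) (M i) (\<lambda>\<omega>. \<omega> i))"
    by (intro PiM_cong refl distr_PiM_component[symmetric] M) auto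
  finally have "distr (PiM I M) (PiM I M) (\<lambda>\<omega>. \<lambda>i\<in>I. \<omega> i) = PiM I (\<lambda>i. distr (PiM I M) (M i) (\<lambda>\<omega>. \<omega> i))" .
  then show ?thesis
    by (subst indep_vars_iff_distr_eq_PiM'[OF I]) auto
qed

lemma integral_std_gaussian_coordinate:
  assumes "i < d"
  shows "(\<integral>z. z i \<partial>std_gaussian d) = 0"
proof -
  let ?G = "density lborel (\<lambda>x. ennreal (std_normal_density x))"
  interpret prob_space ?G by (rule prob_space_std_normal)
  have d: "distr (std_gaussian d) ?G (\<lambda>z. z i) = ?G"
    unfolding std_gaussian_def using assms by (intro distr_PiM_component prob_space_std_normal) auto
  have m: "(\<lambda>z. z i) \<in> std_gaussian d \<rightarrow>\<^sub>M ?G"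
    using std_gaussian_component[OF assms] by simp
  have "distributed ?G lborel (\<lambda>x. x) (\<lambda>x. ennreal (std_normal_density x))"
    unfolding distributed_def by (auto simp: distr_id2)
  from standard_normal_distributed_expectation[OF this] have "(\<integral>x. x \<partial>?G) = 0" .
  moreover have "(\<integral>x. x \<partial>distr (std_gaussian d) ?G (\<lambda>z. z i)) = (\<integral>z. z i \<partial>std_gaussian d)"
    by (rule integral_distr[OF m]) simp
  ultimately show ?thesis unfolding d by simp
qed

text \<open>The summands a_j z_j are independent and centred, so adding squares of norms produces
  the Euclidean norm of the coefficients; replacing it by their p-norm costs the second
  d^(p/2-1).\<close>

lemma integral_gauss_linear_powr_le:
  assumes p: "p \<ge> 2"
  shows "(\<integral>z. \<bar>\<Sum>j<d. a j * z j\<bar> powr p \<partial>std_gaussian d)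
    \<le> (orth_const p * (normal_norm p)\<^sup>2) powr (p / 2) * real d powr (p / 2 - 1) * (\<Sum>j<d. \<bar>a j\<bar> powr p)"
proof (cases "d = 0")
  case False
  interpret prob_space "std_gaussian d" by (rule prob_space_std_gaussian)
  have p0: "p > 0" using p by simp
  let ?G = "density lborel (\<lambda>x. ennreal (std_normal_density x))"
  have "indep_vars (\<lambda>_. ?G) (\<lambda>i \<omega>. \<omega> i) {..<d}"
    using indep_vars_PiM_coordinates[of "{..<d}" "\<lambda>_. ?G"] False prob_space_std_normal
    by (auto simp: std_gaussian_def)
  then have iv: "indep_vars (\<lambda>_. borel) (\<lambda>j z. a j * z j) {..<d}"
    by (rule indep_vars_compose2) auto
  define f where "f = (\<lambda>z. \<Sum>j<d. a j * z j)"
  have nz: "Lp_norm p (std_gaussian d) (\<lambda>z. a j * z j) = \<bar>a j\<bar> * normal_norm p" if "j < d" for j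
    using Lp_norm_cmult[OF in_Lp_std_gaussian[OF that p0] p0] Lp_norm_std_gaussian[OF that p0] by simp
  have "(Lp_norm p (std_gaussian d) f)\<^sup>2 \<le> orth_const p * (\<Sum>j<d. (Lp_norm p (std_gaussian d) (\<lambda>z. a j * z j))\<^sup>2)"
    unfolding f_def using p0
    by (intro Lp_norm_indep_sum p iv in_Lp_cmult in_Lp_std_gaussian)
      (auto simp: integral_std_gaussian_coordinate)
  also have "\<dots> = orth_const p * (\<Sum>j<d. (a j)\<^sup>2 * (normal_norm p)\<^sup>2)"
    by (intro arg_cong2[where f = "(*)"] sum.cong refl) (auto simp: nz power_mult_distrib)
  also have "\<dots> = (orth_const p * (normal_norm p)\<^sup>2) * (\<Sum>j<d. (a j)\<^sup>2)"
    by (simp add: sum_distrib_left sum_distrib_right mult_ac)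
  finally have "((Lp_norm p (std_gaussian d) f)\<^sup>2) powr (p / 2)
      \<le> ((orth_const p * (normal_norm p)\<^sup>2) * (\<Sum>j<d. (a j)\<^sup>2)) powr (p / 2)"
    using p by (intro powr_mono2) auto
  also have "\<dots> = (orth_const p * (normal_norm p)\<^sup>2) powr (p / 2) * (\<Sum>j<d. (a j)\<^sup>2) powr (p / 2)"
    using orth_const_pos[OF p] by (intro powr_mult)
  also have "\<dots> \<le> (orth_const p * (normal_norm p)\<^sup>2) powr (p / 2) * (real d powr (p / 2 - 1) * (\<Sum>j<d. ((a j)\<^sup>2) powr (p / 2)))"
    using p by (intro mult_left_mono sum_powr_le) auto
  also have "(\<Sum>j<d. ((a j)\<^sup>2) powr (p / 2)) = (\<Sum>j<d. \<bar>a j\<bar> powr p)"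
    by (intro sum.cong refl) (metis abs_ge_zero power2_abs square_powr_half)
  also have "((Lp_norm p (std_gaussian d) f)\<^sup>2) powr (p / 2) = (\<integral>z. \<bar>f z\<bar> powr p \<partial>std_gaussian d)"
    using p0 by (simp add: square_powr_half Lp_norm_powr)
  finally show ?thesis by (simp add: f_def mult.assoc)
qed simp

lemma epowr_le_ennreal:
  assumes "a \<le> ennreal b" "0 \<le> b" "0 \<le> r"
  shows "epowr a r \<le> ennreal (b powr r)"
proof -
  have "a \<noteq> \<infinity>" using assms by (auto simp: top_unique)
  moreover have "enn2real a \<le> b" using assms enn2real_mono[of a "ennreal b"] by simp
  then have "enn2real a powr r \<le> b powr r" using assms by (intro powr_mono2) auto
  ultimately show ?thesis by (simp add: epowr_def ennreal_leI)
qed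

context stein_pair
begin

text \<open>For a fixed sample point (T - I) z is a linear form in the Gaussian coordinates, so the
  integral over z is taken first.\<close>

lemma discrepancy_le:
  assumes i: "i < d"
  shows "discrepancy i powr p \<le> (orth_const p * (normal_norm p)\<^sup>2) powr (p / 2) * real d powr (p / 2 - 1)
    * (\<Sum>j<d. \<integral>\<omega>. \<bar>T i j \<omega> - id_mat i j\<bar> powr p \<partial>P)"
proof -
  define \<kappa> where "\<kappa> = (orth_const p * (normal_norm p)\<^sup>2) powr (p / 2) * real d powr (p / 2 - 1)"
  have \<kappa>: "\<kappa> \<ge> 0" by (simp add: \<kappa>_def)
  define A where "A j \<omega> = T i j \<omega> - id_mat i j" for j \<omega>
  have AL: "in_Lp p P (A j)" if "j < d" for j
  proof -
    have "in_Lp p P (\<lambda>_. id_mat i j)" using in_Lp_cmult[OF in_Lp_one p_pos(1), of "id_mat i j"] by simp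
    then show ?thesis unfolding A_def by (intro in_Lp_diff T_Lp i that p_pos)
  qed
  then have Ai: "integrable P (\<lambda>\<omega>. \<bar>A j \<omega>\<bar> powr p)" and [measurable]: "A j \<in> borel_measurable P" if "j < d" for j
    using that by (auto simp: in_Lp_def)
  define F where "F = (\<lambda>y. \<Sum>j<d. A j (fst y) * snd y j)"
  have F_eq: "(\<Sum>j<d. T i j (fst y) * snd y j) - snd y i = F y" for y :: "'w \<times> rvec"
  proof -
    have "(\<Sum>j<d. id_mat i j * snd y j) = (\<Sum>j<d. if j = i then snd y j else 0)"
      by (intro sum.cong) (auto simp: id_mat_def)
    also have "\<dots> = snd y i" using i by simp
    finally show ?thesis by (simp add: F_def A_def left_diff_distrib sum_subtractf)
  qed
  have FL: "in_Lp p (P \<Otimes>\<^sub>M std_gaussian d) F"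
    unfolding F_def using p_pos
    by (intro in_Lp_sum PG.in_Lp_pair_mult in_Lp_std_gaussian AL) auto
  then have Fi: "integrable (P \<Otimes>\<^sub>M std_gaussian d) (\<lambda>y. \<bar>F y\<bar> powr p)" by (simp add: in_Lp_def)
  have "discrepancy i powr p = (\<integral>y. \<bar>F y\<bar> powr p \<partial>(P \<Otimes>\<^sub>M std_gaussian d))"
    unfolding discrepancy_def F_eq using p_pos by (simp add: Lp_norm_powr)
  also have "\<dots> = (\<integral>\<omega>. \<integral>z. \<bar>F (\<omega>, z)\<bar> powr p \<partial>std_gaussian d \<partial>P)"
    by (rule PG.integral_fst'[symmetric, OF Fi])
  also have "\<dots> \<le> (\<integral>\<omega>. \<kappa> * (\<Sum>j<d. \<bar>A j \<omega>\<bar> powr p) \<partial>P)"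
  proof (rule integral_mono)
    show "integrable P (\<lambda>\<omega>. \<integral>z. \<bar>F (\<omega>, z)\<bar> powr p \<partial>std_gaussian d)"
      by (rule PG.integrable_fst'[OF Fi])
    show "integrable P (\<lambda>\<omega>. \<kappa> * (\<Sum>j<d. \<bar>A j \<omega>\<bar> powr p))"
      using Ai by (intro integrable_mult_right Bochner_Integration.integrable_sum) auto
    show "(\<integral>z. \<bar>F (\<omega>, z)\<bar> powr p \<partial>std_gaussian d) \<le> \<kappa> * (\<Sum>j<d. \<bar>A j \<omega>\<bar> powr p)" for \<omega>
      unfolding F_def \<kappa>_def fst_conv snd_conv by (rule integral_gauss_linear_powr_le[OF p_ge])
  qed
  also have "\<dots> = \<kappa> * (\<Sum>j<d. \<integral>\<omega>. \<bar>A j \<omega>\<bar> powr p \<partial>P)"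
    using Ai by (subst integral_mult_right_zero, subst Bochner_Integration.integral_sum) auto
  finally show ?thesis by (simp add: \<kappa>_def A_def)
qed

lemma coupling_cost_le:
  assumes \<pi>: "\<pi> \<in> couplings d \<mu> \<nu>"
    and i: "\<And>i. i < d \<Longrightarrow> in_Lp p \<pi> (\<lambda>u. fst u i - snd u i)"
      "\<And>i. i < d \<Longrightarrow> Lp_norm p \<pi> (\<lambda>u. fst u i - snd u i) \<le> b i"
  shows "(\<integral>\<^sup>+z. ennreal (edist d (fst z) (snd z) powr p) \<partial>\<pi>) \<le> ennreal (real d powr (p / 2 - 1) * (\<Sum>i<d. b i powr p))"
proof -
  have ii: "integrable \<pi> (\<lambda>u. \<bar>fst u i - snd u i\<bar> powr p)" if "i < d" for i
    using i(1)[OF that] by (simp add: in_Lp_def)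
  then have si: "integrable \<pi> (\<lambda>z. real d powr (p / 2 - 1) * (\<Sum>i<d. \<bar>fst z i - snd z i\<bar> powr p))"
    by (intro integrable_mult_right Bochner_Integration.integrable_sum) auto
  have "(\<integral>\<^sup>+z. ennreal (edist d (fst z) (snd z) powr p) \<partial>\<pi>)
      \<le> (\<integral>\<^sup>+z. ennreal (real d powr (p / 2 - 1) * (\<Sum>i<d. \<bar>fst z i - snd z i\<bar> powr p)) \<partial>\<pi>)"
    by (intro nn_integral_mono ennreal_leI edist_powr_le p_ge)
  also have "\<dots> = ennreal (\<integral>z. real d powr (p / 2 - 1) * (\<Sum>i<d. \<bar>fst z i - snd z i\<bar> powr p) \<partial>\<pi>)"
    by (intro nn_integral_eq_integral si) (auto intro!: mult_nonneg_nonneg sum_nonneg)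
  also have "(\<integral>z. real d powr (p / 2 - 1) * (\<Sum>i<d. \<bar>fst z i - snd z i\<bar> powr p) \<partial>\<pi>)
      = real d powr (p / 2 - 1) * (\<Sum>i<d. Lp_norm p \<pi> (\<lambda>u. fst u i - snd u i) powr p)"
    using ii p_pos by (subst integral_mult_right_zero, subst Bochner_Integration.integral_sum) (auto simp: Lp_norm_powr)
  also have "\<dots> \<le> real d powr (p / 2 - 1) * (\<Sum>i<d. b i powr p)"
    using i(2) p_pos by (intro mult_left_mono sum_mono powr_mono2) auto
  finally show ?thesis by (simp add: ennreal_leI)
qed

text \<open>The couplings vary with n but the infimum does not, so the error terms may tend to 0
  without any convergence of couplings.\<close>

lemma wasserstein_le_discrepancy:
  "wasserstein p d source_law (std_gaussian d)
    \<le> ennreal ((real d powr (p / 2 - 1) * (\<Sum>i<d. (2 * discrepancy i) powr p)) powr (1 / p))"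
proof -
  define e where "e i n = 2 / real (Suc n) * size_bound i
      + 2 * sqrt (orth_const p) / sqrt (real (Suc n)) * (size_bound i + discrepancy i)" for i n
  let ?I = "INF \<pi>\<in>couplings d source_law (std_gaussian d). \<integral>\<^sup>+z. ennreal (edist d (fst z) (snd z) powr p) \<partial>\<pi>"
  have I: "?I \<le> ennreal (real d powr (p / 2 - 1) * (\<Sum>i<d. (2 * discrepancy i + e i n) powr p))" for n
  proof -
    from gaussian_coupling[of "Suc n"] obtain \<pi> where \<pi>: "\<pi> \<in> couplings d source_law (std_gaussian d)"
      "\<And>i. i < d \<Longrightarrow> in_Lp p \<pi> (\<lambda>u. fst u i - snd u i)"
      "\<And>i. i < d \<Longrightarrow> Lp_norm p \<pi> (\<lambda>u. fst u i - snd u i) \<le> 2 * discrepancy i + e i n"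
      unfolding e_def by blast
    show ?thesis by (rule INF_lower2[OF \<pi>(1)]) (rule coupling_cost_le[OF \<pi>])
  qed
  have e: "(e i \<longlongrightarrow> 0) sequentially" for i
  proof -
    have "(\<lambda>n. inverse (real (Suc n))) \<longlonglongrightarrow> 0" by (rule LIMSEQ_inverse_real_of_nat)
    then have 1: "(\<lambda>n. 2 * inverse (real (Suc n)) * size_bound i + 2 * sqrt (orth_const p) * sqrt (inverse (real (Suc n))) * (size_bound i + discrepancy i))
        \<longlonglongrightarrow> 2 * 0 * size_bound i + 2 * sqrt (orth_const p) * sqrt 0 * (size_bound i + discrepancy i)"
      by (intro tendsto_intros)
    have 2: "e i = (\<lambda>n. 2 * inverse (real (Suc n)) * size_bound i + 2 * sqrt (orth_const p) * sqrt (inverse (real (Suc n))) * (size_bound i + discrepancy i))"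
      unfolding e_def by (simp only: divide_inverse real_sqrt_inverse)
    show ?thesis using 1 unfolding 2 by simp
  qed
  have "((\<lambda>n. (2 * discrepancy i + e i n) powr p) \<longlongrightarrow> (2 * discrepancy i + 0) powr p) sequentially" for i
  proof (rule tendsto_powr')
    show "(\<lambda>n. 2 * discrepancy i + e i n) \<longlonglongrightarrow> 2 * discrepancy i + 0"
      by (intro tendsto_intros e)
    \<comment> \<open>The limit of the base may be 0, where continuity of the power relies on p > 0
      and on nonnegative bases.\<close>
    show "2 * discrepancy i + 0 \<noteq> 0 \<or> 0 < p \<and> (\<forall>\<^sub>F n in sequentially. 0 \<le> 2 * discrepancy i + e i n)"
      using p_pos discrepancy_nonneg[of i] size_bound_nonneg[of i] orth_const_ge_1
      by (intro disjI2 conjI always_eventually allI) (auto simp: e_def intro!: add_nonneg_nonneg mult_nonneg_nonneg)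
  qed auto
  then have "((\<lambda>n. ennreal (real d powr (p / 2 - 1) * (\<Sum>i<d. (2 * discrepancy i + e i n) powr p)))
      \<longlongrightarrow> ennreal (real d powr (p / 2 - 1) * (\<Sum>i<d. (2 * discrepancy i + 0) powr p))) sequentially"
    by (intro tendsto_ennrealI tendsto_mult tendsto_const tendsto_sum)
  then have "?I \<le> ennreal (real d powr (p / 2 - 1) * (\<Sum>i<d. (2 * discrepancy i + 0) powr p))"
    by (rule tendsto_lowerbound) (use I in \<open>auto simp del: INF_le_iff\<close>)
  then show ?thesis
    unfolding wasserstein_def using p_pos by (intro epowr_le_ennreal) (auto intro!: mult_nonneg_nonneg sum_nonneg)
qed

text \<open>The two factors d^(p/2-1), from the coupling cost and from the Gaussian linear forms,
  multiply to d^(p-2), whose p-th root is d^(1-2/p).\<close>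

lemma wasserstein_le_kernel:
  "wasserstein p d source_law (std_gaussian d)
    \<le> ennreal ((2 powr p * (orth_const p * (normal_norm p)\<^sup>2) powr (p / 2) * real d powr (p - 2)
        * (\<Sum>i<d. \<Sum>j<d. \<integral>\<omega>. \<bar>T i j \<omega> - id_mat i j\<bar> powr p \<partial>P)) powr (1 / p))"
proof -
  have "real d powr (p / 2 - 1) * (\<Sum>i<d. (2 * discrepancy i) powr p)
      \<le> real d powr (p / 2 - 1) * (\<Sum>i<d. 2 powr p * ((orth_const p * (normal_norm p)\<^sup>2) powr (p / 2) * real d powr (p / 2 - 1)
        * (\<Sum>j<d. \<integral>\<omega>. \<bar>T i j \<omega> - id_mat i j\<bar> powr p \<partial>P)))"
  proof (intro mult_left_mono sum_mono)
    fix i assume "i \<in> {..<d}"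
    then have "2 powr p * discrepancy i powr p \<le> 2 powr p * ((orth_const p * (normal_norm p)\<^sup>2) powr (p / 2)
        * real d powr (p / 2 - 1) * (\<Sum>j<d. \<integral>\<omega>. \<bar>T i j \<omega> - id_mat i j\<bar> powr p \<partial>P))"
      by (intro mult_left_mono discrepancy_le) auto
    then show "(2 * discrepancy i) powr p \<le> 2 powr p * ((orth_const p * (normal_norm p)\<^sup>2) powr (p / 2)
        * real d powr (p / 2 - 1) * (\<Sum>j<d. \<integral>\<omega>. \<bar>T i j \<omega> - id_mat i j\<bar> powr p \<partial>P))"
      by (simp only: powr_mult)
  qed simp
  also have "\<dots> = 2 powr p * (orth_const p * (normal_norm p)\<^sup>2) powr (p / 2) * (real d powr (p / 2 - 1) * real d powr (p / 2 - 1))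
        * (\<Sum>i<d. \<Sum>j<d. \<integral>\<omega>. \<bar>T i j \<omega> - id_mat i j\<bar> powr p \<partial>P)"
    by (simp add: sum_distrib_left mult_ac)
  also have "real d powr (p / 2 - 1) * real d powr (p / 2 - 1) = real d powr (p - 2)"
    by (simp flip: powr_add)
  finally show ?thesis
    using p_pos by (intro order_trans[OF wasserstein_le_discrepancy] ennreal_leI powr_mono2)
      (auto intro!: mult_nonneg_nonneg sum_nonneg)
qed

end

subsection \<open>Gradients and the first variation of the Poincare inequality\<close>

lemma abs_coordinate_le_edist: "i < d \<Longrightarrow> \<bar>y i - x i\<bar> \<le> edist d y x"
  using member_le_L2_set[of "{..<d}" i "\<lambda>i. \<bar>y i - x i\<bar>"] by (simp add: edist_def L2_set_def)

lemma edist_nonneg [simp]: "0 \<le> edist d y x"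
  by (simp add: edist_def)

lemma edist_pos:
  assumes "x \<in> RR d" "y \<in> RR d" "y \<noteq> x"
  shows "0 < edist d y x"
proof -
  have "\<exists>i<d. y i \<noteq> x i"
  proof (rule ccontr)
    assume "\<not> (\<exists>i<d. y i \<noteq> x i)"
    then have "y = x" using assms(1,2) unfolding RR_def by (intro PiE_ext) auto
    then show False using assms(3) by simp
  qed
  then obtain i where i: "i < d" "y i \<noteq> x i" by blast
  then have "0 < \<bar>y i - x i\<bar>" by simp
  then show ?thesis using abs_coordinate_le_edist[OF i(1), of y x] by linarith
qed

lemma edist_tendsto_zero:
  assumes "x \<in> RR d" shows "((\<lambda>y. edist d y x) \<longlongrightarrow> 0) (at x within RR d)"
proof (rule tendstoI)
  fix e :: real assume "e > 0"
  then show "\<forall>\<^sub>F y in at x within RR d. dist (edist d y x) 0 < e"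
    unfolding eventually_at_within_RR[OF assms] by (intro exI[of _ e]) auto
qed

lemma eventually_edist_pos:
  assumes "x \<in> RR d" shows "\<forall>\<^sub>F y in at x within RR d. 0 < edist d y x"
  unfolding eventually_at_within_RR[OF assms] using edist_pos[OF assms] by (intro exI[of _ 1]) auto

lemma has_gradient_lincomb:
  assumes "has_gradient d f v x" "has_gradient d f' v' x"
  shows "has_gradient d (\<lambda>y. f y + t * f' y) (\<lambda>i. v i + t * v' i) x"
proof -
  have "((\<lambda>y. (f y - f x - (\<Sum>i<d. v i * (y i - x i))) / edist d y x
      + t * ((f' y - f' x - (\<Sum>i<d. v' i * (y i - x i))) / edist d y x)) \<longlongrightarrow> 0 + t * 0) (at x within RR d)"
    using assms unfolding has_gradient_def by (intro tendsto_intros)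
  moreover have "(\<lambda>y. (f y - f x - (\<Sum>i<d. v i * (y i - x i))) / edist d y x
      + t * ((f' y - f' x - (\<Sum>i<d. v' i * (y i - x i))) / edist d y x))
    = (\<lambda>y. ((f y + t * f' y) - (f x + t * f' x) - (\<Sum>i<d. (v i + t * v' i) * (y i - x i))) / edist d y x)"
  proof
    fix y
    have "(\<Sum>i<d. (v i + t * v' i) * (y i - x i)) = (\<Sum>i<d. v i * (y i - x i)) + t * (\<Sum>i<d. v' i * (y i - x i))"
      by (simp add: sum_distrib_left sum.distrib[symmetric] distrib_right mult.assoc)
    then show "(f y - f x - (\<Sum>i<d. v i * (y i - x i))) / edist d y x
      + t * ((f' y - f' x - (\<Sum>i<d. v' i * (y i - x i))) / edist d y x)
      = ((f y + t * f' y) - (f x + t * f' x) - (\<Sum>i<d. (v i + t * v' i) * (y i - x i))) / edist d y x"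
      by (simp add: add_divide_distrib[symmetric] algebra_simps)
  qed
  ultimately show ?thesis by (simp add: has_gradient_def)
qed

lemma has_gradient_const: "has_gradient d (\<lambda>y. k) (\<lambda>i. 0) x"
  by (simp add: has_gradient_def)

lemma has_gradient_coordinate:
  assumes "i < d" shows "has_gradient d (\<lambda>y. y i) (\<lambda>j. if j = i then 1 else 0) x"
proof -
  have "(\<Sum>j<d. (if j = i then 1 else 0) * (y j - x j)) = y i - x i" for y
  proof -
    have "(\<Sum>j<d. (if j = i then 1 else 0) * (y j - x j)) = (\<Sum>j<d. if j = i then y j - x j else 0)"
      by (intro sum.cong) auto
    then show ?thesis using assms by simp
  qed
  then show ?thesis by (simp add: has_gradient_def)
qed

text \<open>Differentiability at one point bounds the difference quotients near it; in the chain
  rule this is the bounded factor next to one that tends to 0.\<close>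

lemma has_gradient_increment_bounded:
  assumes x: "x \<in> RR d" and f: "has_gradient d f v x"
  shows "\<forall>\<^sub>F y in at x within RR d. \<bar>f y - f x\<bar> \<le> (1 + (\<Sum>i<d. \<bar>v i\<bar>)) * edist d y x"
proof -
  have "\<forall>\<^sub>F y in at x within RR d. dist ((f y - f x - (\<Sum>i<d. v i * (y i - x i))) / edist d y x) 0 < 1"
    using f unfolding has_gradient_def by (rule tendstoD) simp
  then show ?thesis using eventually_edist_pos[OF x]
  proof eventually_elim
    case (elim y)
    then have 1: "\<bar>f y - f x - (\<Sum>i<d. v i * (y i - x i))\<bar> \<le> edist d y x"
      by (simp add: divide_less_eq)
    have "\<bar>\<Sum>i<d. v i * (y i - x i)\<bar> \<le> (\<Sum>i<d. \<bar>v i\<bar> * edist d y x)"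
      by (intro order_trans[OF sum_abs] sum_mono) (auto simp: abs_mult intro!: mult_left_mono abs_coordinate_le_edist)
    then show ?case using 1 by (simp add: sum_distrib_right[symmetric] distrib_right)
  qed
qed

lemma has_gradient_imp_tendsto:
  assumes x: "x \<in> RR d" and f: "has_gradient d f v x"
  shows "(f \<longlongrightarrow> f x) (at x within RR d)"
proof -
  have "((\<lambda>y. f y - f x) \<longlongrightarrow> 0) (at x within RR d)"
  proof (rule Lim_null_comparison)
    show "\<forall>\<^sub>F y in at x within RR d. norm (f y - f x) \<le> (1 + (\<Sum>i<d. \<bar>v i\<bar>)) * edist d y x"
      using has_gradient_increment_bounded[OF assms] by simp
    show "((\<lambda>y. (1 + (\<Sum>i<d. \<bar>v i\<bar>)) * edist d y x) \<longlongrightarrow> 0) (at x within RR d)"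
      using tendsto_mult[OF tendsto_const edist_tendsto_zero[OF x], of "1 + (\<Sum>i<d. \<bar>v i\<bar>)"] by simp
  qed
  then show ?thesis by (simp add: LIM_zero_iff)
qed

text \<open>Caratheodory's form of the derivative: with a slope function continuous at
  \<open>f x\<close>, the increment of the composition is an exact product, and points with f y = f
  x call for no separate treatment.\<close>

lemma has_gradient_compose:
  assumes x: "x \<in> RR d" and f: "has_gradient d f v x" and \<phi>: "(\<phi> has_real_derivative D) (at (f x))"
  shows "has_gradient d (\<lambda>y. \<phi> (f y)) (\<lambda>i. D * v i) x"
proof -
  from \<phi> obtain \<zeta> where \<zeta>: "\<And>z. \<phi> z - \<phi> (f x) = \<zeta> z * (z - f x)" "isCont \<zeta> (f x)" "\<zeta> (f x) = D"
    unfolding CARAT_DERIV by blast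
  have lim: "((\<lambda>y. \<zeta> (f y)) \<longlongrightarrow> D) (at x within RR d)"
    using isCont_tendsto_compose[OF \<zeta>(2) has_gradient_imp_tendsto[OF x f]] by (simp add: \<zeta>(3))
  have A: "((\<lambda>y. D * ((f y - f x - (\<Sum>i<d. v i * (y i - x i))) / edist d y x)) \<longlongrightarrow> D * 0) (at x within RR d)"
    using f unfolding has_gradient_def by (intro tendsto_intros)
  have B: "((\<lambda>y. (\<zeta> (f y) - D) * ((f y - f x) / edist d y x)) \<longlongrightarrow> 0) (at x within RR d)"
  proof (rule Lim_null_comparison)
    let ?L = "1 + (\<Sum>i<d. \<bar>v i\<bar>)"
    show "\<forall>\<^sub>F y in at x within RR d. norm ((\<zeta> (f y) - D) * ((f y - f x) / edist d y x)) \<le> \<bar>\<zeta> (f y) - D\<bar> * ?L"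
      using has_gradient_increment_bounded[OF x f] eventually_edist_pos[OF x]
    proof eventually_elim
      case (elim y)
      then have "\<bar>(f y - f x) / edist d y x\<bar> \<le> ?L" by (simp add: divide_le_eq)
      then show ?case unfolding real_norm_def abs_mult by (intro mult_left_mono) auto
    qed
    have "((\<lambda>y. \<bar>\<zeta> (f y) - D\<bar> * ?L) \<longlongrightarrow> \<bar>D - D\<bar> * ?L) (at x within RR d)"
      by (intro tendsto_intros lim)
    then show "((\<lambda>y. \<bar>\<zeta> (f y) - D\<bar> * ?L) \<longlongrightarrow> 0) (at x within RR d)" by simp
  qed
  have "(\<phi> (f y) - \<phi> (f x) - (\<Sum>i<d. D * v i * (y i - x i))) / edist d y x
      = D * ((f y - f x - (\<Sum>i<d. v i * (y i - x i))) / edist d y x) + (\<zeta> (f y) - D) * ((f y - f x) / edist d y x)" for y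
  proof -
    have "(\<Sum>i<d. D * v i * (y i - x i)) = D * (\<Sum>i<d. v i * (y i - x i))"
      by (simp add: sum_distrib_left mult.assoc)
    then show ?thesis unfolding \<zeta>(1) by (simp add: add_divide_distrib[symmetric] algebra_simps)
  qed
  then show ?thesis using tendsto_add[OF A B] by (simp add: has_gradient_def)
qed

lemma C1_grad_continuous: "C1_grad d f g \<Longrightarrow> continuous_on (RR d) f"
  unfolding C1_grad_def continuous_on_def using has_gradient_imp_tendsto by blast

lemma C1_grad_const: "C1_grad d (\<lambda>_. k) (\<lambda>_ _. 0)"
  by (auto simp: C1_grad_def has_gradient_const)

lemma C1_grad_coordinate: "i < d \<Longrightarrow> C1_grad d (\<lambda>y. y i) (\<lambda>_ j. if j = i then 1 else 0)"
  by (auto simp: C1_grad_def has_gradient_coordinate)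

lemma C1_grad_lincomb:
  assumes "C1_grad d f g" "C1_grad d f' g'"
  shows "C1_grad d (\<lambda>y. f y + t * f' y) (\<lambda>y i. g y i + t * g' y i)"
  using assms by (auto simp: C1_grad_def has_gradient_lincomb intro!: continuous_intros)

lemma C1_grad_add:
  assumes "C1_grad d f g" "C1_grad d f' g'"
  shows "C1_grad d (\<lambda>y. f y + f' y) (\<lambda>y i. g y i + g' y i)"
  using C1_grad_lincomb[OF assms, of 1] by simp

lemma C1_grad_compose:
  assumes f: "C1_grad d f g" and \<phi>: "\<And>u. (\<phi> has_real_derivative \<phi>' u) (at u)" and c: "continuous_on UNIV \<phi>'"
  shows "C1_grad d (\<lambda>y. \<phi> (f y)) (\<lambda>y i. \<phi>' (f y) * g y i)"
  unfolding C1_grad_def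
proof (intro conjI ballI allI impI)
  fix x assume "x \<in> RR d"
  then show "has_gradient d (\<lambda>y. \<phi> (f y)) (\<lambda>i. \<phi>' (f x) * g x i) x"
    using f \<phi> by (intro has_gradient_compose) (auto simp: C1_grad_def)
next
  fix i assume "i < d"
  then show "continuous_on (RR d) (\<lambda>x. \<phi>' (f x) * g x i)"
    using f by (intro continuous_on_mult continuous_on_compose2[OF c C1_grad_continuous[OF f]]) (auto simp: C1_grad_def)
qed

lemma C1_grad_sum:
  assumes "finite I" "\<And>k. k \<in> I \<Longrightarrow> C1_grad d (f k) (g k)"
  shows "C1_grad d (\<lambda>y. \<Sum>k\<in>I. f k y) (\<lambda>y i. \<Sum>k\<in>I. g k y i)"
  using assms by (induction I) (auto simp: C1_grad_const C1_grad_add)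

section \<open>The weight as a Stein kernel\<close>

locale poincare_weight =
  fixes d :: nat and \<mu> :: "rvec measure" and W :: "rvec \<Rightarrow> rmat"
  assumes prob_on: "prob_on_RR d \<mu>"
    and second_moment: "\<And>i. i < d \<Longrightarrow> integrable \<mu> (\<lambda>x. (x i)\<^sup>2)"
    and mean_zero: "\<And>i. i < d \<Longrightarrow> mean \<mu> i = 0"
    and cov_id: "\<And>i j. i < d \<Longrightarrow> j < d \<Longrightarrow> cov \<mu> i j = id_mat i j"
    and adm: "admissible d \<mu> W"
    and poincare: "poincare_const d \<mu> W = 1"
begin

sublocale prob_space \<mu>
  using prob_on by (simp add: prob_on_RR_def)

lemma sets_mu [simp]: "sets \<mu> = sets (borel_RR d)"
  using prob_on by (simp add: prob_on_RR_def)

lemma measurable_mu: "f \<in> borel_RR d \<rightarrow>\<^sub>M N \<Longrightarrow> f \<in> \<mu> \<rightarrow>\<^sub>M N"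
  by (simp add: measurable_cong_sets[OF sets_mu refl])

lemma space_mu: "space \<mu> = RR d"
  using sets_eq_imp_space_eq[OF sets_mu] by (simp add: borel_RR_def RR_def space_PiM)

lemma coordinate_measurable: "i < d \<Longrightarrow> (\<lambda>x. x i) \<in> borel_measurable \<mu>"
  by (rule measurable_mu[OF borel_RR_component])

lemma W_measurable: "i < d \<Longrightarrow> j < d \<Longrightarrow> (\<lambda>x. W x i j) \<in> borel_measurable \<mu>"
  using adm by (intro measurable_mu) (auto simp: admissible_def)

lemma psd_W: "x \<in> RR d \<Longrightarrow> psd d (W x)"
  using adm by (auto simp: admissible_def)

definition quad :: "rvec \<Rightarrow> rvec \<Rightarrow> real" where
  "quad x v = (\<Sum>i<d. \<Sum>j<d. v i * W x i j * v j)"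

lemma quad_nonneg: "x \<in> RR d \<Longrightarrow> 0 \<le> quad x v"
  using psd_W by (auto simp: psd_def quad_def)

lemma W_sym: "x \<in> RR d \<Longrightarrow> i < d \<Longrightarrow> j < d \<Longrightarrow> W x i j = W x j i"
  using psd_W[of x] unfolding psd_def by blast

text \<open>Polarization around the i-th unit vector; symmetry of \<open>W\<close> merges the two
  mixed terms into one row of \<open>W\<close>.\<close>

lemma quad_add_unit:
  assumes x: "x \<in> RR d" and i: "i < d"
  shows "quad x (\<lambda>k. (if k = i then 1 else 0) + t * v k)
    = W x i i + 2 * t * (\<Sum>j<d. W x i j * v j) + t\<^sup>2 * quad x v"
proof -
  let ?e = "\<lambda>k. if k = i then 1 else 0 :: real"
  have d1: "(\<Sum>k<d. ?e k * f k) = f i" for f :: "nat \<Rightarrow> real"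
  proof -
    have "(\<Sum>k<d. ?e k * f k) = (\<Sum>k<d. if k = i then f k else 0)" by (intro sum.cong) auto
    then show ?thesis using i by simp
  qed
  have "quad x (\<lambda>k. ?e k + t * v k)
      = (\<Sum>k<d. \<Sum>j<d. ?e k * (?e j * W x k j)) + (\<Sum>k<d. \<Sum>j<d. ?e k * (t * (W x k j * v j)))
        + (\<Sum>k<d. \<Sum>j<d. ?e j * (t * (v k * W x k j))) + (\<Sum>k<d. \<Sum>j<d. t\<^sup>2 * (v k * W x k j * v j))"
    unfolding quad_def sum.distrib[symmetric]
    by (intro sum.cong refl) (simp add: algebra_simps power2_eq_square)
  also have "(\<Sum>k<d. \<Sum>j<d. ?e k * (?e j * W x k j)) = W x i i"
    by (simp only: sum_distrib_left[symmetric] d1)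
  also have "(\<Sum>k<d. \<Sum>j<d. ?e k * (t * (W x k j * v j))) = t * (\<Sum>j<d. W x i j * v j)"
    by (simp only: sum_distrib_left[symmetric] d1)
  also have "(\<Sum>k<d. \<Sum>j<d. ?e j * (t * (v k * W x k j))) = (\<Sum>k<d. t * (v k * W x k i))"
    by (simp only: d1)
  also have "\<dots> = t * (\<Sum>j<d. W x i j * v j)"
    unfolding sum_distrib_left by (intro sum.cong refl) (auto simp: W_sym[OF x i])
  also have "(\<Sum>k<d. \<Sum>j<d. t\<^sup>2 * (v k * W x k j * v j)) = t\<^sup>2 * quad x v"
    by (simp add: quad_def sum_distrib_left)
  finally show ?thesis by simp
qed

lemma W_diag_nonneg: "x \<in> RR d \<Longrightarrow> i < d \<Longrightarrow> 0 \<le> W x i i"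
  using quad_add_unit[of x i 0 "\<lambda>_. 0"] quad_nonneg[of x "\<lambda>k. if k = i then 1 else 0"] by simp

text \<open>Positivity of the form at e_i + v and at e_i - v. As Cauchy-Schwarz would, it controls
  rows of \<open>W\<close> by integrable quantities, but without square roots.\<close>

lemma abs_W_row_le:
  assumes x: "x \<in> RR d" and i: "i < d"
  shows "\<bar>\<Sum>j<d. W x i j * v j\<bar> \<le> W x i i + quad x v"
proof -
  have "0 \<le> W x i i + 2 * 1 * (\<Sum>j<d. W x i j * v j) + 1\<^sup>2 * quad x v"
    unfolding quad_add_unit[OF x i, of 1 v, symmetric] by (rule quad_nonneg[OF x])
  moreover have "0 \<le> W x i i + 2 * (- 1) * (\<Sum>j<d. W x i j * v j) + (- 1)\<^sup>2 * quad x v"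
    unfolding quad_add_unit[OF x i, of "- 1" v, symmetric] by (rule quad_nonneg[OF x])
  ultimately show ?thesis using quad_nonneg[OF x, of v] W_diag_nonneg[OF x i] by simp
qed

lemma integrable_W_diag: assumes i: "i < d" shows "integrable \<mu> (\<lambda>x. W x i i)"
proof (rule integrableI_nonneg)
  show "(\<lambda>x. W x i i) \<in> borel_measurable \<mu>" by (rule W_measurable[OF i i])
  show "AE x in \<mu>. 0 \<le> W x i i" using W_diag_nonneg i by (intro AE_I2) (auto simp: space_mu)
  have "(\<integral>\<^sup>+x. ennreal (W x i i) \<partial>\<mu>) \<le> (\<integral>\<^sup>+x. ennreal (tr d (W x)) \<partial>\<mu>)"
    unfolding tr_def using i W_diag_nonneg
    by (intro nn_integral_mono ennreal_leI member_le_sum[where f = "\<lambda>i. W _ i i"]) (auto simp: space_mu)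
  also have "\<dots> < \<infinity>" using adm by (simp add: admissible_def)
  finally show "(\<integral>\<^sup>+x. ennreal (W x i i) \<partial>\<mu>) < \<infinity>" .
qed

lemma sum_integral_W_diag: "(\<Sum>i<d. \<integral>x. W x i i \<partial>\<mu>) = real d"
proof -
  have tr_nn: "0 \<le> tr d (W x)" if "x \<in> space \<mu>" for x
    using that W_diag_nonneg by (auto simp: tr_def space_mu intro!: sum_nonneg)
  have ti: "integrable \<mu> (\<lambda>x. tr d (W x))"
    unfolding tr_def by (intro Bochner_Integration.integrable_sum integrable_W_diag) auto
  have "tr d (cov \<mu>) = real d" by (simp add: tr_def cov_id id_mat_def)
  then have "ennreal (\<integral>x. tr d (W x) \<partial>\<mu>) = ennreal (real d)"
    using adm tr_nn nn_integral_eq_integral[OF ti] by (auto simp: admissible_def)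
  then have "(\<integral>x. tr d (W x) \<partial>\<mu>) = real d"
    using tr_nn by (subst (asm) ennreal_inj) (auto intro!: integral_nonneg_AE AE_I2)
  moreover have "(\<integral>x. tr d (W x) \<partial>\<mu>) = (\<Sum>i<d. \<integral>x. W x i i \<partial>\<mu>)"
    unfolding tr_def by (intro Bochner_Integration.integral_sum integrable_W_diag) auto
  ultimately show ?thesis by simp
qed

lemma integrable_of_square:
  fixes f :: "rvec \<Rightarrow> real"
  assumes [measurable]: "f \<in> borel_measurable \<mu>" and f: "integrable \<mu> (\<lambda>x. (f x)\<^sup>2)"
  shows "integrable \<mu> f"
proof (rule Bochner_Integration.integrable_bound)
  show "integrable \<mu> (\<lambda>x. 1 + (f x)\<^sup>2)" using f by simp
  have "\<bar>a\<bar> \<le> 1 + a\<^sup>2" for a :: real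
  proof -
    have "0 \<le> (\<bar>a\<bar> - 1)\<^sup>2" by simp
    then have "2 * \<bar>a\<bar> \<le> a\<^sup>2 + 1" by (simp add: power2_diff)
    then show ?thesis by linarith
  qed
  then show "AE x in \<mu>. norm (f x) \<le> norm (1 + (f x)\<^sup>2)" by (auto simp: abs_of_nonneg)
qed measurable

text \<open>The Poincare constant is an infimum, so the inequality is first available with every
  constant 1 + e; since the energy is finite, e may tend to 0.\<close>

lemma variance_le:
  assumes C: "C1_grad d f g" and [measurable]: "f \<in> borel_measurable \<mu>"
    and f2: "integrable \<mu> (\<lambda>x. (f x)\<^sup>2)" and q: "integrable \<mu> (\<lambda>x. quad x (g x))"
  shows "(\<integral>x. (f x)\<^sup>2 \<partial>\<mu>) - (\<integral>x. f x \<partial>\<mu>)\<^sup>2 \<le> (\<integral>x. quad x (g x) \<partial>\<mu>)"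
proof -
  have f1: "integrable \<mu> f" by (rule integrable_of_square[OF _ f2]) measurable
  define m where "m = (\<integral>x. f x \<partial>\<mu>)"
  have eq: "(f x - m)\<^sup>2 = (f x)\<^sup>2 - 2 * m * f x + m\<^sup>2" for x
    by (simp add: power2_diff mult_ac)
  have vi: "integrable \<mu> (\<lambda>x. (f x - m)\<^sup>2)" unfolding eq using f1 f2 by simp
  have v: "(\<integral>x. (f x - m)\<^sup>2 \<partial>\<mu>) = (\<integral>x. (f x)\<^sup>2 \<partial>\<mu>) - m\<^sup>2"
    unfolding eq using f1 f2 by (simp add: m_def[symmetric] prob_space) (simp add: power2_eq_square)
  have Var: "Var \<mu> f = ennreal ((\<integral>x. (f x)\<^sup>2 \<partial>\<mu>) - m\<^sup>2)"
    unfolding Var_def m_def[symmetric] v[symmetric] by (intro nn_integral_eq_integral vi) auto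
  define E where "E = (\<integral>x. quad x (g x) \<partial>\<mu>)"
  have E0: "E \<ge> 0" unfolding E_def by (intro integral_nonneg_AE AE_I2) (auto simp: space_mu quad_nonneg)
  have En: "energy d \<mu> W g = ennreal E"
    unfolding energy_def E_def quad_def[symmetric]
    by (intro nn_integral_eq_integral q AE_I2) (auto simp: space_mu quad_nonneg)
  have "(\<integral>x. (f x)\<^sup>2 \<partial>\<mu>) - m\<^sup>2 \<le> (1 + e) * E" if e: "e > 0" for e
  proof -
    have "poincare_const d \<mu> W < ennreal (1 + e)" unfolding poincare using e by (simp add: ennreal_less_iff flip: ennreal_1)
    then obtain c where c: "c < ennreal (1 + e)" "\<And>f g. C1_grad d f g \<Longrightarrow> integrable \<mu> (\<lambda>x. (f x)\<^sup>2) \<Longrightarrow>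
        energy d \<mu> W g < \<infinity> \<Longrightarrow> Var \<mu> f \<le> c * energy d \<mu> W g"
      unfolding poincare_const_def Inf_less_iff by blast
    have "Var \<mu> f \<le> c * energy d \<mu> W g" by (rule c(2)[OF C f2]) (simp add: En)
    also have "\<dots> \<le> ennreal (1 + e) * ennreal E" unfolding En using c(1) by (intro mult_right_mono) auto
    also have "\<dots> = ennreal ((1 + e) * E)" using e E0 by (simp add: ennreal_mult)
    finally show ?thesis unfolding Var using e E0 by (subst (asm) ennreal_le_iff) auto
  qed
  note b = this
  have "((\<lambda>e. (1 + e) * E) \<longlongrightarrow> (1 + 0) * E) (at_right 0)" by (intro tendsto_intros)
  moreover have "\<forall>\<^sub>F e in at_right (0::real). (\<integral>x. (f x)\<^sup>2 \<partial>\<mu>) - m\<^sup>2 \<le> (1 + e) * E"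
    using eventually_at_right_less[of 0] by eventually_elim (rule b)
  ultimately have "(\<integral>x. (f x)\<^sup>2 \<partial>\<mu>) - m\<^sup>2 \<le> (1 + 0) * E"
    by (intro tendsto_lowerbound[where F = "at_right (0::real)"]) auto
  then show ?thesis by (simp add: m_def E_def)
qed

lemma integral_coordinate: "i < d \<Longrightarrow> (\<integral>x. x i \<partial>\<mu>) = 0"
  using mean_zero by (simp add: mean_def)

lemma integral_coordinate_mult: "i < d \<Longrightarrow> j < d \<Longrightarrow> (\<integral>x. x i * x j \<partial>\<mu>) = id_mat i j"
  using cov_id[of i j] mean_zero by (simp add: cov_def)

text \<open>The Poincare inequality for x_i + t h, with both sides expanded in powers of
  \<open>t\<close>; the 1 on the left is the variance of x_i.\<close>

lemma first_variation_inequality: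
  assumes i: "i < d" and C: "C1_grad d h g" and hm[measurable]: "h \<in> borel_measurable \<mu>"
    and gm: "\<And>j. j < d \<Longrightarrow> (\<lambda>x. g x j) \<in> borel_measurable \<mu>"
    and h2: "integrable \<mu> (\<lambda>x. (h x)\<^sup>2)" and q: "integrable \<mu> (\<lambda>x. quad x (g x))"
  shows "1 + 2 * t * (\<integral>x. x i * h x \<partial>\<mu>) + t\<^sup>2 * ((\<integral>x. (h x)\<^sup>2 \<partial>\<mu>) - (\<integral>x. h x \<partial>\<mu>)\<^sup>2)
    \<le> (\<integral>x. W x i i \<partial>\<mu>) + 2 * t * (\<integral>x. (\<Sum>j<d. W x i j * g x j) \<partial>\<mu>) + t\<^sup>2 * (\<integral>x. quad x (g x) \<partial>\<mu>)"
proof -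
  note [measurable] = coordinate_measurable[OF i]
  let ?f = "\<lambda>x. x i + t * h x"
  let ?g = "\<lambda>x k. (if k = i then 1 else 0) + t * g x k"
  have xi: "integrable \<mu> (\<lambda>x. x i)"
    by (rule integrable_of_square[OF _ second_moment[OF i]]) measurable
  have hi: "integrable \<mu> h" by (rule integrable_of_square[OF _ h2]) measurable
  have xh: "integrable \<mu> (\<lambda>x. x i * h x)"
  proof (rule Bochner_Integration.integrable_bound)
    show "integrable \<mu> (\<lambda>x. (x i)\<^sup>2 + (h x)\<^sup>2)" using h2 second_moment[OF i] by simp
    have "\<bar>a * b\<bar> \<le> a\<^sup>2 + b\<^sup>2" for a b :: real
    proof -
      have "0 \<le> (\<bar>a\<bar> - \<bar>b\<bar>)\<^sup>2" by simp
      then have "2 * \<bar>a * b\<bar> \<le> a\<^sup>2 + b\<^sup>2" by (simp add: power2_diff abs_mult)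
      then show ?thesis by linarith
    qed
    then show "AE x in \<mu>. norm (x i * h x) \<le> norm ((x i)\<^sup>2 + (h x)\<^sup>2)" by (auto simp: abs_of_nonneg)
  qed measurable
  have f2eq: "(?f x)\<^sup>2 = (x i)\<^sup>2 + 2 * t * (x i * h x) + t\<^sup>2 * (h x)\<^sup>2" for x
    by (simp add: power2_sum power_mult_distrib)
  have f2: "integrable \<mu> (\<lambda>x. (?f x)\<^sup>2)" unfolding f2eq using second_moment[OF i] xh h2 by simp
  have wg: "integrable \<mu> (\<lambda>x. \<Sum>j<d. W x i j * g x j)"
  proof (rule Bochner_Integration.integrable_bound)
    show "integrable \<mu> (\<lambda>x. W x i i + quad x (g x))" using integrable_W_diag[OF i] q by simp
    show "AE x in \<mu>. norm (\<Sum>j<d. W x i j * g x j) \<le> norm (W x i i + quad x (g x))"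
      using abs_W_row_le[OF _ i]
      by (intro AE_I2) (auto simp: space_mu intro: order_trans[OF _ abs_ge_self])
    show "(\<lambda>x. \<Sum>j<d. W x i j * g x j) \<in> borel_measurable \<mu>"
      using W_measurable i gm by (intro borel_measurable_sum borel_measurable_times) auto
  qed
  have qeq: "quad x (?g x) = W x i i + 2 * t * (\<Sum>j<d. W x i j * g x j) + t\<^sup>2 * quad x (g x)" if "x \<in> space \<mu>" for x
    using quad_add_unit[of x i t "g x"] that i by (simp add: space_mu)
  have qi: "integrable \<mu> (\<lambda>x. quad x (?g x))"
    using integrable_W_diag[OF i] wg q by (subst Bochner_Integration.integrable_cong[OF refl qeq]) auto
  have fm: "?f \<in> borel_measurable \<mu>" by measurable
  have le: "(\<integral>x. (?f x)\<^sup>2 \<partial>\<mu>) - (\<integral>x. ?f x \<partial>\<mu>)\<^sup>2 \<le> (\<integral>x. quad x (?g x) \<partial>\<mu>)"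
    by (rule variance_le[OF C1_grad_lincomb[OF C1_grad_coordinate[OF i] C] fm f2 qi])
  have 1: "(\<integral>x. (?f x)\<^sup>2 \<partial>\<mu>) = 1 + 2 * t * (\<integral>x. x i * h x \<partial>\<mu>) + t\<^sup>2 * (\<integral>x. (h x)\<^sup>2 \<partial>\<mu>)"
    unfolding f2eq using second_moment[OF i] xh h2 integral_coordinate_mult[OF i i]
    by (simp add: id_mat_def power2_eq_square)
  have 2: "(\<integral>x. ?f x \<partial>\<mu>) = t * (\<integral>x. h x \<partial>\<mu>)"
    using xi hi integral_coordinate[OF i] by simp
  have 3: "(\<integral>x. quad x (?g x) \<partial>\<mu>)
      = (\<integral>x. W x i i \<partial>\<mu>) + 2 * t * (\<integral>x. (\<Sum>j<d. W x i j * g x j) \<partial>\<mu>) + t\<^sup>2 * (\<integral>x. quad x (g x) \<partial>\<mu>)"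
    using integrable_W_diag[OF i] wg q by (subst Bochner_Integration.integral_cong[OF refl qeq]) auto
  show ?thesis using le unfolding 1 2 3 by (simp add: power_mult_distrib algebra_simps)
qed

text \<open>Taking h = 0 gives E[W_kk] >= 1 for every k, and the trace constraint makes these means
  sum to d. All of them therefore equal 1, so every coordinate attains equality.\<close>

lemma integral_W_diag: assumes i: "i < d" shows "(\<integral>x. W x i i \<partial>\<mu>) = 1"
proof -
  have ge: "1 \<le> (\<integral>x. W x k k \<partial>\<mu>)" if "k < d" for k
    using first_variation_inequality[OF that C1_grad_const, of 0 0] by (simp add: quad_def)
  have "(\<Sum>k<d. (\<integral>x. W x k k \<partial>\<mu>) - 1) = 0"
    by (simp add: sum_subtractf sum_integral_W_diag)
  then have "(\<integral>x. W x i i \<partial>\<mu>) - 1 = 0"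
    using ge i by (subst (asm) sum_nonneg_eq_0_iff) auto
  then show ?thesis by simp
qed

text \<open>Coordinates saturate the Poincare inequality, so the first variation around them vanishes:
  \<open>W\<close> is a Stein kernel.\<close>

lemma stein_identity:
  assumes i: "i < d" and C: "C1_grad d h g" and h: "h \<in> borel_measurable \<mu>"
    and gm: "\<And>j. j < d \<Longrightarrow> (\<lambda>x. g x j) \<in> borel_measurable \<mu>"
    and h2: "integrable \<mu> (\<lambda>x. (h x)\<^sup>2)" and q: "integrable \<mu> (\<lambda>x. quad x (g x))"
  shows "(\<integral>x. x i * h x \<partial>\<mu>) = (\<integral>x. (\<Sum>j<d. W x i j * g x j) \<partial>\<mu>)"
proof -
  define A where "A = (\<integral>x. x i * h x \<partial>\<mu>) - (\<integral>x. (\<Sum>j<d. W x i j * g x j) \<partial>\<mu>)"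
  define B where "B = (\<integral>x. quad x (g x) \<partial>\<mu>) - ((\<integral>x. (h x)\<^sup>2 \<partial>\<mu>) - (\<integral>x. h x \<partial>\<mu>)\<^sup>2)"
  have *: "2 * t * A \<le> t\<^sup>2 * B" for t
    using first_variation_inequality[OF assms, of t] by (simp add: integral_W_diag[OF i] A_def B_def algebra_simps)
  have "A = 0"
  proof (rule ccontr)
    assume "A \<noteq> 0"
    define K where "K = \<bar>B\<bar> + 1"
    have K: "K > 0" "B \<le> K" by (auto simp: K_def)
    \<comment> \<open>For A different from 0, 2 t A <= t^2 K fails for small t of the sign of A; t =
      A / K is an explicit such choice.\<close>
    have "2 * (A / K) * A \<le> (A / K)\<^sup>2 * K"
      using *[of "A / K"] mult_left_mono[OF K(2), of "(A / K)\<^sup>2"] by simp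
    then have "2 * A\<^sup>2 / K \<le> A\<^sup>2 / K" using K by (simp add: power2_eq_square)
    then have "A\<^sup>2 \<le> 0" using K by (simp add: divide_le_cancel)
    then show False using \<open>A \<noteq> 0\<close> by simp
  qed
  then show ?thesis by (simp add: A_def)
qed

lemma quad_scaled_unit:
  assumes x: "x \<in> RR d" and k: "k < d"
  shows "quad x (\<lambda>j. a * (if j = k then 1 else 0)) = a\<^sup>2 * W x k k"
proof -
  have "quad x (\<lambda>j. a * (if j = k then 1 else 0)) = a\<^sup>2 * quad x (\<lambda>j. if j = k then 1 else 0)"
    unfolding quad_def sum_distrib_left by (intro sum.cong refl) (simp add: power2_eq_square)
  then show ?thesis using quad_add_unit[OF x k, of 0] by simp
qed

text \<open>The Stein identity for h = x_k. It makes W - I centred, which the average over N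
  summands needs in order to gain sqrt N.\<close>

lemma integral_W:
  assumes i: "i < d" and k: "k < d"
  shows "(\<integral>x. W x i k \<partial>\<mu>) = id_mat i k"
proof -
  have q: "integrable \<mu> (\<lambda>x. quad x (\<lambda>j. if j = k then 1 else 0))"
    using integrable_W_diag[OF k] quad_scaled_unit[OF _ k, of _ 1]
    by (subst Bochner_Integration.integrable_cong[OF refl, of _ _ "\<lambda>x. W x k k"]) (auto simp: space_mu)
  have "(\<integral>x. x i * x k \<partial>\<mu>) = (\<integral>x. (\<Sum>j<d. W x i j * (if j = k then 1 else 0)) \<partial>\<mu>)"
    by (rule stein_identity[OF i C1_grad_coordinate[OF k] coordinate_measurable[OF k] _ second_moment[OF k] q]) simp
  moreover have "(\<Sum>j<d. W x i j * (if j = k then 1 else 0)) = W x i k" for x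
  proof -
    have "(\<Sum>j<d. W x i j * (if j = k then 1 else 0)) = (\<Sum>j<d. if j = k then W x i j else 0)"
      by (intro sum.cong) auto
    then show ?thesis using k by simp
  qed
  ultimately show ?thesis using integral_coordinate_mult[OF i k] by simp
qed

end

subsection \<open>Gaussian test functions and moments\<close>

lemma C1_grad_cong:
  assumes "C1_grad d f g" "\<And>x i. i < d \<Longrightarrow> g x i = g' x i"
  shows "C1_grad d f g'"
proof -
  have "has_gradient d f (g x) x = has_gradient d f (g' x) x" for x
    unfolding has_gradient_def using assms(2) by simp
  then show ?thesis using assms by (auto simp: C1_grad_def)
qed

text \<open>The Gaussian density as a function of its mean a y, written as an exponential of a sum
  of squares so that sums and the chain rule with one-variable outer functions suffice.\<close>

lemma C1_grad_gauss_density: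
  assumes s: "s > 0"
  shows "C1_grad d (\<lambda>y. gauss_density d s (\<lambda>j. a * y j) x)
    (\<lambda>y j. a / s\<^sup>2 * (x j - a * y j) * gauss_density d s (\<lambda>j. a * y j) x)"
proof -
  define K where "K = (1 / sqrt (2 * pi * s\<^sup>2)) ^ d"
  define f where "f y = (\<Sum>k<d. (x k - a * y k)\<^sup>2)" for y :: rvec
  have "C1_grad d (\<lambda>y. (x k - a * y k)\<^sup>2) (\<lambda>y j. - 2 * a * (x k - a * y k) * (if j = k then 1 else 0))" if "k < d" for k
    by (rule C1_grad_compose[OF C1_grad_coordinate[OF that], of "\<lambda>u. (x k - a * u)\<^sup>2" "\<lambda>u. - 2 * a * (x k - a * u)"])
      (auto intro!: derivative_eq_intros continuous_intros simp: algebra_simps)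
  then have "C1_grad d f (\<lambda>y j. \<Sum>k<d. - 2 * a * (x k - a * y k) * (if j = k then 1 else 0))"
    unfolding f_def by (intro C1_grad_sum) auto
  moreover have "((\<lambda>u. K * exp (- u / (2 * s\<^sup>2))) has_real_derivative - K / (2 * s\<^sup>2) * exp (- u / (2 * s\<^sup>2))) (at u)" for u
    using s by (auto intro!: derivative_eq_intros simp: field_simps power2_eq_square power4_eq_xxxx)
  moreover have "continuous_on UNIV (\<lambda>u. - K / (2 * s\<^sup>2) * exp (- u / (2 * s\<^sup>2)))"
    using s by (intro continuous_intros) auto
  ultimately have "C1_grad d (\<lambda>y. K * exp (- f y / (2 * s\<^sup>2)))
      (\<lambda>y j. - K / (2 * s\<^sup>2) * exp (- f y / (2 * s\<^sup>2)) * (\<Sum>k<d. - 2 * a * (x k - a * y k) * (if j = k then 1 else 0)))"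
    by (rule C1_grad_compose)
  then have "C1_grad d (\<lambda>y. K * exp (- f y / (2 * s\<^sup>2)))
      (\<lambda>y j. a / s\<^sup>2 * (x j - a * y j) * (K * exp (- f y / (2 * s\<^sup>2))))"
  proof (rule C1_grad_cong)
    fix y j assume j: "j < d"
    have "(\<Sum>k<d. - 2 * a * (x k - a * y k) * (if j = k then 1 else 0)) = (\<Sum>k<d. if j = k then - 2 * a * (x k - a * y k) else 0)"
      by (intro sum.cong) auto
    also have "\<dots> = - 2 * a * (x j - a * y j)" using j by simp
    finally have sum: "(\<Sum>k<d. - 2 * a * (x k - a * y k) * (if j = k then 1 else 0)) = - 2 * a * (x j - a * y j)" .
    show "- K / (2 * s\<^sup>2) * exp (- f y / (2 * s\<^sup>2)) * (\<Sum>k<d. - 2 * a * (x k - a * y k) * (if j = k then 1 else 0))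
      = a / s\<^sup>2 * (x j - a * y j) * (K * exp (- f y / (2 * s\<^sup>2)))" unfolding sum by simp
  qed
  moreover have "(\<lambda>y. gauss_density d s (\<lambda>j. a * y j) x) = (\<lambda>y. K * exp (- f y / (2 * s\<^sup>2)))"
    by (simp add: gauss_density_eq_exp K_def f_def)
  ultimately show ?thesis by (simp only: fun_eq_iff)
qed

lemma borel_measurable_gauss_density:
  assumes "\<And>j. j < d \<Longrightarrow> (\<lambda>y. f y j) \<in> borel_measurable M"
  shows "(\<lambda>y. gauss_density d s (f y) x) \<in> borel_measurable M"
  unfolding gauss_density_def normal_density_def using assms by (intro borel_measurable_prod) simp

context poincare_weight
begin

lemma abs_W_le:
  assumes x: "x \<in> RR d" and i: "i < d" and j: "j < d"
  shows "\<bar>W x i j\<bar> \<le> W x i i + W x j j"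
proof -
  have "(\<Sum>k<d. W x i k * (if k = j then 1 else 0)) = (\<Sum>k<d. if k = j then W x i k else 0)"
    by (intro sum.cong) auto
  then have "(\<Sum>k<d. W x i k * (if k = j then 1 else 0)) = W x i j" using j by simp
  then show ?thesis
    using abs_W_row_le[OF x i, of "\<lambda>k. if k = j then 1 else 0"] quad_scaled_unit[OF x j, of 1] by simp
qed

lemma integrable_W: assumes "i < d" "j < d" shows "integrable \<mu> (\<lambda>x. W x i j)"
proof (rule Bochner_Integration.integrable_bound)
  show "integrable \<mu> (\<lambda>x. W x i i + W x j j)" using assms integrable_W_diag by simp
  show "AE x in \<mu>. norm (W x i j) \<le> norm (W x i i + W x j j)"
    using abs_W_le assms by (intro AE_I2) (auto simp: space_mu intro: order_trans[OF _ abs_ge_self])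
qed (rule W_measurable[OF assms])

lemma integrable_quad_bounded:
  assumes gm: "\<And>j. j < d \<Longrightarrow> (\<lambda>x. g x j) \<in> borel_measurable \<mu>"
    and B: "\<And>x j. j < d \<Longrightarrow> \<bar>g x j\<bar> \<le> B"
  shows "integrable \<mu> (\<lambda>x. quad x (g x))"
  unfolding quad_def
proof (intro Bochner_Integration.integrable_sum)
  fix i j assume "i \<in> {..<d}" "j \<in> {..<d}"
  then have ij: "i < d" "j < d" by auto
  show "integrable \<mu> (\<lambda>x. g x i * W x i j * g x j)"
  proof (rule Bochner_Integration.integrable_bound)
    show "integrable \<mu> (\<lambda>x. B * W x i j * B)" using integrable_W[OF ij] by simp
    show "AE x in \<mu>. norm (g x i * W x i j * g x j) \<le> norm (B * W x i j * B)"
    proof (rule AE_I2)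
      fix x
      have "\<bar>g x i\<bar> \<le> \<bar>B\<bar>" "\<bar>g x j\<bar> \<le> \<bar>B\<bar>" using B[of i x] B[of j x] ij by linarith+
      then show "norm (g x i * W x i j * g x j) \<le> norm (B * W x i j * B)"
        unfolding real_norm_def abs_mult by (intro mult_mono) auto
    qed
    show "(\<lambda>x. g x i * W x i j * g x j) \<in> borel_measurable \<mu>"
      using gm ij W_measurable by simp
  qed
qed

text \<open>Gaussian weights and their gradients are bounded, so they are admissible test functions
  with no moments of the measure beyond the second.\<close>

lemma stein_gauss:
  assumes i: "i < d" and s: "s > 0"
  shows "s\<^sup>2 * (\<integral>y. y i * gauss_density d s (\<lambda>j. a * y j) x \<partial>\<mu>)
    = a * (\<integral>y. (\<Sum>j<d. W y i j * (x j - a * y j)) * gauss_density d s (\<lambda>j. a * y j) x \<partial>\<mu>)"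
proof -
  define K where "K = (1 / sqrt (2 * pi * s\<^sup>2)) ^ d"
  let ?G = "\<lambda>y. gauss_density d s (\<lambda>j. a * y j) x"
  let ?g = "\<lambda>y j. a / s\<^sup>2 * (x j - a * y j) * ?G y"
  have Gm: "?G \<in> borel_measurable \<mu>"
    using coordinate_measurable by (intro borel_measurable_gauss_density) simp
  have gm: "(\<lambda>y. ?g y j) \<in> borel_measurable \<mu>" if "j < d" for j
    using Gm coordinate_measurable[OF that] by simp
  have G2: "integrable \<mu> (\<lambda>y. (?G y)\<^sup>2)"
  proof (rule integrable_const_bound)
    show "AE y in \<mu>. norm ((?G y)\<^sup>2) \<le> K\<^sup>2"
      using gauss_density_le[of d s] by (intro AE_I2) (simp add: K_def power_mono)
  qed (use Gm in simp)
  have gb: "\<bar>?g y j\<bar> \<le> \<bar>a\<bar> / s * K" if "j < d" for y j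
  proof -
    have "\<bar>?g y j\<bar> = \<bar>a\<bar> / s * (?G y * \<bar>(x j - a * y j) / s\<bar>)"
      using s by (simp add: abs_mult power2_eq_square)
    also have "\<dots> \<le> \<bar>a\<bar> / s * K"
      unfolding K_def using s gauss_density_residual_le[OF s that, of "\<lambda>j. a * y j" x] by (intro mult_left_mono) auto
    finally show ?thesis .
  qed
  have "(\<integral>y. y i * ?G y \<partial>\<mu>) = (\<integral>y. (\<Sum>j<d. W y i j * ?g y j) \<partial>\<mu>)"
    by (rule stein_identity[OF i C1_grad_gauss_density[OF s] Gm gm G2 integrable_quad_bounded[OF gm gb]])
  also have "\<dots> = (\<integral>y. a / s\<^sup>2 * ((\<Sum>j<d. W y i j * (x j - a * y j)) * ?G y) \<partial>\<mu>)"
    by (intro Bochner_Integration.integral_cong refl) (simp add: sum_distrib_left sum_distrib_right mult_ac)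
  also have "\<dots> = a / s\<^sup>2 * (\<integral>y. (\<Sum>j<d. W y i j * (x j - a * y j)) * ?G y \<partial>\<mu>)"
    by simp
  finally show ?thesis using s by simp
qed

end

section \<open>Moments of the coordinates from moments of the weight\<close>

text \<open>The test function u (1 + u^2)^b would yield moments of order 2 b + 2, but their
  finiteness is what is to be shown. Replacing 1 + u^2 by \<open>r\<close>, which is at most 1/e,
  keeps the derivative bounded, and its bound by (1 + 2 b) r^b does not degrade as e tends to
  0.\<close>

lemma truncated_power:
  fixes e b :: real
  assumes e: "0 < e" "e \<le> 1" and b: "b \<ge> 0"
  defines "r \<equiv> \<lambda>u. (1 + u\<^sup>2) / (1 + e * u\<^sup>2)"
  defines "\<phi>' \<equiv> \<lambda>u. r u powr b + u * (b * r u powr (b - 1) * (2 * u * (1 - e) / (1 + e * u\<^sup>2)\<^sup>2))"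
  shows "1 \<le> r u" "r u \<le> 1 / e" "r u \<le> 1 + u\<^sup>2"
    and "((\<lambda>u. u * r u powr b) has_real_derivative \<phi>' u) (at u)"
    and "continuous_on UNIV \<phi>'"
    and "0 \<le> \<phi>' u" "\<phi>' u \<le> (1 + 2 * b) * r u powr b"
proof -
  have den: "1 + e * u\<^sup>2 > 0" for u using e by (simp add: add_pos_nonneg)
  have eu: "e * u\<^sup>2 \<le> u\<^sup>2" for u using e by (intro mult_left_le_one_le) auto
  have r1: "1 \<le> r u" for u unfolding r_def using den[of u] eu[of u] by (simp add: le_divide_eq)
  then show "1 \<le> r u" .
  have "(1 + u\<^sup>2) * e \<le> 1 + e * u\<^sup>2" using e by (simp add: algebra_simps)
  then show "r u \<le> 1 / e" unfolding r_def using den[of u] e by (simp add: divide_simps)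
  show "r u \<le> 1 + u\<^sup>2" unfolding r_def using den[of u] e by (simp add: divide_le_eq mult_left_mono algebra_simps)
  have rpos: "r u > 0" for u using r1[of u] by linarith
  have rd: "(r has_real_derivative 2 * u * (1 - e) / (1 + e * u\<^sup>2)\<^sup>2) (at u)" for u
  proof -
    have "((\<lambda>u. 1 + u\<^sup>2) has_real_derivative 2 * u) (at u)" "((\<lambda>u. 1 + e * u\<^sup>2) has_real_derivative 2 * e * u) (at u)"
      by (auto intro!: derivative_eq_intros)
    from DERIV_divide[OF this] den[of u]
    have "(r has_real_derivative (2 * u * (1 + e * u\<^sup>2) - (1 + u\<^sup>2) * (2 * e * u)) / ((1 + e * u\<^sup>2) * (1 + e * u\<^sup>2))) (at u)"
      by (simp add: r_def[abs_def])
    moreover have "2 * u * (1 + e * u\<^sup>2) - (1 + u\<^sup>2) * (2 * e * u) = 2 * u * (1 - e)"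
      by (simp add: algebra_simps)
    ultimately show ?thesis by (simp add: power2_eq_square)
  qed
  have "((\<lambda>u. r u powr b) has_real_derivative b * r u powr (b - 1) * (2 * u * (1 - e) / (1 + e * u\<^sup>2)\<^sup>2)) (at u)"
    using DERIV_fun_powr[OF rd[of u] rpos[of u], of b] by simp
  from DERIV_mult[OF DERIV_ident this]
  show "((\<lambda>u. u * r u powr b) has_real_derivative \<phi>' u) (at u)"
    unfolding \<phi>'_def by (simp add: add.commute mult.commute)
  have ne: "1 + e * u\<^sup>2 \<noteq> 0" "(1 + e * u\<^sup>2)\<^sup>2 \<noteq> 0" "r u \<noteq> 0" for u
    using den[of u] rpos[of u] by auto
  have cr: "continuous_on UNIV (\<lambda>u. r u)" unfolding r_def by (intro continuous_intros ballI ne)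
  show "continuous_on UNIV \<phi>'"
    unfolding \<phi>'_def by (intro continuous_intros cr ballI ne)
  \<comment> \<open>\<open>k\<close> is u r'(u) / r(u), so that the derivative is r^b (1 + b k);
    both bounds on it follow from 0 <= k <= 2.\<close>
  define k where "k = 2 * u\<^sup>2 * (1 - e) / ((1 + e * u\<^sup>2) * (1 + u\<^sup>2))"
  have one: "1 + u\<^sup>2 > 0" by (simp add: add_pos_nonneg)
  have k0: "k \<ge> 0" unfolding k_def using e den[of u] by (intro divide_nonneg_nonneg mult_nonneg_nonneg) auto
  have k2: "k \<le> 2"
  proof -
    have "u\<^sup>2 * (1 - e) \<le> 1 * (1 + u\<^sup>2)" using e by (simp add: algebra_simps add_increasing)
    also have "\<dots> \<le> (1 + e * u\<^sup>2) * (1 + u\<^sup>2)" using e by (intro mult_right_mono) auto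
    finally show ?thesis unfolding k_def using den[of u] one by (simp add: divide_le_eq)
  qed
  have eq: "\<phi>' u = r u powr b * (1 + b * k)"
  proof -
    have "u * (2 * u * (1 - e) / (1 + e * u\<^sup>2)\<^sup>2) = k * r u"
      unfolding k_def r_def using den[of u] one by (simp add: power2_eq_square)
    moreover have "r u powr b = r u powr (b - 1) * r u" using rpos[of u] by (simp add: powr_diff)
    moreover have "u * (b * r u powr (b - 1) * (2 * u * (1 - e) / (1 + e * u\<^sup>2)\<^sup>2))
        = b * r u powr (b - 1) * (u * (2 * u * (1 - e) / (1 + e * u\<^sup>2)\<^sup>2))"
      by (simp only: mult_ac)
    ultimately have "u * (b * r u powr (b - 1) * (2 * u * (1 - e) / (1 + e * u\<^sup>2)\<^sup>2)) = b * k * r u powr b"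
      by (simp only: mult_ac)
    then show ?thesis unfolding \<phi>'_def by (simp add: algebra_simps)
  qed
  show "0 \<le> \<phi>' u" unfolding eq using b k0 by simp
  have "b * k \<le> b * 2" using b k2 by (intro mult_left_mono)
  then have "r u powr b * (1 + b * k) \<le> r u powr b * (1 + 2 * b)" by (intro mult_left_mono) auto
  then show "\<phi>' u \<le> (1 + 2 * b) * r u powr b" unfolding eq by (simp add: mult.commute)
qed

text \<open>A Young inequality obtained by comparing \<open>w\<close> with r / 2; the coefficient
  1/2 of the first term is what later allows absorption.\<close>

lemma mult_powr_le_add:
  fixes w r b :: real
  assumes "w \<ge> 0" "r \<ge> 1" "b \<ge> 0"
  shows "w * r powr b \<le> r powr (b + 1) / 2 + (2 * w) powr (b + 1)"
proof (cases "w \<le> r / 2")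
  case True
  then have "w * r powr b \<le> r / 2 * r powr b" by (intro mult_right_mono) auto
  also have "\<dots> = r powr (b + 1) / 2" using assms by (simp add: powr_add)
  finally show ?thesis by (simp add: add_increasing2)
next
  case False
  then have "w * r powr b \<le> (2 * w) * (2 * w) powr b"
    using assms by (intro mult_mono powr_mono2) auto
  also have "\<dots> = (2 * w) powr (b + 1)" using assms False by (simp add: powr_add)
  finally show ?thesis using assms by (simp add: add_increasing)
qed

context poincare_weight
begin

text \<open>The Stein identity for the truncated power bounds E[x_i^2 r^b] by (p - 1) E[W_ii r^b],
  and Young's inequality leaves at most half of the quantity to be estimated on the right. Thanks to
  the truncation that quantity is finite and can be moved to the left; the resulting bound does not
  involve \<open>e\<close>.\<close>

lemma truncated_moment_le:
  assumes p: "p \<ge> 2" and i: "i < d" and W: "integrable \<mu> (\<lambda>x. (2 * ((p - 1) * W x i i)) powr (p / 2))"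
    and e: "0 < e" "e \<le> 1"
  defines "r \<equiv> \<lambda>u. (1 + u\<^sup>2) / (1 + e * u\<^sup>2)"
  shows "integrable \<mu> (\<lambda>x. (1 + (x i)\<^sup>2) * r (x i) powr (p / 2 - 1))"
    and "(\<integral>x. (1 + (x i)\<^sup>2) * r (x i) powr (p / 2 - 1) \<partial>\<mu>)
      \<le> 4 * (4 powr (p / 2 - 1) + (\<integral>x. (2 * ((p - 1) * W x i i)) powr (p / 2) \<partial>\<mu>))"
proof -
  define b where "b = p / 2 - 1"
  have b: "b \<ge> 0" using p by (simp add: b_def)
  define \<phi>' where "\<phi>' u = r u powr b + u * (b * r u powr (b - 1) * (2 * u * (1 - e) / (1 + e * u\<^sup>2)\<^sup>2))" for u
  have r_eq: "(1 + u\<^sup>2) / (1 + e * u\<^sup>2) = r u" for u by (simp add: r_def)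
  note tp = truncated_power[OF e b, unfolded r_eq, folded \<phi>'_def]
  note [measurable] = coordinate_measurable[OF i] W_measurable[OF i i]
  have rm[measurable]: "r \<in> borel_measurable borel" unfolding r_def by measurable
  have pm[measurable]: "\<phi>' \<in> borel_measurable borel" unfolding \<phi>'_def by measurable
  define B where "B = (1 / e) powr b"
  have rb: "r u powr b \<le> B" "0 \<le> r u powr b" for u
    using tp(1,2)[of u] b unfolding B_def by (auto intro!: powr_mono2)
  have B0: "B \<ge> 0" by (simp add: B_def)
  note sm = second_moment[OF i]
  have i0: "integrable \<mu> (\<lambda>x. r (x i) powr b)"
    by (rule integrable_const_bound[where B = B]) (use rb in auto)
  have i1: "integrable \<mu> (\<lambda>x. (x i)\<^sup>2 * r (x i) powr b)"
  proof (rule Bochner_Integration.integrable_bound)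
    show "integrable \<mu> (\<lambda>x. (x i)\<^sup>2 * B)" using sm by simp
    show "AE x in \<mu>. norm ((x i)\<^sup>2 * r (x i) powr b) \<le> norm ((x i)\<^sup>2 * B)"
      using rb B0 by (intro AE_I2) (auto simp: abs_mult intro!: mult_left_mono)
  qed measurable
  have iG: "integrable \<mu> (\<lambda>x. (1 + (x i)\<^sup>2) * r (x i) powr b)"
    unfolding distrib_right using i0 i1 by simp
  then show "integrable \<mu> (\<lambda>x. (1 + (x i)\<^sup>2) * r (x i) powr (p / 2 - 1))" by (simp add: b_def)
  have h2: "integrable \<mu> (\<lambda>x. (x i * r (x i) powr b)\<^sup>2)"
  proof (rule Bochner_Integration.integrable_bound)
    show "integrable \<mu> (\<lambda>x. (x i)\<^sup>2 * B\<^sup>2)" using sm by simp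
    show "AE x in \<mu>. norm ((x i * r (x i) powr b)\<^sup>2) \<le> norm ((x i)\<^sup>2 * B\<^sup>2)"
      using rb B0 by (intro AE_I2) (auto simp: power_mult_distrib intro!: mult_left_mono power_mono)
  qed measurable
  have \<phi>b: "\<bar>\<phi>' u\<bar> \<le> (1 + 2 * b) * B" for u
  proof -
    have "\<phi>' u \<le> (1 + 2 * b) * r u powr b" by (rule tp(7))
    also have "\<dots> \<le> (1 + 2 * b) * B" using rb b by (intro mult_left_mono) auto
    finally show ?thesis using tp(6)[of u] by simp
  qed
  have C: "C1_grad d (\<lambda>x. x i * r (x i) powr b) (\<lambda>x j. \<phi>' (x i) * (if j = i then 1 else 0))"
    by (rule C1_grad_compose[OF C1_grad_coordinate[OF i] tp(4,5)])
  have q: "integrable \<mu> (\<lambda>x. quad x (\<lambda>j. \<phi>' (x i) * (if j = i then 1 else 0)))"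
    by (rule integrable_quad_bounded[where B = "(1 + 2 * b) * B"]) (use \<phi>b b B0 in auto)
  have "(\<integral>x. x i * (x i * r (x i) powr b) \<partial>\<mu>) = (\<integral>x. (\<Sum>j<d. W x i j * (\<phi>' (x i) * (if j = i then 1 else 0))) \<partial>\<mu>)"
    by (rule stein_identity[OF i C _ _ h2 q]) measurable
  also have "\<dots> = (\<integral>x. W x i i * \<phi>' (x i) \<partial>\<mu>)"
  proof (intro Bochner_Integration.integral_cong refl)
    fix x
    have "(\<Sum>j<d. W x i j * (\<phi>' (x i) * (if j = i then 1 else 0))) = (\<Sum>j<d. if j = i then W x i j * \<phi>' (x i) else 0)"
      by (intro sum.cong) auto
    then show "(\<Sum>j<d. W x i j * (\<phi>' (x i) * (if j = i then 1 else 0))) = W x i i * \<phi>' (x i)" using i by simp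
  qed
  finally have st: "(\<integral>x. (x i)\<^sup>2 * r (x i) powr b \<partial>\<mu>) = (\<integral>x. W x i i * \<phi>' (x i) \<partial>\<mu>)"
    by (simp add: power2_eq_square mult.assoc)
  define M where "M = (\<integral>x. (2 * ((p - 1) * W x i i)) powr (p / 2) \<partial>\<mu>)"
  define G where "G = (\<integral>x. (1 + (x i)\<^sup>2) * r (x i) powr b \<partial>\<mu>)"
  have "(\<integral>x. W x i i * \<phi>' (x i) \<partial>\<mu>)
      \<le> (\<integral>x. ((1 + (x i)\<^sup>2) * r (x i) powr b) / 2 + (2 * ((p - 1) * W x i i)) powr (p / 2) \<partial>\<mu>)"
  proof (rule integral_mono)
    show "integrable \<mu> (\<lambda>x. W x i i * \<phi>' (x i))"
    proof (rule Bochner_Integration.integrable_bound)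
      show "integrable \<mu> (\<lambda>x. W x i i * ((1 + 2 * b) * B))" using integrable_W_diag[OF i] by simp
      show "AE x in \<mu>. norm (W x i i * \<phi>' (x i)) \<le> norm (W x i i * ((1 + 2 * b) * B))"
        unfolding real_norm_def abs_mult[of "W _ i i"]
        using \<phi>b by (intro AE_I2 mult_left_mono) (auto intro: order_trans[OF _ abs_ge_self])
    qed measurable
    show "integrable \<mu> (\<lambda>x. ((1 + (x i)\<^sup>2) * r (x i) powr b) / 2 + (2 * ((p - 1) * W x i i)) powr (p / 2))"
      using iG W by simp
    fix x assume "x \<in> space \<mu>"
    then have w: "0 \<le> W x i i" using W_diag_nonneg i by (simp add: space_mu)
    have "W x i i * \<phi>' (x i) \<le> W x i i * ((1 + 2 * b) * r (x i) powr b)"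
      using w tp(7) by (intro mult_left_mono)
    also have "\<dots> = ((p - 1) * W x i i) * r (x i) powr b" by (simp add: b_def)
    also have "\<dots> \<le> r (x i) powr (b + 1) / 2 + (2 * ((p - 1) * W x i i)) powr (b + 1)"
      using w p tp(1) b by (intro mult_powr_le_add) auto
    also have "r (x i) powr (b + 1) / 2 \<le> ((1 + (x i)\<^sup>2) * r (x i) powr b) / 2"
    proof -
      have "r (x i) powr (b + 1) = r (x i) * r (x i) powr b" using tp(1)[of "x i"] by (simp add: powr_add)
      also have "\<dots> \<le> (1 + (x i)\<^sup>2) * r (x i) powr b" using tp(3) by (intro mult_right_mono) auto
      finally show ?thesis by simp
    qed
    finally show "W x i i * \<phi>' (x i) \<le> ((1 + (x i)\<^sup>2) * r (x i) powr b) / 2 + (2 * ((p - 1) * W x i i)) powr (p / 2)"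
      by (simp add: b_def)
  qed
  also have "\<dots> = G / 2 + M" using iG W by (simp add: G_def M_def)
  finally have 1: "(\<integral>x. (x i)\<^sup>2 * r (x i) powr b \<partial>\<mu>) \<le> G / 2 + M" unfolding st .
  \<comment> \<open>The term without x_i^2 is absorbed as well: where 1 + x_i^2 > 4 it is at most a
    quarter of the whole, and elsewhere \<open>r\<close> is at most 4.\<close>
  have "(\<integral>x. r (x i) powr b \<partial>\<mu>) \<le> (\<integral>x. ((1 + (x i)\<^sup>2) * r (x i) powr b) / 4 + 4 powr b \<partial>\<mu>)"
  proof (rule integral_mono)
    fix x
    show "r (x i) powr b \<le> ((1 + (x i)\<^sup>2) * r (x i) powr b) / 4 + 4 powr b"
    proof (cases "1 + (x i)\<^sup>2 \<le> 4")
      case True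
      then have "r (x i) \<le> 4" using tp(3)[of "x i"] by linarith
      then have "r (x i) powr b \<le> 4 powr b" using tp(1)[of "x i"] b by (intro powr_mono2) auto
      then show ?thesis by (simp add: add_increasing)
    next
      case False
      then have "4 * r (x i) powr b \<le> (1 + (x i)\<^sup>2) * r (x i) powr b" by (intro mult_right_mono) auto
      then show ?thesis by (simp add: add_increasing2)
    qed
  qed (use i0 iG in auto)
  also have "\<dots> = G / 4 + 4 powr b" using iG by (simp add: G_def prob_space)
  finally have 2: "(\<integral>x. r (x i) powr b \<partial>\<mu>) \<le> G / 4 + 4 powr b" .
  have "G = (\<integral>x. r (x i) powr b \<partial>\<mu>) + (\<integral>x. (x i)\<^sup>2 * r (x i) powr b \<partial>\<mu>)"
    unfolding G_def distrib_right using i0 i1 by simp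
  \<comment> \<open>Altogether G <= G/2 + G/4 + M + 4^b, hence the factor 4.\<close>
  then have "G \<le> 4 * (4 powr b + M)" using 1 2 by (simp add: field_simps)
  then show "(\<integral>x. (1 + (x i)\<^sup>2) * r (x i) powr (p / 2 - 1) \<partial>\<mu>)
      \<le> 4 * (4 powr (p / 2 - 1) + (\<integral>x. (2 * ((p - 1) * W x i i)) powr (p / 2) \<partial>\<mu>))"
    by (simp add: G_def M_def b_def)
qed

text \<open>The truncation is removed by Fatou's lemma along e = 1 / (n + 1). Integrability of order
  p of the coordinates is thus inherited from the weight.\<close>

lemma in_Lp_coordinate:
  assumes p: "p \<ge> 2" and i: "i < d" and WL: "in_Lp p \<mu> (\<lambda>x. W x i i - id_mat i i)"
  shows "in_Lp p \<mu> (\<lambda>x. x i)"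
proof -
  have p0: "p > 0" using p by simp
  note [measurable] = coordinate_measurable[OF i] W_measurable[OF i i]
  have "in_Lp p \<mu> (\<lambda>x. (W x i i - id_mat i i) + id_mat i i * 1)"
    by (intro in_Lp_add WL in_Lp_cmult in_Lp_one p0)
  then have WL': "in_Lp p \<mu> (\<lambda>x. 2 * (p - 1) * W x i i)"
    using in_Lp_cmult[OF _ p0, of \<mu> "\<lambda>x. W x i i" "2 * (p - 1)"] by simp
  have Wi: "integrable \<mu> (\<lambda>x. (2 * ((p - 1) * W x i i)) powr (p / 2))"
  proof (rule Bochner_Integration.integrable_bound)
    show "integrable \<mu> (\<lambda>x. 1 + \<bar>2 * (p - 1) * W x i i\<bar> powr p)" using WL' by (simp add: in_Lp_def)
    have "a powr (p / 2) \<le> 1 + \<bar>a\<bar> powr p" if "a \<ge> 0" for a :: real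
    proof (cases "a \<le> 1")
      case True
      then have "a powr (p / 2) \<le> 1" using p that by (intro powr_le1) auto
      then show ?thesis by (simp add: add_increasing2)
    next
      case False
      then have "a powr (p / 2) \<le> a powr p" using p by (intro powr_mono) auto
      then show ?thesis using that by simp
    qed
    note bound = this
    show "AE x in \<mu>. norm ((2 * ((p - 1) * W x i i)) powr (p / 2)) \<le> norm (1 + \<bar>2 * (p - 1) * W x i i\<bar> powr p)"
    proof (rule AE_I2)
      fix x assume "x \<in> space \<mu>"
      then have "0 \<le> 2 * ((p - 1) * W x i i)" using W_diag_nonneg[OF _ i] p by (simp add: space_mu)
      from bound[OF this] show "norm ((2 * ((p - 1) * W x i i)) powr (p / 2)) \<le> norm (1 + \<bar>2 * (p - 1) * W x i i\<bar> powr p)"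
        unfolding real_norm_def mult.assoc by (simp only: abs_of_nonneg[OF powr_ge_zero] order_trans[OF _ abs_ge_self])
    qed
  qed measurable
  define r where "r n u = (1 + u\<^sup>2) / (1 + (1 / real (Suc n)) * u\<^sup>2)" for n and u :: real
  define D where "D = 4 * (4 powr (p / 2 - 1) + (\<integral>x. (2 * ((p - 1) * W x i i)) powr (p / 2) \<partial>\<mu>))"
  have tm: "integrable \<mu> (\<lambda>x. (1 + (x i)\<^sup>2) * r n (x i) powr (p / 2 - 1))"
    "(\<integral>x. (1 + (x i)\<^sup>2) * r n (x i) powr (p / 2 - 1) \<partial>\<mu>) \<le> D" for n
    unfolding r_def D_def by (intro truncated_moment_le p i Wi; simp)+
  have lim: "(\<lambda>n. (1 + u\<^sup>2) * r n u powr (p / 2 - 1)) \<longlonglongrightarrow> (1 + u\<^sup>2) * (1 + u\<^sup>2) powr (p / 2 - 1)" for u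
  proof -
    have pos: "1 + u\<^sup>2 > 0" by (simp add: add_pos_nonneg)
    have "(\<lambda>n. r n u) \<longlonglongrightarrow> (1 + u\<^sup>2) / (1 + 0 * u\<^sup>2)"
      unfolding r_def using LIMSEQ_inverse_real_of_nat by (intro tendsto_intros) (auto simp: inverse_eq_divide)
    then have "(\<lambda>n. r n u) \<longlonglongrightarrow> 1 + u\<^sup>2" by simp
    then show ?thesis using pos by (intro tendsto_intros) auto
  qed
  have "(\<integral>\<^sup>+x. ennreal (\<bar>x i\<bar> powr p) \<partial>\<mu>)
      \<le> (\<integral>\<^sup>+x. liminf (\<lambda>n. ennreal ((1 + (x i)\<^sup>2) * r n (x i) powr (p / 2 - 1))) \<partial>\<mu>)"
  proof (rule nn_integral_mono)
    fix x
    have "(\<lambda>n. ennreal ((1 + (x i)\<^sup>2) * r n (x i) powr (p / 2 - 1))) \<longlonglongrightarrow> ennreal ((1 + (x i)\<^sup>2) * (1 + (x i)\<^sup>2) powr (p / 2 - 1))"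
      by (rule tendsto_ennrealI[OF lim])
    then have l: "liminf (\<lambda>n. ennreal ((1 + (x i)\<^sup>2) * r n (x i) powr (p / 2 - 1))) = ennreal ((1 + (x i)\<^sup>2) * (1 + (x i)\<^sup>2) powr (p / 2 - 1))"
      by (rule lim_imp_Liminf[OF sequentially_bot])
    have "\<bar>x i\<bar> powr p = ((x i)\<^sup>2) powr (p / 2)" using square_powr_half[of "\<bar>x i\<bar>" p] by simp
    also have "\<dots> \<le> (1 + (x i)\<^sup>2) powr (p / 2)" using p by (intro powr_mono2) auto
    also have "\<dots> = (1 + (x i)\<^sup>2) * (1 + (x i)\<^sup>2) powr (p / 2 - 1)"
      using add_pos_nonneg[of 1 "(x i)\<^sup>2"] by (simp add: powr_diff)
    finally show "ennreal (\<bar>x i\<bar> powr p) \<le> liminf (\<lambda>n. ennreal ((1 + (x i)\<^sup>2) * r n (x i) powr (p / 2 - 1)))"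
      unfolding l by (rule ennreal_leI)
  qed
  also have "\<dots> \<le> liminf (\<lambda>n. \<integral>\<^sup>+x. ennreal ((1 + (x i)\<^sup>2) * r n (x i) powr (p / 2 - 1)) \<partial>\<mu>)"
    unfolding r_def by (intro nn_integral_liminf) measurable
  also have "\<dots> \<le> ennreal D"
  proof (rule Liminf_le[OF sequentially_bot always_eventually], rule allI)
    fix n
    have "(\<integral>\<^sup>+x. ennreal ((1 + (x i)\<^sup>2) * r n (x i) powr (p / 2 - 1)) \<partial>\<mu>)
        = ennreal (\<integral>x. (1 + (x i)\<^sup>2) * r n (x i) powr (p / 2 - 1) \<partial>\<mu>)"
      by (intro nn_integral_eq_integral tm) auto
    then show "(\<integral>\<^sup>+x. ennreal ((1 + (x i)\<^sup>2) * r n (x i) powr (p / 2 - 1)) \<partial>\<mu>) \<le> ennreal D"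
      using tm(2)[of n] by (simp add: ennreal_leI)
  qed
  finally have "(\<integral>\<^sup>+x. ennreal (\<bar>x i\<bar> powr p) \<partial>\<mu>) < \<infinity>"
    by (rule le_less_trans) simp
  then show ?thesis unfolding in_Lp_def by (intro conjI integrableI_nonneg) auto
qed

end

subsection \<open>Normalized sums\<close>

lemma integrable_mult_bounded:
  fixes f g :: "'a \<Rightarrow> real"
  assumes f: "integrable M f" and g: "g \<in> borel_measurable M" and B: "\<And>x. \<bar>g x\<bar> \<le> B"
  shows "integrable M (\<lambda>x. f x * g x)"
proof (rule Bochner_Integration.integrable_bound)
  show "integrable M (\<lambda>x. f x * B)" using f by simp
  show "AE x in M. norm (f x * g x) \<le> norm (f x * B)"
    unfolding real_norm_def abs_mult using B
    by (intro AE_I2 mult_left_mono) (auto intro: order_trans[OF _ abs_ge_self])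
qed (use f g in simp)

lemma gauss_density_shift:
  "gauss_density d s (\<lambda>j. m j + r j) x = gauss_density d s r (\<lambda>j. x j - m j)"
  by (simp add: gauss_density_eq_exp algebra_simps)

text \<open>\<open>W_Lp\<close> is finiteness of the right side of the theorem, entry by
  entry.\<close>

locale stein_sum = poincare_weight d \<mu> W for d \<mu> W +
  fixes p :: real and N :: nat
  assumes p_ge: "p \<ge> 2" and N_pos: "N > 0"
    and W_Lp: "\<And>i j. i < d \<Longrightarrow> j < d \<Longrightarrow> in_Lp p \<mu> (\<lambda>x. W x i j - id_mat i j)"
begin

definition PN :: "(nat \<Rightarrow> rvec) measure" where
  "PN = PiM {..<N} (\<lambda>_. \<mu>)"

definition SN :: "nat \<Rightarrow> (nat \<Rightarrow> rvec) \<Rightarrow> real" where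
  "SN i \<omega> = (\<Sum>k<N. \<omega> k i) / sqrt (real N)"

definition TN :: "nat \<Rightarrow> nat \<Rightarrow> (nat \<Rightarrow> rvec) \<Rightarrow> real" where
  "TN i j \<omega> = (\<Sum>k<N. W (\<omega> k) i j) / real N"

sublocale PN: prob_space PN
  unfolding PN_def by (intro prob_space_PiM prob_space_axioms)

lemma p_pos: "p > 0" "p \<ge> 1" using p_ge by auto

lemma component_measurable: "k < N \<Longrightarrow> (\<lambda>\<omega>. \<omega> k) \<in> PN \<rightarrow>\<^sub>M \<mu>"
  unfolding PN_def by (intro measurable_component_singleton) auto

lemma distr_component: "k < N \<Longrightarrow> distr PN \<mu> (\<lambda>\<omega>. \<omega> k) = \<mu>"
  unfolding PN_def by (intro distr_PiM_component prob_space_axioms) auto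

lemma
  assumes k: "k < N" and f: "in_Lp p \<mu> f"
  shows in_Lp_component: "in_Lp p PN (\<lambda>\<omega>. f (\<omega> k))"
    and Lp_norm_component: "Lp_norm p PN (\<lambda>\<omega>. f (\<omega> k)) = Lp_norm p \<mu> f"
  using in_Lp_distr[OF component_measurable[OF k] in_Lp_measurable[OF f], of p] f
  by (simp_all add: distr_component[OF k])

lemma integral_component:
  fixes f :: "rvec \<Rightarrow> real"
  assumes "k < N" "f \<in> borel_measurable \<mu>" shows "(\<integral>\<omega>. f (\<omega> k) \<partial>PN) = (\<integral>x. f x \<partial>\<mu>)"
  using integral_distr[OF component_measurable[OF assms(1)] assms(2)] by (simp add: distr_component[OF assms(1)])

lemma X_Lp: "i < d \<Longrightarrow> in_Lp p \<mu> (\<lambda>x. x i)"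
  by (rule in_Lp_coordinate[OF p_ge _ W_Lp])

lemma W_Lp': assumes "i < d" "j < d" shows "in_Lp p \<mu> (\<lambda>x. W x i j)"
proof -
  have "in_Lp p \<mu> (\<lambda>x. (W x i j - id_mat i j) + id_mat i j * 1)"
    by (intro in_Lp_add W_Lp assms in_Lp_cmult in_Lp_one p_pos)
  then show ?thesis by simp
qed

lemma SN_Lp: "i < d \<Longrightarrow> in_Lp p PN (SN i)"
  unfolding SN_def[abs_def] by (intro in_Lp_divide in_Lp_sum in_Lp_component[of _ "\<lambda>x. x i"] X_Lp p_pos) auto

lemma TN_Lp: "i < d \<Longrightarrow> j < d \<Longrightarrow> in_Lp p PN (TN i j)"
  unfolding TN_def[abs_def] by (intro in_Lp_divide in_Lp_sum in_Lp_component[of _ "\<lambda>x. W x i j"] W_Lp' p_pos) auto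

text \<open>Conditionally on the other summands, a Gaussian function of the sum is a Gaussian function
  of the \<open>k\<close>-th summand, so the one-variable identity applies.\<close>

lemma stein_component:
  fixes c s :: real and x :: rvec
  assumes i: "i < d" and s: "s > 0" and k: "k < N"
  defines "G \<equiv> \<lambda>\<omega>. gauss_density d s (\<lambda>j. c * SN j \<omega>) x"
  shows "integrable PN (\<lambda>\<omega>. \<omega> k i * G \<omega>)"
    and "integrable PN (\<lambda>\<omega>. (\<Sum>j<d. W (\<omega> k) i j * (x j - c * SN j \<omega>)) * G \<omega>)"
    and "s\<^sup>2 * (\<integral>\<omega>. \<omega> k i * G \<omega> \<partial>PN)
      = c / sqrt (real N) * (\<integral>\<omega>. (\<Sum>j<d. W (\<omega> k) i j * (x j - c * SN j \<omega>)) * G \<omega> \<partial>PN)"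
proof -
  define K where "K = (1 / sqrt (2 * pi * s\<^sup>2)) ^ d"
  \<comment> \<open>The coefficient with which a single summand enters c S.\<close>
  define a where "a = c / sqrt (real N)"
  have SNm: "SN j \<in> borel_measurable PN" if "j < d" for j
    using SN_Lp[OF that] by (simp add: in_Lp_def)
  have Gm: "G \<in> borel_measurable PN"
    unfolding G_def using SNm by (intro borel_measurable_gauss_density) simp
  have gle: "\<bar>gauss_density d s m y\<bar> \<le> K" for m y
    using gauss_density_le[of d s m y] by (simp add: K_def)
  have gre: "\<bar>(y j - m j) * gauss_density d s m y\<bar> \<le> s * K" if "j < d" for m y j
  proof -
    have "\<bar>(y j - m j) * gauss_density d s m y\<bar> = s * (gauss_density d s m y * \<bar>(y j - m j) / s\<bar>)"
      using s by (simp add: abs_mult)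
    also have "\<dots> \<le> s * K" unfolding K_def using s gauss_density_residual_le[OF s that] by (intro mult_left_mono) auto
    finally show ?thesis .
  qed
  show i1: "integrable PN (\<lambda>\<omega>. \<omega> k i * G \<omega>)"
    unfolding G_def
    by (rule integrable_mult_bounded[OF in_Lp_imp_integrable[OF PN.finite_measure_axioms in_Lp_component[OF k X_Lp[OF i]] p_pos(2)]
          Gm[unfolded G_def] gle])
  have i2j: "integrable PN (\<lambda>\<omega>. W (\<omega> k) i j * ((x j - c * SN j \<omega>) * G \<omega>))" if j: "j < d" for j
    unfolding G_def
    by (rule integrable_mult_bounded[OF in_Lp_imp_integrable[OF PN.finite_measure_axioms in_Lp_component[OF k W_Lp'[OF i j]] p_pos(2)]
          _ gre[OF j]]) (use Gm[unfolded G_def] SNm[OF j] in simp)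
  show i2: "integrable PN (\<lambda>\<omega>. (\<Sum>j<d. W (\<omega> k) i j * (x j - c * SN j \<omega>)) * G \<omega>)"
    unfolding sum_distrib_right mult.assoc using i2j by (intro Bochner_Integration.integrable_sum) auto
  interpret pp: product_prob_space "\<lambda>_::nat. \<mu>" by (intro product_prob_spaceI prob_space_axioms)
  define I where "I = {..<N} - {k}"
  have ins: "{..<N} = insert k I" and I: "finite I" "k \<notin> I" using k by (auto simp: I_def)
  define H where "H \<omega> = s\<^sup>2 * (\<omega> k i * G \<omega>) - a * ((\<Sum>j<d. W (\<omega> k) i j * (x j - c * SN j \<omega>)) * G \<omega>)" for \<omega>
  have Hi: "integrable PN H" unfolding H_def using i1 i2 by simp
  then have "(\<integral>\<omega>. H \<omega> \<partial>PN) = (\<integral>\<omega>. (\<integral>y. H (fun_upd \<omega> k y) \<partial>\<mu>) \<partial>PiM I (\<lambda>_. \<mu>))"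
    unfolding PN_def ins by (intro pp.product_integral_insert I) auto
  also have "\<dots> = (\<integral>\<omega>. 0 \<partial>PiM I (\<lambda>_. \<mu>))"
  proof (rule Bochner_Integration.integral_cong[OF refl])
    fix \<omega> :: "nat \<Rightarrow> rvec"
    define R where "R j = (\<Sum>l\<in>I. \<omega> l j)" for j
    \<comment> \<open>The contribution of the other summands is shifted into the target point, which
      turns the weight into that of one summand with coefficient \<open>a\<close>.\<close>
    define x' where "x' j = x j - a * R j" for j
    let ?g = "\<lambda>y. gauss_density d s (\<lambda>j. a * y j) x'"
    have SNu: "c * SN j (fun_upd \<omega> k y) = a * R j + a * y j" for j y
    proof -
      have "(\<Sum>l<N. (fun_upd \<omega> k y) l j) = (fun_upd \<omega> k y) k j + (\<Sum>l\<in>I. (fun_upd \<omega> k y) l j)"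
        unfolding ins by (rule sum.insert[OF I])
      also have "(\<Sum>l\<in>I. (fun_upd \<omega> k y) l j) = R j"
        unfolding R_def using I(2) by (intro sum.cong refl) auto
      finally have "(\<Sum>l<N. (fun_upd \<omega> k y) l j) = y j + R j" by simp
      then show ?thesis by (simp add: SN_def a_def add_divide_distrib distrib_left add.commute)
    qed
    have Gu: "G (fun_upd \<omega> k y) = ?g y" for y
      unfolding G_def SNu gauss_density_shift x'_def by simp
    have Hu: "H (fun_upd \<omega> k y) = s\<^sup>2 * (y i * ?g y) - a * ((\<Sum>j<d. W y i j * (x' j - a * y j)) * ?g y)" for y
      unfolding H_def Gu SNu by (simp add: x'_def diff_diff_eq)
    have gm: "?g \<in> borel_measurable \<mu>"
      using coordinate_measurable by (intro borel_measurable_gauss_density) simp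
    have j1: "integrable \<mu> (\<lambda>y. y i * ?g y)"
      by (rule integrable_mult_bounded[OF in_Lp_imp_integrable[OF finite_measure_axioms X_Lp[OF i] p_pos(2)] gm gle])
    have j2j: "integrable \<mu> (\<lambda>y. W y i j * ((x' j - a * y j) * ?g y))" if j: "j < d" for j
      by (rule integrable_mult_bounded[OF integrable_W[OF i j] _ gre[OF j]])
        (use gm coordinate_measurable[OF j] in simp)
    have j2: "integrable \<mu> (\<lambda>y. (\<Sum>j<d. W y i j * (x' j - a * y j)) * ?g y)"
      unfolding sum_distrib_right mult.assoc using j2j by (intro Bochner_Integration.integrable_sum) auto
    show "(\<integral>y. H (fun_upd \<omega> k y) \<partial>\<mu>) = 0"
      unfolding Hu using j1 j2 stein_gauss[OF i s, of a x'] by simp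
  qed
  finally have "(\<integral>\<omega>. H \<omega> \<partial>PN) = 0" by simp
  then show "s\<^sup>2 * (\<integral>\<omega>. \<omega> k i * G \<omega> \<partial>PN)
      = c / sqrt (real N) * (\<integral>\<omega>. (\<Sum>j<d. W (\<omega> k) i j * (x j - c * SN j \<omega>)) * G \<omega> \<partial>PN)"
    unfolding H_def using i1 i2 by (simp add: a_def)
qed

text \<open>Each summand contributes its identity with a factor 1/sqrt N; the 1/sqrt N in the
  definition of S supplies another, and their product 1/N turns the sum of the W(X_k) into
  \<open>TN\<close>.\<close>

sublocale stein_pair PN d SN TN p
proof unfold_locales
  show "p \<ge> 2" by (rule p_ge)
  fix i assume i: "i < d"
  show "in_Lp p PN (SN i)" by (rule SN_Lp[OF i])
  show "in_Lp p PN (TN i j)" if "j < d" for j by (rule TN_Lp[OF i that])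
  fix x :: rvec and c s :: real assume s: "s > 0"
  let ?G = "\<lambda>\<omega>. gauss_density d s (\<lambda>j. c * SN j \<omega>) x"
  let ?V = "\<lambda>k \<omega>. (\<Sum>j<d. W (\<omega> k) i j * (x j - c * SN j \<omega>)) * ?G \<omega>"
  note sc = stein_component[OF i s, where c = c and x = x]
  have n: "sqrt (real N) * sqrt (real N) = real N" by simp
  have "s\<^sup>2 * PN.expectation (\<lambda>\<omega>. SN i \<omega> * ?G \<omega>) = s\<^sup>2 * (\<integral>\<omega>. (\<Sum>k<N. \<omega> k i * ?G \<omega>) / sqrt (real N) \<partial>PN)"
    by (simp add: SN_def sum_distrib_right)
  also have "\<dots> = (\<Sum>k<N. s\<^sup>2 * (\<integral>\<omega>. \<omega> k i * ?G \<omega> \<partial>PN)) / sqrt (real N)"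
    using sc(1) by (simp add: Bochner_Integration.integral_sum sum_distrib_left)
  also have "\<dots> = (\<Sum>k<N. c / sqrt (real N) * (\<integral>\<omega>. ?V k \<omega> \<partial>PN)) / sqrt (real N)"
    using sc(3) by simp
  also have "\<dots> = c * ((\<Sum>k<N. \<integral>\<omega>. ?V k \<omega> \<partial>PN) / real N)"
    unfolding sum_distrib_left[symmetric] using n by (simp add: field_simps)
  also have "(\<Sum>k<N. \<integral>\<omega>. ?V k \<omega> \<partial>PN) / real N = (\<integral>\<omega>. (\<Sum>k<N. ?V k \<omega>) / real N \<partial>PN)"
    using sc(2) by (simp add: Bochner_Integration.integral_sum)
  also have "\<dots> = PN.expectation (\<lambda>\<omega>. (\<Sum>j<d. TN i j \<omega> * (x j - c * SN j \<omega>)) * ?G \<omega>)"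
  proof (intro Bochner_Integration.integral_cong refl)
    fix \<omega>
    have "(\<Sum>k<N. \<Sum>j<d. W (\<omega> k) i j * (x j - c * SN j \<omega>)) = (\<Sum>j<d. \<Sum>k<N. W (\<omega> k) i j * (x j - c * SN j \<omega>))"
      by (rule sum.swap)
    also have "\<dots> = (\<Sum>j<d. (real N * TN i j \<omega>) * (x j - c * SN j \<omega>))"
      using N_pos by (simp add: TN_def sum_distrib_right)
    also have "\<dots> = real N * (\<Sum>j<d. TN i j \<omega> * (x j - c * SN j \<omega>))"
      by (simp only: sum_distrib_left mult.assoc)
    finally show "(\<Sum>k<N. ?V k \<omega>) / real N = (\<Sum>j<d. TN i j \<omega> * (x j - c * SN j \<omega>)) * ?G \<omega>"
      using N_pos by (simp add: sum_distrib_right[symmetric])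
  qed
  finally show "s\<^sup>2 * PN.expectation (\<lambda>\<omega>. SN i \<omega> * ?G \<omega>)
      = c * PN.expectation (\<lambda>\<omega>. (\<Sum>j<d. TN i j \<omega> * (x j - c * SN j \<omega>)) * ?G \<omega>)" .
qed

text \<open>T_ij - I_ij is a sum of N independent centred terms of norm L / N; adding squares gives
  N (L / N)^2 = L^2 / N up to the constant, which is the source of 1/sqrt N in the theorem.\<close>

lemma integral_TN_le:
  assumes i: "i < d" and j: "j < d"
  shows "(\<integral>\<omega>. \<bar>TN i j \<omega> - id_mat i j\<bar> powr p \<partial>PN)
    \<le> (orth_const p / real N) powr (p / 2) * (\<integral>x. \<bar>W x i j - id_mat i j\<bar> powr p \<partial>\<mu>)"
proof -
  define f where "f x = (W x i j - id_mat i j) / real N" for x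
  have fL: "in_Lp p \<mu> f" unfolding f_def using W_Lp[OF i j] by (intro in_Lp_divide p_pos)
  then have fm: "f \<in> borel_measurable \<mu>" by (simp add: in_Lp_def)
  have f0: "(\<integral>x. f x \<partial>\<mu>) = 0"
    unfolding f_def using integrable_W[OF i j] integral_W[OF i j] by (simp add: prob_space)
  have fN: "Lp_norm p \<mu> f = Lp_norm p \<mu> (\<lambda>x. W x i j - id_mat i j) / real N"
    using Lp_norm_cmult[OF W_Lp[OF i j] p_pos(1), of "1 / real N"] by (simp add: f_def[abs_def])
  have "PN.indep_vars (\<lambda>_. \<mu>) (\<lambda>k \<omega>. \<omega> k) {..<N}"
    unfolding PN_def using N_pos by (intro indep_vars_PiM_coordinates prob_space_axioms) auto
  then have iv: "PN.indep_vars (\<lambda>_. borel) (\<lambda>k \<omega>. f (\<omega> k)) {..<N}"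
    by (rule PN.indep_vars_compose2) (rule fm)
  define L where "L = Lp_norm p \<mu> (\<lambda>x. W x i j - id_mat i j)"
  have "(Lp_norm p PN (\<lambda>\<omega>. \<Sum>k<N. f (\<omega> k)))\<^sup>2 \<le> orth_const p * (\<Sum>k<N. (Lp_norm p PN (\<lambda>\<omega>. f (\<omega> k)))\<^sup>2)"
    by (intro PN.Lp_norm_indep_sum p_ge iv in_Lp_component fL) (auto simp: integral_component fm f0)
  also have "\<dots> = orth_const p * (real N * (L / real N)\<^sup>2)"
    by (simp add: Lp_norm_component[OF _ fL] fN L_def)
  also have "\<dots> = orth_const p / real N * L\<^sup>2"
    using N_pos by (simp add: power_divide power2_eq_square)
  finally have "((Lp_norm p PN (\<lambda>\<omega>. \<Sum>k<N. f (\<omega> k)))\<^sup>2) powr (p / 2) \<le> (orth_const p / real N * L\<^sup>2) powr (p / 2)"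
    using p_pos by (intro powr_mono2) auto
  also have "\<dots> = (orth_const p / real N) powr (p / 2) * L powr p"
    unfolding powr_mult by (simp add: square_powr_half L_def)
  also have "L powr p = (\<integral>x. \<bar>W x i j - id_mat i j\<bar> powr p \<partial>\<mu>)"
    using p_pos by (simp add: L_def Lp_norm_powr)
  also have "((Lp_norm p PN (\<lambda>\<omega>. \<Sum>k<N. f (\<omega> k)))\<^sup>2) powr (p / 2) = (\<integral>\<omega>. \<bar>\<Sum>k<N. f (\<omega> k)\<bar> powr p \<partial>PN)"
    using p_pos by (simp add: square_powr_half Lp_norm_powr)
  also have "(\<lambda>\<omega>. \<Sum>k<N. f (\<omega> k)) = (\<lambda>\<omega>. TN i j \<omega> - id_mat i j)"
    using N_pos by (simp add: f_def TN_def sum_divide_distrib[symmetric] sum_subtractf diff_divide_distrib)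
  then have "(\<integral>\<omega>. \<bar>\<Sum>k<N. f (\<omega> k)\<bar> powr p \<partial>PN) = (\<integral>\<omega>. \<bar>TN i j \<omega> - id_mat i j\<bar> powr p \<partial>PN)"
    by (simp add: fun_eq_iff)
  finally show ?thesis .
qed

lemma source_law_eq: "source_law = normalized_sum_law d N \<mu>"
  unfolding source_law_def unfolding normalized_sum_law_def PN_def normalized_sum_def[abs_def] SN_def ..

lemma wasserstein_normalized_sum_le:
  "wasserstein p d (normalized_sum_law d N \<mu>) (std_gaussian d)
    \<le> ennreal ((2 powr p * (orth_const p * (normal_norm p)\<^sup>2) powr (p / 2) * real d powr (p - 2)
        * ((orth_const p / real N) powr (p / 2) * (\<Sum>i<d. \<Sum>j<d. \<integral>x. \<bar>W x i j - id_mat i j\<bar> powr p \<partial>\<mu>))) powr (1 / p))"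
proof -
  have "(\<Sum>i<d. \<Sum>j<d. \<integral>\<omega>. \<bar>TN i j \<omega> - id_mat i j\<bar> powr p \<partial>PN)
      \<le> (orth_const p / real N) powr (p / 2) * (\<Sum>i<d. \<Sum>j<d. \<integral>x. \<bar>W x i j - id_mat i j\<bar> powr p \<partial>\<mu>)"
    unfolding sum_distrib_left by (intro sum_mono integral_TN_le) auto
  then show ?thesis
    unfolding source_law_eq[symmetric] using p_pos
    by (intro order_trans[OF wasserstein_le_kernel] ennreal_leI powr_mono2 mult_left_mono)
      (auto intro!: mult_nonneg_nonneg sum_nonneg integral_nonneg_AE)
qed

end

section \<open>Collecting the constant, and the case of an infinite right-hand side\<close>

theorem corollary2:
  fixes p :: real
  assumes "p \<ge> 2"
  shows "\<exists>C>0. \<forall>(d::nat) (N::nat) (\<mu> :: rvec measure) (W :: rvec \<Rightarrow> rmat).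
    d \<ge> 1 \<longrightarrow> N \<ge> 1 \<longrightarrow>
    prob_on_RR d \<mu> \<longrightarrow>
    (\<forall>i<d. integrable \<mu> (\<lambda>x. (x i)\<^sup>2)) \<longrightarrow>
    (\<forall>i<d. mean \<mu> i = 0) \<longrightarrow>
    (\<forall>i<d. \<forall>j<d. cov \<mu> i j = id_mat i j) \<longrightarrow>
    optimal_weight d \<mu> W \<longrightarrow>
    poincare_const d \<mu> W = 1 \<longrightarrow>
    wasserstein p d (normalized_sum_law d N \<mu>) (std_gaussian d)
      \<le> ennreal (C * real d powr (1 - 2 / p) / sqrt (real N)) *
         epowr (\<integral>\<^sup>+x. ennreal (mat_norm_pow p d (\<lambda>i j. W x i j - id_mat i j)) \<partial>\<mu>) (1 / p)"
proof -
  define A where "A = 2 powr p * (orth_const p * (normal_norm p)\<^sup>2) powr (p / 2)"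
  \<comment> \<open>The summand 1 makes \<open>C\<close> positive without a separate look at the
    Gaussian norm.\<close>
  define C where "C = A powr (1 / p) * sqrt (orth_const p) + 1"
  have p0: "p > 0" using assms by simp
  have A0: "A \<ge> 0" by (simp add: A_def)
  have K0: "orth_const p > 0" by (rule orth_const_pos[OF assms])
  have C0: "C > 0" unfolding C_def using K0 by (intro add_nonneg_pos) auto
  show ?thesis
  proof (intro exI[of _ C] conjI C0 allI impI)
    fix d N :: nat and \<mu> :: "rvec measure" and W :: "rvec \<Rightarrow> rmat"
    assume d: "d \<ge> 1" and N: "N \<ge> 1" and \<mu>: "prob_on_RR d \<mu>"
      "\<forall>i<d. integrable \<mu> (\<lambda>x. (x i)\<^sup>2)" "\<forall>i<d. mean \<mu> i = 0" "\<forall>i<d. \<forall>j<d. cov \<mu> i j = id_mat i j"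
      and W: "optimal_weight d \<mu> W" "poincare_const d \<mu> W = 1"
    interpret poincare_weight d \<mu> W
      using \<mu> W by unfold_locales (auto simp: optimal_weight_def)
    let ?D = "\<lambda>i j x. \<bar>W x i j - id_mat i j\<bar> powr p"
    define I where "I = (\<integral>\<^sup>+x. ennreal (mat_norm_pow p d (\<lambda>i j. W x i j - id_mat i j)) \<partial>\<mu>)"
    have cpos: "0 < C * real d powr (1 - 2 / p) / sqrt (real N)"
      using C0 d N by simp
    show "wasserstein p d (normalized_sum_law d N \<mu>) (std_gaussian d)
      \<le> ennreal (C * real d powr (1 - 2 / p) / sqrt (real N)) *
         epowr (\<integral>\<^sup>+x. ennreal (mat_norm_pow p d (\<lambda>i j. W x i j - id_mat i j)) \<partial>\<mu>) (1 / p)"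
      unfolding I_def[symmetric]
    proof (cases "I = \<infinity>")
      case True
      \<comment> \<open>A product of 0 and infinity would be 0; positivity of the prefactor, from d
        >= 1 and N >= 1, is what makes the bound trivial here.\<close>
      have "ennreal x * \<infinity> = \<infinity>" if "x > 0" for x
        using that by (simp add: ennreal_mult_top)
      from this[OF cpos] True have "ennreal (C * real d powr (1 - 2 / p) / sqrt (real N)) * epowr I (1 / p) = \<infinity>"
        by (simp only: epowr_def simp_thms if_True)
      then show "wasserstein p d (normalized_sum_law d N \<mu>) (std_gaussian d)
        \<le> ennreal (C * real d powr (1 - 2 / p) / sqrt (real N)) * epowr I (1 / p)" by simp
    next
      case False
      have Wm: "(\<lambda>x. W x i j - id_mat i j) \<in> borel_measurable \<mu>" if "i < d" "j < d" for i j
        using W_measurable[OF that] by simp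
      \<comment> \<open>Each |W_ij - I_ij|^p is one summand of the p-th power of the matrix norm, so
        finiteness of \<open>I\<close> gives p-integrability of every entry.\<close>
      have WL: "in_Lp p \<mu> (\<lambda>x. W x i j - id_mat i j)" if ij: "i < d" "j < d" for i j
      proof -
        have "?D i j x \<le> mat_norm_pow p d (\<lambda>i j. W x i j - id_mat i j)" for x
        proof -
          have "?D i j x \<le> (\<Sum>j<d. ?D i j x)"
            using ij by (intro member_le_sum[where f = "\<lambda>j. ?D i j x"]) auto
          also have "\<dots> \<le> (\<Sum>i<d. \<Sum>j<d. ?D i j x)"
            using ij by (intro member_le_sum[where f = "\<lambda>i. \<Sum>j<d. ?D i j x"]) (auto intro: sum_nonneg)
          finally show ?thesis by (simp add: mat_norm_pow_def)
        qed
        then have "(\<integral>\<^sup>+x. ennreal (?D i j x) \<partial>\<mu>) \<le> I"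
          unfolding I_def by (intro nn_integral_mono ennreal_leI)
        also have "I < \<infinity>" using False by (simp add: less_top)
        finally show ?thesis unfolding in_Lp_def using Wm[OF ij]
          by (intro conjI integrableI_nonneg) auto
      qed
      interpret stein_sum d \<mu> W p N
        using assms N WL by unfold_locales auto
      define Q where "Q = (\<Sum>i<d. \<Sum>j<d. \<integral>x. ?D i j x \<partial>\<mu>)"
      have Q0: "Q \<ge> 0" unfolding Q_def by (intro sum_nonneg integral_nonneg_AE) auto
      have Di: "integrable \<mu> (?D i j)" if "i < d" "j < d" for i j
        using WL[OF that] by (simp add: in_Lp_def)
      have mi: "integrable \<mu> (\<lambda>x. mat_norm_pow p d (\<lambda>i j. W x i j - id_mat i j))"
        unfolding mat_norm_pow_def using Di by (intro Bochner_Integration.integrable_sum) auto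
      have "I = ennreal (\<integral>x. mat_norm_pow p d (\<lambda>i j. W x i j - id_mat i j) \<partial>\<mu>)"
        unfolding I_def by (intro nn_integral_eq_integral mi) (auto simp: mat_norm_pow_def intro!: sum_nonneg)
      also have "(\<integral>x. mat_norm_pow p d (\<lambda>i j. W x i j - id_mat i j) \<partial>\<mu>) = Q"
      proof -
        have "(\<integral>x. (\<Sum>i<d. \<Sum>j<d. ?D i j x) \<partial>\<mu>) = (\<Sum>i<d. \<integral>x. (\<Sum>j<d. ?D i j x) \<partial>\<mu>)"
          using Di by (intro Bochner_Integration.integral_sum Bochner_Integration.integrable_sum) auto
        also have "\<dots> = Q"
          unfolding Q_def using Di by (intro sum.cong refl Bochner_Integration.integral_sum) auto
        finally show ?thesis by (simp add: mat_norm_pow_def)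
      qed
      finally have IQ: "epowr I (1 / p) = ennreal (Q powr (1 / p))"
        using Q0 by (simp add: epowr_def)
      \<comment> \<open>Taking the p-th root factor by factor turns d^(p-2) into d^(1-2/p) and the
        power p/2 of \<open>orth_const p / real N\<close> into a square root.\<close>
      have "(A * real d powr (p - 2) * ((orth_const p / real N) powr (p / 2) * Q)) powr (1 / p)
          = A powr (1 / p) * (real d powr (p - 2)) powr (1 / p) * (((orth_const p / real N) powr (p / 2)) powr (1 / p) * Q powr (1 / p))"
        using A0 Q0 by (simp add: powr_mult)
      also have "(real d powr (p - 2)) powr (1 / p) = real d powr (1 - 2 / p)"
        using p0 by (simp add: powr_powr diff_divide_distrib)
      also have "((orth_const p / real N) powr (p / 2)) powr (1 / p) = sqrt (orth_const p / real N)"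
        using p0 K0 by (simp add: powr_powr powr_half_sqrt)
      also have "A powr (1 / p) * real d powr (1 - 2 / p) * (sqrt (orth_const p / real N) * Q powr (1 / p))
          = (A powr (1 / p) * sqrt (orth_const p)) * (real d powr (1 - 2 / p) / sqrt (real N) * Q powr (1 / p))"
        by (simp add: real_sqrt_divide)
      also have "\<dots> \<le> C * (real d powr (1 - 2 / p) / sqrt (real N) * Q powr (1 / p))"
        unfolding C_def by (intro mult_right_mono) auto
      finally have "wasserstein p d (normalized_sum_law d N \<mu>) (std_gaussian d)
          \<le> ennreal (C * real d powr (1 - 2 / p) / sqrt (real N) * Q powr (1 / p))"
        by (intro order_trans[OF wasserstein_normalized_sum_le] ennreal_leI) (simp add: A_def Q_def)
      also have "\<dots> = ennreal (C * real d powr (1 - 2 / p) / sqrt (real N)) * epowr I (1 / p)"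
        unfolding IQ using cpos by (intro ennreal_mult) auto
      finally show "wasserstein p d (normalized_sum_law d N \<mu>) (std_gaussian d)
        \<le> ennreal (C * real d powr (1 - 2 / p) / sqrt (real N)) * epowr I (1 / p)" .
    qed
  qed
qed

end
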